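(* Let $1\le s<2$, let $\Omega:S^1\to\mathbb{R}$ be smooth, strictly positive, with $\Omega(\theta+\pi)=\Omega(\theta)$ and $\Omega(\theta)=\Omega(-\theta)$, and let $W(\mathbf{x})=|\mathbf{x}|^{-s}\Omega(\theta)+|\mathbf{x}|^2$ on $\mathbb{R}^2$. Then the unique minimizer (up to translation) of the energy associated to $W$ is given by $\rho_{a,b}$ for some $a,b>0$.
   Context: $S^1=[-\pi,\pi)$ is the set of angles (mod $2\pi$); $\theta$ is the angle of $\mathbf{x}\in\mathbb{R}^2\setminus\{0\}$, i.e. $\mathbf{x}/|\mathbf{x}|=(\cos\theta,\sin\theta)$. The energy is $E[\rho]=\frac12\int_{\mathbb{R}^2}\int_{\mathbb{R}^2}W(\mathbf{x}-\mathbf{y})\rho(\mathbf{y})\,\mathrm{d}\mathbf{y}\,\rho(\mathbf{x})\,\mathrm{d}\mathbf{x}$ for probability measures $\rho$ on $\mathbb{R}^2$; minimizers are global minimizers among probability measures. $\rho_2(\mathbf{x})=C_2(R_2^2-|\mathbf{x}|^2)_+^{s/2}$ with $R_2=\Big(\frac{8\sin\frac{s\pi}{2}}{s^2(2+s)\pi}\Big)^{-\frac{1}{s+2}}$, $C_2=\frac{4\sin\frac{s\pi}{2}}{s^2\pi^2}$ (a probability density), and $\rho_{a,b}(\mathbf{x})=\frac{1}{ab}\rho_2\big(\frac{x_1}{a},\frac{x_2}{b}\big)$. *)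

theory Defs
  imports "HOL-Probability.Probability"
begin

definition smooth :: "(real \<Rightarrow> real) \<Rightarrow> bool" where
  "smooth f \<longleftrightarrow> (\<forall>n x. (deriv ^^ n) f differentiable (at x))"

text \<open>\<^const>\<open>Arg\<close> takes values in \<open>(-\<pi>, \<pi>]\<close> rather than \<open>[-\<pi>, \<pi>)\<close>; this makes no difference
  under a \<open>2\<pi>\<close>-periodic function of the angle.\<close>

definition polar_angle :: "real^2 \<Rightarrow> real" where
  "polar_angle x = Arg (Complex (x $ 1) (x $ 2))"

text \<open>Functions on the circle are periodic functions on the reals. At the origin the singular part
  takes its limit value \<open>\<infinity>\<close> (\<open>0 powr (-s)\<close> would be \<open>0\<close>), so measures with atoms have infinite
  energy. Values in \<^typ>\<open>ennreal\<close> lose nothing as long as \<open>\<Omega>\<close> is nonnegative.\<close>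

definition potential :: "real \<Rightarrow> (real \<Rightarrow> real) \<Rightarrow> real^2 \<Rightarrow> ennreal" where
  "potential s \<Omega> x =
     (if x = 0 then \<infinity>
      else ennreal (norm x powr (-s) * \<Omega> (polar_angle x) + (norm x)\<^sup>2))"

definition prob_measures :: "(real^2) measure set" where
  "prob_measures = {\<rho>. prob_space \<rho> \<and> sets \<rho> = sets borel}"

definition energy :: "(real^2 \<Rightarrow> ennreal) \<Rightarrow> (real^2) measure \<Rightarrow> ennreal" where
  "energy W \<rho> = (\<integral>\<^sup>+x. (\<integral>\<^sup>+y. W (x - y) \<partial>\<rho>) \<partial>\<rho>) / 2"

definition is_minimizer :: "(real^2 \<Rightarrow> ennreal) \<Rightarrow> (real^2) measure \<Rightarrow> bool" where
  "is_minimizer W \<rho> \<longleftrightarrow>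
     \<rho> \<in> prob_measures \<and> (\<forall>\<nu>\<in>prob_measures. energy W \<rho> \<le> energy W \<nu>)"

definition translate :: "real^2 \<Rightarrow> (real^2) measure \<Rightarrow> (real^2) measure" where
  "translate c \<rho> = distr \<rho> borel (\<lambda>x. x + c)"

definition unique_minimizer_up_to_translation ::
    "(real^2 \<Rightarrow> ennreal) \<Rightarrow> (real^2) measure \<Rightarrow> bool" where
  "unique_minimizer_up_to_translation W \<rho> \<longleftrightarrow>
     is_minimizer W \<rho> \<and> (\<forall>\<nu>. is_minimizer W \<nu> \<longrightarrow> (\<exists>c. \<nu> = translate c \<rho>))"

definition R2 :: "real \<Rightarrow> real" where
  "R2 s = (8 * sin (s * pi / 2) / (s\<^sup>2 * (2 + s) * pi)) powr (- (1 / (s + 2)))"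

definition C2 :: "real \<Rightarrow> real" where
  "C2 s = 4 * sin (s * pi / 2) / (s\<^sup>2 * pi\<^sup>2)"

definition rho2 :: "real \<Rightarrow> real^2 \<Rightarrow> real" where
  "rho2 s x = C2 s * (max 0 ((R2 s)\<^sup>2 - (norm x)\<^sup>2)) powr (s / 2)"

definition rho_ab :: "real \<Rightarrow> real \<Rightarrow> real \<Rightarrow> real^2 \<Rightarrow> real" where
  "rho_ab s a b x = 1 / (a * b) * rho2 s (vector [x $ 1 / a, x $ 2 / b])"

end

theory Submission
  imports Defs
begin

text \<open>
  The minimizer satisfies an explicitly solvable Euler--Lagrange condition, and it is the only one because
  the energy is strictly convex up to translations.

  \<^bold>\<open>Equilibrium.\<close> In the coordinates \<open>(r, r \<tau>)\<close> the singular kernel is \<open>|r| powr (- s)\<close> times a function of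
  the slope \<open>\<tau>\<close>, and the Jacobian is \<open>|r|\<close>. The singular potential of the profile
  \<open>(1 - u (y $ 1)^2 - v (y $ 2)^2)\<close> to the power \<open>s / 2\<close> is therefore a superposition, over the lines through
  \<open>x\<close>, of integrals of \<open>|r| powr (1 - s)\<close> against a power of a quadratic polynomial. For \<open>x\<close> inside the
  ellipse each of them is, by a substitution that leads to Beta integrals, a quadratic polynomial in \<open>x\<close>
  (\<open>chord_inside\<close>). Evenness of \<open>\<Omega>\<close> removes the mixed term, and \<open>u\<close>, \<open>v\<close> can be chosen such that the
  squares cancel the confinement \<open>|x|^2\<close> (\<open>exists_equilibrium_axes\<close>): the intermediate value theorem gives the
  ratio of the axes, a dilation their size. For \<open>x\<close> outside the ellipse each line contributes at least the
  same polynomial (\<open>chord_outside\<close>), so the total potential is smallest on the ellipse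
  (\<open>equilibrium_potential\<close>).

  \<^bold>\<open>Convexity.\<close> The isotropic kernel \<open>|x| powr (- s)\<close> is a mixture of Gaussians, which are convolution squares;
  it is strictly positive definite because Gaussian mollifications determine a measure (\<open>riesz_mix_strict\<close>).
  Composition with a linear map preserves positivity. Stretching the plane strongly in one direction
  concentrates the kernel near a line, and for \<open>s \<ge> 1\<close> the suitably normalised stretched kernels are an
  approximate identity in the angle (\<open>profile_approximation\<close>). Hence every kernel \<open>|x| powr (- s)\<close> times a
  continuous nonnegative function of the line through \<open>x\<close> is a limit of positive definite ones. Splitting
  a positive constant off \<open>\<Omega>\<close> gives strictness (\<open>riesz_strictly_pos_def\<close>).

  \<^bold>\<open>Comparison.\<close> A competitor of finite energy has a finite second moment and may be centred by a translation.
  For centred measures the quadratic part of the interaction satisfies the positive definiteness inequality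
  with equality, so the energies of the ellipse and of the competitor bound twice their mutual energy, which
  the Euler--Lagrange inequality bounds from below by twice the energy of the ellipse (\<open>energy_comparison\<close>).
\<close>

section \<open>The potential along a chord\<close>

text \<open>Change of variables without integrability hypotheses: if one side is not integrable, neither is the
  other, and both nonnegative integrals are infinite.\<close>

lemma nn_integral_change_of_variables:
  fixes f g g' :: "real \<Rightarrow> real"
  assumes f[measurable]: "f \<in> borel_measurable borel" and f0: "\<And>x. 0 \<le> f x"
    and S[measurable]: "S \<in> sets borel" and T[measurable]: "g ` S \<in> sets borel"
    and h[measurable]: "(\<lambda>z. indicator S z * (\<bar>g' z\<bar> * f (g z))) \<in> borel_measurable borel"
    and der: "\<And>z. z \<in> S \<Longrightarrow> (g has_field_derivative g' z) (at z within S)" and inj: "inj_on g S"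
  shows "(\<integral>\<^sup>+r. ennreal (indicator (g ` S) r * f r) \<partial>lborel) =
         (\<integral>\<^sup>+z. ennreal (indicator S z * (\<bar>g' z\<bar> * f (g z))) \<partial>lborel)" (is "?L = ?R")
proof -
  have S': "S \<in> sets lebesgue" by simp
  note cov = has_absolute_integral_change_of_variables_1'[OF S' der inj, of f]
  have ai: "u absolutely_integrable_on A \<longleftrightarrow> integrable lborel (\<lambda>x. indicator A x * u x)"
    "u absolutely_integrable_on A \<Longrightarrow> integral A u = integral\<^sup>L lborel (\<lambda>x. indicator A x * u x)"
    if "(\<lambda>x. indicator A x * u x) \<in> borel_measurable borel" for u :: "real \<Rightarrow> real" and A
  proof -
    show a: "u absolutely_integrable_on A \<longleftrightarrow> integrable lborel (\<lambda>x. indicator A x * u x)"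
      using that by (simp add: set_integrable_def integrable_completion)
    assume "u absolutely_integrable_on A"
    then show "integral A u = integral\<^sup>L lborel (\<lambda>x. indicator A x * u x)"
      using that by (simp add: set_lebesgue_integral_eq_integral(2)[symmetric] set_lebesgue_integral_def
        integral_completion)
  qed
  have mT: "(\<lambda>x. indicator (g ` S) x * f x) \<in> borel_measurable borel" by measurable
  have iff: "integrable lborel (\<lambda>x. indicator (g`S) x * f x) \<longleftrightarrow>
      integrable lborel (\<lambda>x. indicator S x * (\<bar>g' x\<bar> * f (g x)))"
    using cov ai(1)[OF mT] ai(1)[OF h] by blast
  show ?thesis
  proof (cases "integrable lborel (\<lambda>x. indicator (g`S) x * f x)")
    case True
    have "integral\<^sup>L lborel (\<lambda>x. indicator (g`S) x * f x) = integral\<^sup>L lborel (\<lambda>x. indicator S x * (\<bar>g' x\<bar> * f (g x)))"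
    proof -
      have A: "f absolutely_integrable_on g ` S" using ai(1)[OF mT] True by simp
      have B: "(\<lambda>x. \<bar>g' x\<bar> * f (g x)) absolutely_integrable_on S" using ai(1)[OF h] True iff by simp
      have "integral S (\<lambda>x. \<bar>g' x\<bar> * f (g x)) = integral (g ` S) f"
        using cov[of "integral (g ` S) f"] A by simp
      then show ?thesis using ai(2)[OF mT A] ai(2)[OF h B] by simp
    qed
    moreover have "?L = ennreal (integral\<^sup>L lborel (\<lambda>x. indicator (g`S) x * f x))"
      by (rule nn_integral_eq_integral[OF True]) (simp add: f0)
    moreover have "?R = ennreal (integral\<^sup>L lborel (\<lambda>x. indicator S x * (\<bar>g' x\<bar> * f (g x))))"
      using True iff by (intro nn_integral_eq_integral) (auto simp add: f0)
    ultimately show ?thesis by simp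
  next
    case False
    have inf: "(\<integral>\<^sup>+x. ennreal (u x) \<partial>lborel) = \<infinity>" if "\<not> integrable lborel u" "u \<in> borel_measurable borel" "\<And>x. 0 \<le> u x"
      for u :: "real \<Rightarrow> real"
    proof (rule ccontr)
      assume "(\<integral>\<^sup>+x. ennreal (u x) \<partial>lborel) \<noteq> \<infinity>"
      then have "integrable lborel u"
        using that by (intro integrableI_nonneg) (auto simp: top.not_eq_extremum)
      then show False using that by simp
    qed
    have "?L = \<infinity>" by (rule inf[OF False mT]) (simp add: f0)
    moreover have "?R = \<infinity>" using False iff by (intro inf h) (auto simp: f0)
    ultimately show ?thesis by simp
  qed
qed

lemma square_powr_half: "(a^2) powr (b / 2) = a powr b" if "a > 0" for a b :: real
proof -
  have "a^2 = a powr 2" using that by simp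
  then have "(a^2) powr (b / 2) = (a powr 2) powr (b / 2)" by (rule arg_cong)
  then show ?thesis by (simp only: powr_powr) simp
qed

lemma has_integral_Beta_Ioo:
  fixes a b c :: real
  assumes "a > 0" "b > 0" "c > 0"
  shows "((\<lambda>w. w powr (a - 1) * (c - w) powr (b - 1)) has_integral (c powr (a + b - 1) * Beta a b)) {0<..<c}"
proof -
  have "((\<lambda>t. t powr (a - 1) * (1 - t) powr (b - 1)) has_integral Beta a b) {0..1}"
    using assms by (intro has_integral_Beta_real)
  from has_integral_affinity'[OF this[folded cbox_interval], of "1/c" 0] assms
  have "((\<lambda>x. (x/c) powr (a - 1) * (1 - x/c) powr (b - 1)) has_integral c * Beta a b) {0..c}"
    by (simp add: divide_inverse mult.commute)
  from has_integral_mult_right[OF this, of "c powr (a+b-2)"]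
  have "((\<lambda>x. c powr (a+b-2) * ((x/c) powr (a - 1) * (1 - x/c) powr (b - 1))) has_integral c powr (a+b-2) * (c * Beta a b)) {0..c}" .
  moreover have "c powr (a+b-2) * (c * Beta a b) = c powr (a + b - 1) * Beta a b"
    using assms powr_mult_base[of c "a+b-2"] by (simp add: algebra_simps)
  ultimately have "((\<lambda>x. c powr (a+b-2) * ((x/c) powr (a - 1) * (1 - x/c) powr (b - 1))) has_integral c powr (a + b - 1) * Beta a b) {0<..<c}"
    by (simp add: has_integral_Icc_iff_Ioo)
  moreover have "c powr (a+b-2) * ((x/c) powr (a - 1) * (1 - x/c) powr (b - 1)) = x powr (a - 1) * (c - x) powr (b - 1)"
    if "x \<in> {0<..<c}" for x
  proof -
    have e: "1 - x/c = (c - x)/c" using assms by (simp add: field_simps)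
    have "c powr (a+b-2) = c powr (a-1) * c powr (b-1)" by (simp add: powr_add[symmetric] algebra_simps)
    moreover have "c powr (a-1) * (x/c) powr (a - 1) = x powr (a-1)"
      using assms that by (simp add: powr_divide)
    moreover have "c powr (b-1) * (1 - x/c) powr (b - 1) = (c-x) powr (b-1)"
      unfolding e using assms that by (simp add: powr_divide)
    ultimately show ?thesis by (simp add: mult.assoc) (metis mult.assoc mult.commute)
  qed
  ultimately show ?thesis by (rule has_integral_eq[rotated])
qed

text \<open>The contribution of one line through a point \<open>x\<close> to the singular potential of an ellipse: along the
  line, with parameter \<open>r\<close> measured from \<open>x\<close>, the quadratic form of the ellipse reads
  \<open>p + 2 q r - m r^2\<close>, and \<open>|r| powr (1 - s)\<close> is the kernel \<open>|r| powr (- s)\<close> times the Jacobian \<open>|r|\<close>.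
  The point lies inside the ellipse precisely when \<open>p > 0\<close>.\<close>

definition chord :: "real \<Rightarrow> real \<Rightarrow> real \<Rightarrow> real \<Rightarrow> ennreal" where
  "chord s p q m = (\<integral>\<^sup>+r. ennreal (\<bar>r\<bar> powr (1 - s) * (max 0 (p + 2 * q * r - m * r^2)) powr (s / 2)) \<partial>lborel)"

definition chord_const :: "real \<Rightarrow> real" where
  "chord_const s = Beta (1 - s / 2) (1 + s / 2)"

lemma chord_const_pos: "0 < s \<Longrightarrow> s < 2 \<Longrightarrow> chord_const s > 0"
  by (simp add: chord_const_def Beta_def Gamma_real_pos)

lemma Beta_edge: "0 < s \<Longrightarrow> s < 2 \<Longrightarrow> Beta (2 - s / 2) (1 + s / 2) = (2 - s) / 4 * chord_const s"
proof -
  assume "0 < s" "s < 2"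
  then have "1 - s/2 \<notin> \<int>\<^sub>\<le>\<^sub>0" by (auto elim!: nonpos_Ints_cases)
  from Beta_plus1_left[OF this, of "1 + s/2"] show ?thesis
    by (simp add: chord_const_def algebra_simps)
qed

context
  fixes s p m :: real
  assumes s: "1 \<le> s" "s < 2" and p: "p > 0" and m: "m > 0"
begin

text \<open>The substitution that evaluates the chord integral for \<open>p > 0\<close>. It is the positive solution \<open>r\<close> of
  \<open>z = m r^2 / (p + 2 q r)\<close>, so that \<open>z\<close> runs through \<open>(0, 1)\<close> while \<open>r\<close> runs from the base point to the end
  of the chord, and \<open>p + 2 q r - m r^2 = m r^2 (1 - z) / z\<close>. In the new variable the integrand on the
  half-line depends on \<open>r\<close> only through \<open>r dr\<close>.\<close>

definition chord_point :: "real \<Rightarrow> real \<Rightarrow> real" where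
  "chord_point q z = (q * z + sqrt (q^2 * z^2 + m * p * z)) / m"

definition chord_point_deriv :: "real \<Rightarrow> real \<Rightarrow> real" where
  "chord_point_deriv q z = (q + (2 * q^2 * z + m * p) / (2 * sqrt (q^2 * z^2 + m * p * z))) / m"

lemma chord_point_pos: "z > 0 \<Longrightarrow> chord_point q z > 0"
proof -
  assume z: "z > 0"
  have "\<bar>q * z\<bar> = sqrt (q^2 * z^2)" by (simp add: power_mult_distrib[symmetric])
  also have "\<dots> < sqrt (q^2 * z^2 + m * p * z)" using z p m by simp
  finally show ?thesis using m by (simp add: chord_point_def)
qed

lemma chord_point_eq: assumes "z > 0" shows "m * (chord_point q z)^2 = z * (p + 2 * q * chord_point q z)"
proof -
  let ?S = "sqrt (q^2 * z^2 + m * p * z)"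
  have S: "?S^2 = q^2 * z^2 + m * p * z" using assms p m by simp
  show ?thesis using m S unfolding chord_point_def
    by (simp add: field_simps power2_eq_square)
qed

lemma has_derivative_chord_point: "z > 0 \<Longrightarrow> (chord_point q has_field_derivative chord_point_deriv q z) (at z within A)"
proof -
  assume z: "z > 0"
  have "q^2 * z^2 + m * p * z > 0" using z p m by (simp add: add_nonneg_pos)
  then show ?thesis unfolding chord_point_def[abs_def] chord_point_deriv_def
    using m by (auto intro!: derivative_eq_intros simp: field_simps)
qed

lemma chord_point_deriv_nonneg: "z > 0 \<Longrightarrow> chord_point_deriv q z \<ge> 0"
proof -
  assume z: "z > 0"
  let ?S = "sqrt (q^2 * z^2 + m * p * z)"
  have P: "q^2 * z^2 + m * p * z > 0" using z p m by (simp add: add_nonneg_pos)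
  have "(2 * \<bar>q\<bar> * ?S)^2 = 4 * q^2 * (q^2 * z^2 + m * p * z)"
    using P by (simp add: power_mult_distrib)
  also have "\<dots> \<le> (2 * q^2 * z + m * p)^2"
    by (simp add: power2_eq_square algebra_simps) (simp add: mult.assoc[symmetric] zero_le_square flip: power2_eq_square)
  finally have "2 * \<bar>q\<bar> * ?S \<le> 2 * q^2 * z + m * p"
    using z p m by (intro power2_le_imp_le[of "2 * \<bar>q\<bar> * ?S"]) auto
  then have "\<bar>q\<bar> \<le> (2 * q^2 * z + m * p) / (2 * ?S)" using P by (simp add: field_simps)
  then show ?thesis using m by (simp add: chord_point_deriv_def)
qed

text \<open>The reason why both half-lines together give a Beta integral: the square root enters the solutions
  for \<open>q\<close> and \<open>- q\<close> with opposite cross terms, so the sum of their squares is polynomial in \<open>z\<close>.\<close>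

lemma chord_point_mult_deriv: "z > 0 \<Longrightarrow> chord_point q z * chord_point_deriv q z + chord_point (-q) z * chord_point_deriv (-q) z = 4 * q^2 * z / m^2 + p / m"
proof -
  assume z: "z > 0"
  let ?S = "sqrt (q^2 * z^2 + m * p * z)"
  have S: "?S^2 = q^2 * z^2 + m * p * z" "?S > 0" using z p m by (auto simp: add_nonneg_pos)
  define R where "R = ?S"
  define t where "t = (2 * q^2 * z + m * p) / (2 * R)"
  have Rt: "R * t = q * q * z + m * p / 2" using S by (simp add: R_def t_def field_simps power2_eq_square)
  have "chord_point q z * chord_point_deriv q z + chord_point (-q) z * chord_point_deriv (-q) z = (2 * q * q * z + 2 * (R * t)) / (m * m)"
    unfolding chord_point_def chord_point_deriv_def R_def[symmetric] power2_minus t_def[symmetric] using m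
    by (simp add: field_simps)
  also have "\<dots> = 4 * q^2 * z / m^2 + p / m"
    using m unfolding Rt by (simp add: field_simps power2_eq_square)
  finally show ?thesis .
qed

lemma chord_point_image: "chord_point q ` {0<..<1} = {r. 0 < r \<and> 0 < p + 2 * q * r - m * r^2}"
proof safe
  fix z :: real assume z: "z \<in> {0<..<1}"
  then show "0 < chord_point q z" by (auto intro: chord_point_pos)
  have "m * (chord_point q z)^2 > 0" using z m chord_point_pos[of z q] by simp
  then have "z * (p + 2 * q * chord_point q z) > 0" using chord_point_eq[of z q] z by simp
  then have "0 < (1 - z) * (p + 2 * q * chord_point q z)" using z by (simp add: zero_less_mult_iff)
  then show "0 < p + 2 * q * chord_point q z - m * (chord_point q z)^2"
    using chord_point_eq[of z q] z by (simp add: algebra_simps)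
next
  fix r assume r: "0 < r" "0 < p + 2 * q * r - m * r^2"
  have mr: "m * r^2 > 0" using r m by simp
  define w where "w = p + 2 * q * r"
  have w: "w > 0" using mr r by (simp add: w_def)
  define z where "z = m * r^2 / w"
  have z: "0 < z" "z < 1" using mr r w by (auto simp: z_def w_def[symmetric])
  have zw: "z * w = m * r^2" using w by (simp add: z_def)
  have "(m * r - q * z) = m * r * (p + q * r) / w"
    using w by (simp add: z_def field_simps power2_eq_square w_def)
  moreover have "p + q * r \<ge> 0" using w p by (simp add: w_def)
  ultimately have nn: "m * r - q * z \<ge> 0" using w m r by simp
  have "(m * r - q * z)^2 = q^2 * z^2 + m * p * z"
  proof -
    have "m * (z * w) = m * (m * r^2)" using zw by simp
    then show ?thesis unfolding w_def by (simp add: power2_eq_square algebra_simps)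
  qed
  then have "sqrt (q^2 * z^2 + m * p * z) = m * r - q * z"
    using nn real_sqrt_unique by blast
  then have "chord_point q z = r" using m by (simp add: chord_point_def)
  then show "r \<in> chord_point q ` {0<..<1}" using z by (intro image_eqI[of _ _ z]) auto
qed

lemma chord_point_inj: "inj_on (chord_point q) {0<..<1}"
proof (rule inj_onI)
  fix y z assume yz: "y \<in> {0<..<1}" "z \<in> {0<..<1}" "chord_point q y = chord_point q z"
  have "m * (chord_point q z)^2 = y * (p + 2 * q * chord_point q z)"
    using chord_point_eq[of y q] yz by simp
  moreover have "m * (chord_point q z)^2 = z * (p + 2 * q * chord_point q z)"
    using chord_point_eq[of z q] yz by simp
  ultimately have "y * (p + 2 * q * chord_point q z) = z * (p + 2 * q * chord_point q z)" by (rule trans[OF sym])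
  moreover have "m * (chord_point q z)^2 > 0" using yz m chord_point_pos[of z q] by simp
  then have "z * (p + 2 * q * chord_point q z) > 0" using chord_point_eq[of z q] yz by simp
  then have "p + 2 * q * chord_point q z \<noteq> 0" by auto
  ultimately show "y = z" by (metis mult_right_cancel)
qed

definition half_chord :: "real \<Rightarrow> real \<Rightarrow> real" where
  "half_chord q z = m powr (s/2) * ((1 - z) / z) powr (s/2) * (chord_point q z * chord_point_deriv q z)"

lemma half_chord_integral:
  "(\<integral>\<^sup>+r. ennreal (indicator {0<..} r * (\<bar>r\<bar> powr (1 - s) * (max 0 (p + 2 * q * r - m * r^2)) powr (s / 2))) \<partial>lborel)
   = (\<integral>\<^sup>+z. ennreal (indicator {0<..<1} z * half_chord q z) \<partial>lborel)"
proof -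
  let ?f = "\<lambda>r. \<bar>r\<bar> powr (1 - s) * (max 0 (p + 2 * q * r - m * r^2)) powr (s / 2)"
  have eq: "\<bar>chord_point_deriv q z\<bar> * ?f (chord_point q z) = half_chord q z" if z: "z \<in> {0<..<1}" for z
  proof -
    let ?G = "chord_point q z"
    have G: "?G > 0" using z chord_point_pos by auto
    have D: "p + 2 * q * ?G - m * ?G^2 = m * ?G^2 * ((1 - z) / z)"
      using chord_point_eq[of z q] z by (simp add: field_simps)
    have pos: "m * ?G^2 * ((1 - z) / z) > 0" using z m G by simp
    have "(max 0 (p + 2 * q * ?G - m * ?G^2)) powr (s / 2) = m powr (s/2) * (?G^2) powr (s/2) * ((1 - z) / z) powr (s/2)"
      unfolding D using pos z m G by (simp add: powr_mult powr_divide max_def)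
    moreover have "(?G^2) powr (s/2) = ?G powr s" using square_powr_half[OF G, of s] by simp
    moreover have "?G powr (1 - s) * ?G powr s = ?G" using G by (simp add: powr_add[symmetric])
    ultimately show ?thesis using chord_point_deriv_nonneg[of z q] z G unfolding half_chord_def
      by (simp add: ac_simps)
  qed
  have meas: "(\<lambda>z. indicator {0<..<1} z * (\<bar>chord_point_deriv q z\<bar> * ?f (chord_point q z))) \<in> borel_measurable borel"
    unfolding chord_point_def[abs_def] chord_point_deriv_def[abs_def] by measurable
  have im: "chord_point q ` {0<..<1} \<in> sets borel" unfolding chord_point_image by measurable
  have "(\<integral>\<^sup>+r. ennreal (indicator {0<..} r * ?f r) \<partial>lborel) = (\<integral>\<^sup>+r. ennreal (indicator (chord_point q ` {0<..<1}) r * ?f r) \<partial>lborel)"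
    unfolding chord_point_image by (intro nn_integral_cong) (auto simp: indicator_def)
  also have "\<dots> = (\<integral>\<^sup>+z. ennreal (indicator {0<..<1} z * (\<bar>chord_point_deriv q z\<bar> * ?f (chord_point q z))) \<partial>lborel)"
    by (rule nn_integral_change_of_variables[OF _ _ _ im meas _ chord_point_inj]) (auto intro!: has_derivative_chord_point)
  also have "\<dots> = (\<integral>\<^sup>+z. ennreal (indicator {0<..<1} z * half_chord q z) \<partial>lborel)"
    by (intro nn_integral_cong) (use eq in \<open>auto simp: indicator_def\<close>)
  finally show ?thesis .
qed

lemma half_chord_nonneg: "z > 0 \<Longrightarrow> z < 1 \<Longrightarrow> half_chord q z \<ge> 0"
  unfolding half_chord_def using chord_point_deriv_nonneg[of z q] chord_point_pos[of z q] by simp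

text \<open>The value on chords through an interior point. After the substitution only the Beta integrals with
  exponents \<open>- s/2, s/2\<close> and \<open>1 - s/2, s/2\<close> remain. The point of the formula is that it is a quadratic
  polynomial in the base point, since \<open>p\<close> is quadratic and \<open>q\<close> is affine in it.\<close>

lemma chord_inside:
  "chord s p q m = ennreal (chord_const s * m powr (s/2 - 1) * (p + (2 - s) * q^2 / m))"
proof -
  let ?f = "\<lambda>q r. \<bar>r\<bar> powr (1 - s) * (max 0 (p + 2 * q * r - m * r^2)) powr (s / 2)"
  have [measurable]: "half_chord q \<in> borel_measurable borel" for q
    unfolding half_chord_def[abs_def] chord_point_def[abs_def] chord_point_deriv_def[abs_def] by measurable
  have "chord s p q m = (\<integral>\<^sup>+r. ennreal (indicator {0<..} r * ?f q r) + ennreal (indicator {..<0} r * ?f q r) \<partial>lborel)"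
    unfolding chord_def using AE_lborel_singleton[of "0::real"]
    by (intro nn_integral_cong_AE) (auto elim!: eventually_mono simp: indicator_def)
  also have "\<dots> = (\<integral>\<^sup>+r. ennreal (indicator {0<..} r * ?f q r) \<partial>lborel) + (\<integral>\<^sup>+r. ennreal (indicator {..<0} r * ?f q r) \<partial>lborel)"
    by (rule nn_integral_add) measurable
  also have "(\<integral>\<^sup>+r. ennreal (indicator {..<0} r * ?f q r) \<partial>lborel) = (\<integral>\<^sup>+r. ennreal (indicator {0<..} r * ?f (-q) r) \<partial>lborel)"
    by (subst nn_integral_real_affine[where c="-1" and t=0]) (auto simp: indicator_def intro!: nn_integral_cong)
  also have "(\<integral>\<^sup>+r. ennreal (indicator {0<..} r * ?f q r) \<partial>lborel) + (\<integral>\<^sup>+r. ennreal (indicator {0<..} r * ?f (-q) r) \<partial>lborel)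
     = (\<integral>\<^sup>+z. ennreal (indicator {0<..<1} z * half_chord q z) + ennreal (indicator {0<..<1} z * half_chord (-q) z) \<partial>lborel)"
    unfolding half_chord_integral by (rule nn_integral_add[symmetric]) measurable
  also have "\<dots> = (\<integral>\<^sup>+z. indicator {0<..<1} z * (m powr (s/2) * (p / m * (z powr ((1 - s/2) - 1) * (1 - z) powr ((1 + s/2) - 1))
       + 4 * q^2 / m^2 * (z powr ((2 - s/2) - 1) * (1 - z) powr ((1 + s/2) - 1)))) \<partial>lborel)"
  proof (intro nn_integral_cong)
    fix z :: real
    show "ennreal (indicator {0<..<1} z * half_chord q z) + ennreal (indicator {0<..<1} z * half_chord (-q) z) =
      ennreal (indicator {0<..<1} z * (m powr (s/2) * (p / m * (z powr ((1 - s/2) - 1) * (1 - z) powr ((1 + s/2) - 1))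
       + 4 * q^2 / m^2 * (z powr ((2 - s/2) - 1) * (1 - z) powr ((1 + s/2) - 1)))))"
    proof (cases "z \<in> {0<..<1}")
      case True
      have "z powr (1 - s/2) = z powr (- (s/2)) * z" using True by (simp add: powr_add[symmetric] powr_mult_base mult.commute)
      moreover have "((1 - z) / z) powr (s/2) = z powr (- (s/2)) * (1 - z) powr (s/2)"
        using True by (simp add: powr_divide powr_minus_divide)
      moreover have "half_chord q z + half_chord (-q) z = m powr (s/2) * ((1 - z) / z) powr (s/2) * (4 * q^2 * z / m^2 + p / m)"
        unfolding half_chord_def using chord_point_mult_deriv[of z q] True by (simp add: distrib_left[symmetric])
      ultimately have "half_chord q z + half_chord (-q) z = m powr (s/2) * (p / m * (z powr ((1 - s/2) - 1) * (1 - z) powr ((1 + s/2) - 1))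
       + 4 * q^2 / m^2 * (z powr ((2 - s/2) - 1) * (1 - z) powr ((1 + s/2) - 1)))"
        by (simp add: algebra_simps)
      then show ?thesis using True half_chord_nonneg[of z q] half_chord_nonneg[of z "-q"]
        by (simp add: ennreal_plus[symmetric] del: ennreal_plus)
    qed simp
  qed
  also have "\<dots> = ennreal (m powr (s/2) * (p / m * chord_const s + 4 * q^2 / m^2 * ((2 - s) / 4 * chord_const s)))"
  proof (rule nn_integral_has_integral_lebesgue)
    have 1: "((\<lambda>z. z powr ((1 - s/2) - 1) * (1 - z) powr ((1 + s/2) - 1)) has_integral chord_const s) {0<..<1}"
      using has_integral_Beta_Ioo[of "1 - s/2" "1 + s/2" 1] s by (simp add: chord_const_def)
    have 2: "((\<lambda>z. z powr ((2 - s/2) - 1) * (1 - z) powr ((1 + s/2) - 1)) has_integral ((2 - s) / 4 * chord_const s)) {0<..<1}"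
      using has_integral_Beta_Ioo[of "2 - s/2" "1 + s/2" 1] s Beta_edge[of s] by simp
    show "((\<lambda>z. m powr (s/2) * (p / m * (z powr ((1 - s/2) - 1) * (1 - z) powr ((1 + s/2) - 1))
       + 4 * q^2 / m^2 * (z powr ((2 - s/2) - 1) * (1 - z) powr ((1 + s/2) - 1)))) has_integral
       (m powr (s/2) * (p / m * chord_const s + 4 * q^2 / m^2 * ((2 - s) / 4 * chord_const s)))) {0<..<1}"
      by (intro has_integral_mult_right has_integral_add 1 2)
  qed (use p m in auto)
  also have "m powr (s/2) * (p / m * chord_const s + 4 * q^2 / m^2 * ((2 - s) / 4 * chord_const s)) =
     chord_const s * m powr (s/2 - 1) * (p + (2 - s) * q^2 / m)"
  proof -
    have "m powr (s/2) = m * m powr (s/2 - 1)" using m by (simp add: powr_mult_base)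
    then show ?thesis using m by (simp add: field_simps power2_eq_square)
  qed
  finally show ?thesis .
qed

end

lemma chord_uminus: "chord s p (- q) m = chord s p q m"
  unfolding chord_def
  by (subst nn_integral_real_affine[where c="-1" and t=0]) auto

text \<open>A convex function lies above its tangent at \<open>w\<close>.\<close>

lemma powr_tangent:
  fixes w d a :: real
  assumes "w > 0" "d \<ge> 0" "a \<le> 0"
  shows "w powr a + a * d * w powr (a - 1) \<le> (w + d) powr a"
proof -
  have x: "1 + d / w > 0" using assms by (simp add: add_pos_nonneg)
  have "1 + a * (d / w) \<le> 1 + a * ln (1 + d / w)"
    using mult_left_mono_neg[of "ln (1 + d / w)" "d / w" a] assms ln_le_minus_one[OF x] by simp
  also have "\<dots> \<le> (1 + d / w) powr a"
    using x exp_ge_add_one_self[of "a * ln (1 + d / w)"] by (auto simp: powr_def)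
  finally have "w powr a * (1 + a * (d / w)) \<le> w powr a * (1 + d / w) powr a"
    by (intro mult_left_mono) auto
  also have "\<dots> = (w * (1 + d / w)) powr a" using assms x by (simp add: powr_mult)
  also have "w * (1 + d / w) = w + d" using assms by (simp add: field_simps)
  finally show ?thesis using assms by (simp add: powr_diff field_simps)
qed

text \<open>For a base point outside the ellipse the chord integral dominates the polynomial that gives its value
  inside. If the line misses the ellipse, the polynomial is nonpositive. Otherwise let \<open>c\<close> be the distance
  from the base point to the midpoint of the chord and \<open>h\<close> its half-length; since the kernel is convex on
  the chord, it is at least its tangent at the position \<open>c = h\<close>, where the base point is an end of the
  chord, and the integrated tangent exceeds the polynomial by a multiple of \<open>(s - 1) (c - h)^2\<close>.\<close>

lemma chord_outside:
  assumes s: "1 \<le> s" "s < 2" and p: "p \<le> 0" and m: "m > 0"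
  shows "ennreal (chord_const s * m powr (s/2 - 1) * (p + (2 - s) * q^2 / m)) \<le> chord s p q m"
proof -
  have main: "ennreal (chord_const s * m powr (s/2 - 1) * (p + (2 - s) * q^2 / m)) \<le> chord s p q m" if q: "q \<ge> 0" for q
  proof (cases "p + q^2 / m \<le> 0")
    case True
    have "(2 - s) * q^2 / m \<le> q^2 / m" using s m by (intro divide_right_mono) (auto intro: mult_left_le_one_le)
    then have "p + (2 - s) * q^2 / m \<le> 0" using True by simp
    moreover have "chord_const s * m powr (s/2 - 1) \<ge> 0" using chord_const_pos[of s] s by simp
    ultimately have "chord_const s * m powr (s/2 - 1) * (p + (2 - s) * q^2 / m) \<le> 0"
      by (simp add: mult_nonneg_nonpos)
    then show ?thesis by (simp add: ennreal_neg)
  next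
    case False
    define c where "c = q / m"
    define h where "h = sqrt (c^2 + p / m)"
    \<comment> \<open>the distance from the base point to the nearer end of the chord\<close>
    define d where "d = c - h"
    let ?k = "chord_const s"
    have "c^2 + p / m = (p + q^2 / m) / m" using m by (simp add: c_def field_simps power2_eq_square)
    then have pos: "c^2 + p / m > 0" using False m by simp
    then have h2: "h^2 = c^2 + p / m" "h > 0" by (auto simp: h_def)
    have "h^2 \<le> c^2" using h2 p m by (simp add: divide_nonpos_pos)
    then have d: "d \<ge> 0" using q m unfolding d_def by (auto simp: c_def intro: power2_le_imp_le)
    have quad: "p + 2 * q * (w + d) - m * (w + d)^2 = m * (w * (2 * h - w))" for w
    proof -
      have P: "p = m * (h^2 - c^2)" "q = m * c" using m h2 by (auto simp: c_def field_simps)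
      show ?thesis unfolding P d_def by (simp add: algebra_simps power2_eq_square)
    qed
    \<comment> \<open>the integrand on the chord in the variable \<open>w = r - d\<close>, and the two terms of its tangent bound\<close>
    define F where "F w = indicator {0<..<2*h} w * (\<bar>w + d\<bar> powr (1 - s) * (max 0 (m * (w * (2 * h - w)))) powr (s / 2))" for w
    define G1 where "G1 w = m powr (s/2) * (w powr ((2 - s/2) - 1) * (2 * h - w) powr ((1 + s/2) - 1))" for w
    define G2 where "G2 w = m powr (s/2) * (s - 1) * d * (w powr ((1 - s/2) - 1) * (2 * h - w) powr ((1 + s/2) - 1))" for w
    have [measurable]: "F \<in> borel_measurable borel" "G1 \<in> borel_measurable borel" "G2 \<in> borel_measurable borel"
      unfolding F_def[abs_def] G1_def[abs_def] G2_def[abs_def] by measurable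
    have I1: "(G1 has_integral (m powr (s/2) * ((2 * h)^2 * ((2 - s) / 4 * ?k)))) {0<..<2*h}"
      unfolding G1_def using has_integral_Beta_Ioo[of "2 - s/2" "1 + s/2" "2 * h"] s h2 Beta_edge[of s]
      by (intro has_integral_mult_right) (simp add: powr_numeral)
    have I2: "(G2 has_integral (m powr (s/2) * (s - 1) * d * ((2 * h) * ?k))) {0<..<2*h}"
      unfolding G2_def using has_integral_Beta_Ioo[of "1 - s/2" "1 + s/2" "2 * h"] s h2
      by (intro has_integral_mult_right) (simp add: chord_const_def)
    have G0: "0 \<le> G1 w" "0 \<le> G2 w" for w using s d by (auto simp: G1_def G2_def)
    have le: "indicator {0<..<2*h} w * G1 w \<le> F w + indicator {0<..<2*h} w * G2 w" for w
    proof (cases "w \<in> {0<..<2*h}")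
      case True
      then have w: "w > 0" "2 * h - w > 0" by auto
      have "w powr (1 - s) + (1 - s) * d * w powr (1 - s - 1) \<le> (w + d) powr (1 - s)"
        using powr_tangent[of w d "1 - s"] w d s by simp
      then have "m powr (s/2) * (w powr (s/2) * (2 * h - w) powr (s/2)) * (w powr (1 - s) + (1 - s) * d * w powr (1 - s - 1))
          \<le> m powr (s/2) * (w powr (s/2) * (2 * h - w) powr (s/2)) * (w + d) powr (1 - s)"
        by (intro mult_left_mono) auto
      also have "\<dots> = F w" using w d m True by (simp add: F_def powr_mult max_def not_less)
      finally have "m powr (s/2) * (w powr (s/2) * (2 * h - w) powr (s/2)) * (w powr (1 - s) + (1 - s) * d * w powr (1 - s - 1)) \<le> F w" .
      moreover have "w powr (s/2) * w powr (1 - s) = w powr ((2 - s/2) - 1)"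
        "w powr (s/2) * w powr (1 - s - 1) = w powr ((1 - s/2) - 1)"
        using w by (auto simp: powr_add[symmetric] intro!: arg_cong[where f="\<lambda>x. w powr x"])
      moreover have "m powr (s/2) * (w powr (s/2) * (2 * h - w) powr (s/2)) * (w powr (1 - s) + (1 - s) * d * w powr (1 - s - 1))
         = m powr (s/2) * ((w powr (s/2) * w powr (1 - s)) * (2 * h - w) powr (s/2))
          - m powr (s/2) * (s - 1) * d * ((w powr (s/2) * w powr (1 - s - 1)) * (2 * h - w) powr (s/2))"
        by (simp add: algebra_simps)
      ultimately show ?thesis using True by (simp add: G1_def G2_def)
    qed (simp add: F_def)
    define a where "a = m powr (s/2) * ((2 * h)^2 * ((2 - s) / 4 * ?k))"
    define b where "b = m powr (s/2) * (s - 1) * d * ((2 * h) * ?k)"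
    have k: "?k > 0" using chord_const_pos s by simp
    have b0: "b \<ge> 0" using k s d h2 by (simp add: b_def)
    have "ennreal a = (\<integral>\<^sup>+w. ennreal (indicator {0<..<2*h} w * G1 w) \<partial>lborel)"
      using nn_integral_has_integral_lebesgue[OF G0(1) I1] by (simp add: a_def)
    also have "\<dots> \<le> (\<integral>\<^sup>+w. ennreal (F w) + ennreal (indicator {0<..<2*h} w * G2 w) \<partial>lborel)"
      using le G0 by (intro nn_integral_mono) (auto simp: F_def simp flip: ennreal_plus intro!: ennreal_leI)
    also have "\<dots> = (\<integral>\<^sup>+w. ennreal (F w) \<partial>lborel) + (\<integral>\<^sup>+w. ennreal (indicator {0<..<2*h} w * G2 w) \<partial>lborel)"
      by (rule nn_integral_add) measurable
    also have "(\<integral>\<^sup>+w. ennreal (indicator {0<..<2*h} w * G2 w) \<partial>lborel) = ennreal b"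
      using nn_integral_has_integral_lebesgue[OF G0(2) I2] by (simp add: b_def)
    also have "(\<integral>\<^sup>+w. ennreal (F w) \<partial>lborel) \<le> chord s p q m"
    proof -
      have "chord s p q m = (\<integral>\<^sup>+w. ennreal (\<bar>w + d\<bar> powr (1 - s) * (max 0 (m * (w * (2 * h - w)))) powr (s / 2)) \<partial>lborel)"
        unfolding chord_def by (subst nn_integral_real_affine[where c=1 and t=d]) (auto simp: quad[symmetric] add.commute)
      then show ?thesis by (auto simp: F_def indicator_def intro!: nn_integral_mono)
    qed
    finally have "ennreal a \<le> chord s p q m + ennreal b" by simp
    then have "ennreal (a - b) \<le> chord s p q m" using b0
      by (simp add: ennreal_minus[symmetric] ennreal_minus_le_iff add.commute)
    moreover have "?k * m powr (s/2 - 1) * (p + (2 - s) * q^2 / m) \<le> a - b"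
    proof -
      have mm: "m powr (s/2) = m * m powr (s/2 - 1)" using m by (simp add: powr_mult_base)
      have P: "p = m * (h^2 - c^2)" "q = m * c" using m h2 by (auto simp: c_def field_simps)
      have "a - b - ?k * m powr (s/2 - 1) * (p + (2 - s) * q^2 / m) = m * m powr (s/2 - 1) * ?k * ((s - 1) * d^2)"
        unfolding a_def b_def mm P using m by (simp add: d_def field_simps power2_eq_square)
      also have "\<dots> \<ge> 0" using m k s by simp
      finally show ?thesis by simp
    qed
    ultimately show ?thesis by (meson ennreal_leI order_trans)
  qed
  show ?thesis using main[of q] main[of "-q"] by (cases "q \<ge> 0") (auto simp: chord_uminus)
qed

section \<open>Slope coordinates in the plane\<close>

lemma periodic_int:
  fixes f :: "real \<Rightarrow> 'a"
  assumes "\<And>t. f (t + pi) = f t"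
  shows "f (t + of_int n * pi) = f t"
proof (induction n rule: int_induct[of _ 0])
  case (step1 i)
  have "t + of_int (i + 1) * pi = (t + of_int i * pi) + pi" by (simp add: algebra_simps)
  then show ?case using assms step1 by metis
next
  case (step2 i)
  have "t + of_int i * pi = (t + of_int (i - 1) * pi) + pi" by (simp add: algebra_simps)
  then show ?case using assms step2 by metis
qed auto

lemma periodic_bounds:
  fixes f :: "real \<Rightarrow> real"
  assumes per: "\<And>t. f (t + pi) = f t" and cont: "continuous_on UNIV f" and pos: "\<And>t. f t > 0"
  obtains \<delta> B where "\<delta> > 0" "B > 0" "\<And>t. \<delta> \<le> f t" "\<And>t. f t \<le> B"
proof -
  have c: "continuous_on {0..pi} f" using cont continuous_on_subset by blast
  obtain a b where a: "\<forall>y\<in>{0..pi}. f a \<le> f y" and b: "\<forall>y\<in>{0..pi}. f y \<le> f b"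
    using continuous_attains_inf[OF compact_Icc _ c] continuous_attains_sup[OF compact_Icc _ c] by fastforce
  have red: "\<exists>y\<in>{0..pi}. f t = f y" for t
  proof -
    let ?y = "t + of_int (- \<lfloor>t / pi\<rfloor>) * pi"
    have "?y \<in> {0..pi}" using floor_divide_lower[of pi t] floor_divide_upper[of pi t] by (simp add: algebra_simps)
    then show ?thesis using periodic_int[of f, OF per] by metis
  qed
  show ?thesis
  proof (rule that[of "f a" "f b"])
    show "f a \<le> f t" "f t \<le> f b" for t using red[of t] a b by auto
  qed (use pos in auto)
qed

lemma polar_angle_coords:
  assumes "x \<noteq> 0"
  shows "x $ 1 = norm x * cos (polar_angle x)" "x $ 2 = norm x * sin (polar_angle x)"
proof -
  have n: "norm x = cmod (Complex (x $ 1) (x $ 2))"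
    by (simp add: norm_vec_def L2_set_def UNIV_2 cmod_def)
  have nz: "Complex (x $ 1) (x $ 2) \<noteq> 0"
    using assms by (auto simp: vec_eq_iff complex_eq_iff forall_2)
  show "x $ 1 = norm x * cos (polar_angle x)" "x $ 2 = norm x * sin (polar_angle x)"
    unfolding polar_angle_def cos_Arg[OF nz] sin_Arg[OF nz] n using nz by auto
qed

text \<open>A \<open>\<pi>\<close>-periodic function of the angle is a function of the line through the point; \<open>t\<close> may be any
  angle of that line and \<open>r\<close> may be negative.\<close>

lemma periodic_polar_angle:
  assumes per: "\<And>t. f (t + pi) = f t" and r: "r \<noteq> 0" and x: "x $ 1 = r * cos t" "x $ 2 = r * sin t"
  shows "f (polar_angle x) = f t"
proof -
  have "(norm x)^2 = r^2"
  proof -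
    have "(norm x)^2 = (x $ 1)^2 + (x $ 2)^2"
      by (simp add: norm_vec_def L2_set_def UNIV_2)
    also have "\<dots> = r^2 * ((cos t)^2 + (sin t)^2)" unfolding x power_mult_distrib by (simp only: distrib_left)
    finally show ?thesis by simp
  qed
  then have n: "norm x = r \<or> norm x = - r" by (simp add: power2_eq_iff)
  have x0: "x \<noteq> 0" using \<open>(norm x)^2 = r^2\<close> r by auto
  note pc = polar_angle_coords[OF x0]
  from n show ?thesis
  proof
    assume "norm x = r"
    then have "sin (polar_angle x) = sin t \<and> cos (polar_angle x) = cos t"
      using pc x r by simp
    then obtain n :: int where "polar_angle x = t + 2 * pi * n" using sin_cos_eq_iff by auto
    then have "polar_angle x = t + of_int (2 * n) * pi" by (simp add: algebra_simps)
    then show ?thesis using periodic_int[of f, OF per] by metis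
  next
    assume "norm x = - r"
    then have "sin (polar_angle x) = sin (t + pi) \<and> cos (polar_angle x) = cos (t + pi)"
      using pc x r mult_left_cancel[of r "sin (polar_angle x)" "- sin t"]
        mult_left_cancel[of r "cos (polar_angle x)" "- cos t"] by simp
    then obtain n :: int where "polar_angle x = t + pi + 2 * pi * n" unfolding sin_cos_eq_iff by auto
    then have "polar_angle x = t + of_int (2 * n + 1) * pi" by (simp add: algebra_simps)
    then show ?thesis using periodic_int[of f, OF per] by metis
  qed
qed

lemma cos_sin_arctan_slope: "1 = sqrt (1 + \<tau>^2) * cos (arctan \<tau>)" "\<tau> = sqrt (1 + \<tau>^2) * sin (arctan \<tau>)"
  by (simp_all add: cos_arctan sin_arctan add_pos_nonneg less_imp_neq[symmetric])

text \<open>The singular part of the interaction for an arbitrary angular profile. Being infinite at the origin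
  makes it consistent under sums, limits and linear substitutions.\<close>

definition riesz :: "real \<Rightarrow> (real \<Rightarrow> real) \<Rightarrow> real^2 \<Rightarrow> ennreal" where
  "riesz s f x = (if x = 0 then \<infinity> else ennreal (norm x powr (- s) * f (polar_angle x)))"

lemma periodic_polar_angle_slope:
  assumes per: "\<And>t. f (t + pi) = f t" and r: "x $ 1 \<noteq> 0"
  shows "f (polar_angle x) = f (arctan (x $ 2 / x $ 1))"
proof (rule periodic_polar_angle[where f=f, OF per])
  let ?t = "x $ 2 / x $ 1"
  show "x $ 1 * sqrt (1 + ?t^2) \<noteq> 0" using r by (simp add: add_pos_nonneg less_imp_neq[symmetric])
  show "x $ 1 = x $ 1 * sqrt (1 + ?t^2) * cos (arctan ?t)"
    using cos_sin_arctan_slope(1)[of ?t] by (simp add: mult.assoc)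
  show "x $ 2 = x $ 1 * sqrt (1 + ?t^2) * sin (arctan ?t)"
    using cos_sin_arctan_slope(2)[of ?t] r by (simp add: mult.assoc)
qed

lemma arctan_measurable [measurable]: "arctan \<in> borel_measurable borel"
  by (intro borel_measurable_continuous_onI continuous_intros)

lemma borel_measurable_vec_nth [measurable]: "(\<lambda>x::real^2. x $ i) \<in> borel_measurable borel"
  by (intro borel_measurable_continuous_onI continuous_intros)

lemma borel_measurable_riesz:
  assumes per: "\<And>t. f (t + pi) = f t" and [measurable]: "f \<in> borel_measurable borel"
  shows "riesz s f \<in> borel_measurable borel"
proof -
  have "riesz s f = (\<lambda>x. if x = 0 then \<infinity> else ennreal (norm x powr (- s) *
      (if x $ 1 = 0 then f (pi/2) else f (arctan (x $ 2 / x $ 1)))))"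
  proof (rule ext)
    fix x :: "real^2"
    have "f (polar_angle x) = f (pi / 2)" if "x $ 1 = 0" "x \<noteq> 0"
      using that by (intro periodic_polar_angle[where r="x $ 2" and f=f, OF per]) (auto simp: vec_eq_iff forall_2)
    then show "riesz s f x = (if x = 0 then \<infinity> else ennreal (norm x powr (- s) *
      (if x $ 1 = 0 then f (pi/2) else f (arctan (x $ 2 / x $ 1)))))"
      using periodic_polar_angle_slope[of f x, OF per] by (simp add: riesz_def)
  qed
  also have "\<dots> \<in> borel_measurable borel"
    by measurable
  finally show ?thesis .
qed

lemma vector2_eq: "vector [a, b] = a *\<^sub>R axis 1 1 + b *\<^sub>R (axis 2 1 :: real^2)"
  by (simp add: vec_eq_iff forall_2 axis_def)

lemma measurable_vector2 [measurable]:
  assumes [measurable]: "g \<in> borel_measurable M" "h \<in> borel_measurable M"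
  shows "(\<lambda>x. vector [g x, h x] :: real^2) \<in> borel_measurable M"
  unfolding vector2_eq by measurable

text \<open>Coordinates for plane integrals: Lebesgue measure on \<open>real^2\<close> is the image of the product measure.\<close>

lemma lborel_vec2: "lborel = distr (lborel \<Otimes>\<^sub>M lborel) borel (\<lambda>(a, b). vector [a, b] :: real^2)"
proof (rule lborel_eqI)
  fix l u :: "real^2" assume le: "\<And>b. b \<in> Basis \<Longrightarrow> l \<bullet> b \<le> u \<bullet> b"
  have B: "(Basis :: (real^2) set) = {axis 1 1, axis 2 1}"
    by (auto simp: Basis_vec_def UNIV_2)
  have ne: "axis 1 1 \<noteq> (axis 2 1 :: real^2)" by (simp add: axis_eq_axis)
  have le': "l $ 1 \<le> u $ 1" "l $ 2 \<le> u $ 2"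
    using le[of "axis 1 1"] le[of "axis 2 1"] by (auto simp: B inner_axis)
  have "(\<lambda>(a, b). vector [a, b]) -` box l u \<inter> space (lborel \<Otimes>\<^sub>M lborel) = {l$1<..<u$1} \<times> {l$2<..<u$2}"
    by (auto simp: box_def B inner_axis space_pair_measure)
  then show "emeasure (distr (lborel \<Otimes>\<^sub>M lborel) borel (\<lambda>(a, b). vector [a, b] :: real^2)) (box l u) =
      ennreal (\<Prod>b\<in>Basis. (u - l) \<bullet> b)"
    using le' ne by (subst emeasure_distr)
      (auto simp: lborel.emeasure_pair_measure_Times B inner_axis simp flip: ennreal_mult)
qed simp

lemma nn_integral_vec2:
  assumes [measurable]: "F \<in> borel_measurable borel"
  shows "(\<integral>\<^sup>+x. F x \<partial>(lborel :: (real^2) measure)) = (\<integral>\<^sup>+a. (\<integral>\<^sup>+b. F (vector [a, b]) \<partial>lborel) \<partial>lborel)"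
  by (subst lborel_vec2) (simp add: nn_integral_distr lborel.nn_integral_fst[symmetric] case_prod_beta)

text \<open>A substitute for polar coordinates. The point \<open>(r, r \<tau>)\<close> runs over the line of slope \<open>\<tau>\<close>, and the
  Jacobian \<open>|r|\<close> comes from the dilation of the second coordinate by the first.\<close>

lemma nn_integral_slope:
  assumes [measurable]: "F \<in> borel_measurable borel"
  shows "(\<integral>\<^sup>+x. F x \<partial>(lborel :: (real^2) measure)) =
    (\<integral>\<^sup>+\<tau>. (\<integral>\<^sup>+r. ennreal \<bar>r\<bar> * F (vector [r, r * \<tau>]) \<partial>lborel) \<partial>lborel)"
proof -
  have "(\<integral>\<^sup>+x. F x \<partial>(lborel :: (real^2) measure)) = (\<integral>\<^sup>+r. (\<integral>\<^sup>+\<tau>. ennreal \<bar>r\<bar> * F (vector [r, r * \<tau>]) \<partial>lborel) \<partial>lborel)"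
    unfolding nn_integral_vec2[OF assms]
  proof (intro nn_integral_cong_AE)
    show "AE r in lborel. (\<integral>\<^sup>+ b. F (vector [r, b]) \<partial>lborel) = (\<integral>\<^sup>+\<tau>. ennreal \<bar>r\<bar> * F (vector [r, r * \<tau>]) \<partial>lborel)"
      using AE_lborel_singleton[of "0::real"]
    proof eventually_elim
      case (elim r)
      show ?case
        by (subst nn_integral_real_affine[where c=r and t=0]) (use elim in \<open>auto simp: nn_integral_cmult\<close>)
    qed
  qed
  also have "\<dots> = (\<integral>\<^sup>+\<tau>. (\<integral>\<^sup>+r. ennreal \<bar>r\<bar> * F (vector [r, r * \<tau>]) \<partial>lborel) \<partial>lborel)"
    by (rule lborel_pair.Fubini') measurable
  finally show ?thesis .
qed

lemma nn_integral_lborel_reflect: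
  fixes F :: "real^2 \<Rightarrow> ennreal"
  assumes [measurable]: "F \<in> borel_measurable borel"
  shows "(\<integral>\<^sup>+y. F (x - y) \<partial>lborel) = (\<integral>\<^sup>+y. F y \<partial>lborel)"
proof -
  have "lborel = distr lborel borel (\<lambda>y. x + (-1) *\<^sub>R y)"
    using lborel_affine[of "-1" x] by (simp add: density_1)
  then have "(\<integral>\<^sup>+y. F y \<partial>lborel) = (\<integral>\<^sup>+y. F y \<partial>distr lborel borel (\<lambda>y. x + (-1) *\<^sub>R y))" by simp
  then show ?thesis by (simp add: nn_integral_distr)
qed

text \<open>The unnormalised profile of the minimizer, with \<open>u\<close> and \<open>v\<close> the inverse squares of the semi-axes.\<close>

definition ellipse_density :: "real \<Rightarrow> real \<Rightarrow> real \<Rightarrow> real^2 \<Rightarrow> real" where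
  "ellipse_density s u v y = (max 0 (1 - u * (y $ 1)^2 - v * (y $ 2)^2)) powr (s / 2)"

lemma borel_measurable_ellipse_density [measurable]: "ellipse_density s u v \<in> borel_measurable borel"
  unfolding ellipse_density_def[abs_def] by measurable

lemma riesz_slope:
  assumes per: "\<And>t. f (t + pi) = f t" and r: "r \<noteq> 0"
  shows "riesz s f (vector [r, r * \<tau>]) = ennreal (\<bar>r\<bar> powr (- s) * ((1 + \<tau>^2) powr (- s / 2) * f (arctan \<tau>)))"
proof -
  let ?x = "vector [r, r * \<tau>] :: real^2"
  have "?x \<noteq> 0" using r by (auto simp: vec_eq_iff forall_2)
  moreover have "norm ?x = \<bar>r\<bar> * sqrt (1 + \<tau>^2)"
  proof -
    have "norm ?x = sqrt (r^2 * (1 + \<tau>^2))"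
      by (simp add: norm_vec_def L2_set_def UNIV_2 power_mult_distrib algebra_simps)
    then show ?thesis by (simp add: real_sqrt_mult)
  qed
  moreover have "f (polar_angle ?x) = f (arctan \<tau>)"
    using periodic_polar_angle_slope[of f ?x, OF per] r by simp
  moreover have "sqrt (1 + \<tau>^2) powr (- s) = (1 + \<tau>^2) powr (- s / 2)"
    by (simp add: powr_half_sqrt[symmetric] powr_powr add_nonneg_nonneg)
  ultimately show ?thesis using r by (simp add: riesz_def powr_mult mult.assoc)
qed

text \<open>The potential of the elliptic profile as a superposition of chord integrals over all lines through
  \<open>x\<close>, weighted by the kernel at \<open>(1, \<tau>)\<close>.\<close>

lemma riesz_potential_ellipse:
  assumes per: "\<And>t. f (t + pi) = f t" and f[measurable]: "f \<in> borel_measurable borel" and f0: "\<And>t. f t \<ge> 0"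
  shows "(\<integral>\<^sup>+y. riesz s f (x - y) * ennreal (ellipse_density s u v y) \<partial>lborel) =
    (\<integral>\<^sup>+\<tau>. ennreal ((1 + \<tau>^2) powr (- s / 2) * f (arctan \<tau>)) *
       chord s (1 - u * (x $ 1)^2 - v * (x $ 2)^2) (u * x $ 1 + v * \<tau> * x $ 2) (u + v * \<tau>^2) \<partial>lborel)"
proof -
  note [measurable] = borel_measurable_riesz[of f, OF per f]
  have "(\<integral>\<^sup>+y. riesz s f (x - y) * ennreal (ellipse_density s u v y) \<partial>lborel) =
    (\<integral>\<^sup>+y. riesz s f y * ennreal (ellipse_density s u v (x - y)) \<partial>lborel)"
    using nn_integral_lborel_reflect[of "\<lambda>y. riesz s f (x - y) * ennreal (ellipse_density s u v y)" x] by simp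
  also have "\<dots> = (\<integral>\<^sup>+\<tau>. (\<integral>\<^sup>+r. ennreal \<bar>r\<bar> * (riesz s f (vector [r, r * \<tau>]) *
       ennreal (ellipse_density s u v (x - vector [r, r * \<tau>]))) \<partial>lborel) \<partial>lborel)"
    by (rule nn_integral_slope) measurable
  also have "\<dots> = (\<integral>\<^sup>+\<tau>. ennreal ((1 + \<tau>^2) powr (- s / 2) * f (arctan \<tau>)) *
       chord s (1 - u * (x $ 1)^2 - v * (x $ 2)^2) (u * x $ 1 + v * \<tau> * x $ 2) (u + v * \<tau>^2) \<partial>lborel)"
  proof (rule nn_integral_cong)
    fix \<tau> :: real
    let ?\<kappa> = "(1 + \<tau>^2) powr (- s / 2) * f (arctan \<tau>)"
    let ?p = "1 - u * (x $ 1)^2 - v * (x $ 2)^2" and ?q = "u * x $ 1 + v * \<tau> * x $ 2" and ?m = "u + v * \<tau>^2"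
    have "(\<integral>\<^sup>+r. ennreal \<bar>r\<bar> * (riesz s f (vector [r, r * \<tau>]) *
       ennreal (ellipse_density s u v (x - vector [r, r * \<tau>]))) \<partial>lborel)
      = (\<integral>\<^sup>+r. ennreal ?\<kappa> * ennreal (\<bar>r\<bar> powr (1 - s) * (max 0 (?p + 2 * ?q * r - ?m * r^2)) powr (s / 2)) \<partial>lborel)"
    proof (rule nn_integral_cong_AE)
      show "AE r in lborel. ennreal \<bar>r\<bar> * (riesz s f (vector [r, r * \<tau>]) *
        ennreal (ellipse_density s u v (x - vector [r, r * \<tau>]))) =
        ennreal ?\<kappa> * ennreal (\<bar>r\<bar> powr (1 - s) * (max 0 (?p + 2 * ?q * r - ?m * r^2)) powr (s / 2))"
        using AE_lborel_singleton[of "0::real"]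
      proof eventually_elim
        case (elim r)
        have "1 - u * (x $ 1 - r)^2 - v * (x $ 2 - r * \<tau>)^2 = ?p + 2 * ?q * r - ?m * r^2"
          by (simp add: power2_eq_square algebra_simps)
        then have e: "ellipse_density s u v (x - vector [r, r * \<tau>]) = (max 0 (?p + 2 * ?q * r - ?m * r^2)) powr (s / 2)"
          unfolding ellipse_density_def vector_minus_component vector_2 by (rule arg_cong)
        have "\<bar>r\<bar> * \<bar>r\<bar> powr (- s) = \<bar>r\<bar> powr (1 - s)" using elim by (simp add: powr_mult_base)
        then show ?case unfolding riesz_slope[of f, OF per elim] e
          using f0 by (simp flip: ennreal_mult add: mult.assoc[symmetric])
      qed
    qed
    also have "\<dots> = ennreal ?\<kappa> * chord s ?p ?q ?m"
      unfolding chord_def by (rule nn_integral_cmult) measurable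
    finally show "(\<integral>\<^sup>+r. ennreal \<bar>r\<bar> * (riesz s f (vector [r, r * \<tau>]) *
       ennreal (ellipse_density s u v (x - vector [r, r * \<tau>]))) \<partial>lborel) = ennreal ?\<kappa> * chord s ?p ?q ?m" .
  qed
  finally show ?thesis .
qed

section \<open>Mass of the elliptic profile\<close>

lemma integral_inverse_one_plus_square:
  "integrable lborel (\<lambda>x::real. inverse (1 + x^2))" "(LBINT x::real. inverse (1 + x^2)) = pi"
  using integrable_inverse_1_plus_square LBINT_inverse_1_plus_square
  by (auto simp: einterval_def set_integrable_def interval_lebesgue_integral_def set_lebesgue_integral_def)

lemma nn_integral_inverse_quadratic:
  assumes "u > 0" "v > 0"
  shows "(\<integral>\<^sup>+\<tau>. ennreal (1 / (u + v * \<tau>^2)) \<partial>lborel) = ennreal (pi / sqrt (u * v))"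
proof -
  have uv: "u + v * t^2 > 0" for t using assms by (simp add: add_pos_nonneg)
  note i = integral_inverse_one_plus_square
  have 1: "(\<integral>\<^sup>+x. ennreal (inverse (1 + x^2)) \<partial>lborel) = ennreal pi"
    using nn_integral_eq_integral[OF i(1)] i(2) by (simp add: add_nonneg_nonneg)
  define c where "c = sqrt (u / v)"
  have c: "c > 0" "c * c = u / v" using assms by (auto simp: c_def)
  have "(\<integral>\<^sup>+\<tau>. ennreal (1 / (u + v * \<tau>^2)) \<partial>lborel) = ennreal \<bar>c\<bar> * (\<integral>\<^sup>+x. ennreal (1 / (u + v * (c * x)^2)) \<partial>lborel)"
    using c by (subst nn_integral_real_affine[where c=c and t=0]) auto
  also have "(\<integral>\<^sup>+x. ennreal (1 / (u + v * (c * x)^2)) \<partial>lborel) = (\<integral>\<^sup>+x. ennreal (1 / u) * ennreal (inverse (1 + x^2)) \<partial>lborel)"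
  proof (intro nn_integral_cong)
    fix x :: real
    have "v * (c * x)^2 = u * x^2" using c assms by (simp add: power2_eq_square)
    then have "1 / (u + v * (c * x)^2) = 1 / (u * (1 + x^2))" by (simp add: distrib_left)
    then have "1 / (u + v * (c * x)^2) = (1 / u) * inverse (1 + x^2)" by (simp add: divide_inverse)
    then show "ennreal (1 / (u + v * (c * x)^2)) = ennreal (1 / u) * ennreal (inverse (1 + x^2))"
      using assms by (simp add: ennreal_mult[symmetric] add_nonneg_nonneg)
  qed
  also have "\<dots> = ennreal (1 / u) * ennreal pi" by (subst nn_integral_cmult) (auto simp: 1)
  also have "ennreal \<bar>c\<bar> * (ennreal (1 / u) * ennreal pi) = ennreal (c * (1 / u * pi))"
    using c assms by (simp add: ennreal_mult[symmetric])
  also have "c * (1 / u * pi) = pi / sqrt (u * v)"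
    using assms by (simp add: c_def real_sqrt_divide real_sqrt_mult field_simps)
  finally show ?thesis .
qed

lemma nn_integral_radial_profile:
  assumes "m > 0" "s > 0"
  shows "(\<integral>\<^sup>+r. ennreal (\<bar>r\<bar> * (max 0 (1 - m * r^2)) powr (s / 2)) \<partial>lborel) = ennreal (2 / ((s + 2) * m))"
proof -
  define a where "a = 1 / sqrt m"
  have a: "a > 0" "m * a^2 = 1" using assms by (auto simp: a_def power_divide)
  define F where "F r = - ((1 - m * r^2) powr (s / 2 + 1)) / (m * (s + 2))" for r
  let ?f = "\<lambda>r. \<bar>r\<bar> * (max 0 (1 - m * r^2)) powr (s / 2)"
  have lt: "m * r^2 < 1" if "0 < r" "r < a" for r
  proof -
    have "r^2 < a^2" using that by (simp add: power_strict_mono)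
    then have "m * r^2 < m * a^2" using assms by simp
    then show ?thesis using a by simp
  qed
  have le: "m * r^2 \<le> 1" if "0 \<le> r" "r \<le> a" for r
  proof -
    have "r^2 \<le> a^2" using that by (simp add: power_mono)
    then have "m * r^2 \<le> m * a^2" using assms by simp
    then show ?thesis using a by simp
  qed
  have ge: "1 - m * r^2 \<le> 0" if "r \<ge> a" for r
  proof -
    have "a^2 \<le> r^2" using that a by (simp add: power_mono)
    then have "m * a^2 \<le> m * r^2" using assms by simp
    then show ?thesis using a by simp
  qed
  have "(?f has_integral (F a - F 0)) {0..a}"
  proof (rule fundamental_theorem_of_calculus_interior)
    show "continuous_on {0..a} F" unfolding F_def
      using assms le by (intro continuous_intros continuous_on_powr') (auto simp: diff_ge_0_iff_ge)
    show "(F has_vector_derivative ?f x) (at x)" if "x \<in> {0<..<a}" for x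
    proof -
      have p: "1 - m * x^2 > 0" using lt that by simp
      have "(F has_real_derivative - ((s / 2 + 1) * (1 - m * x^2) powr (s / 2) * (- (m * (2 * x)))) / (m * (s + 2))) (at x)"
      proof -
        have "((\<lambda>r. 1 - m * r^2) has_real_derivative - (m * (2 * x))) (at x)"
          by (auto intro!: derivative_eq_intros)
        from DERIV_chain2[OF has_real_derivative_powr[OF p, of "s / 2 + 1"] this]
        have "((\<lambda>r. (1 - m * r^2) powr (s / 2 + 1)) has_real_derivative
            (s / 2 + 1) * (1 - m * x^2) powr (s / 2) * (- (m * (2 * x)))) (at x)" by simp
        from DERIV_cdivide[OF DERIV_minus[OF this]] show ?thesis unfolding F_def .
      qed
      also have "- ((s / 2 + 1) * (1 - m * x^2) powr (s / 2) * (- (m * (2 * x)))) / (m * (s + 2)) = ?f x"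
      proof -
        have "- ((s / 2 + 1) * P * (- (m * (2 * x)))) / (m * (s + 2)) = x * P" for P
        proof -
          have "- ((s / 2 + 1) * P * (- (m * (2 * x)))) = (x * P) * (m * (s + 2))" by (simp add: algebra_simps)
          moreover have "m * (s + 2) \<noteq> 0" using assms by simp
          ultimately show ?thesis by (simp only: nonzero_mult_div_cancel_right not_False_eq_True)
        qed
        then show ?thesis using p that by simp
      qed
      finally show ?thesis by (simp add: has_real_derivative_iff_has_vector_derivative)
    qed
  qed (use a in auto)
  moreover have "F a - F 0 = 1 / (m * (s + 2))" using a by (simp add: F_def)
  ultimately have "(?f has_integral (1 / (m * (s + 2)))) {0..a}" by simp
  then have "(\<integral>\<^sup>+r. ennreal (indicator {0..a} r * ?f r) \<partial>lborel) = ennreal (1 / (m * (s + 2)))"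
    by (rule nn_integral_has_integral_lebesgue[rotated]) auto
  also have "(\<integral>\<^sup>+r. ennreal (indicator {0..a} r * ?f r) \<partial>lborel) = (\<integral>\<^sup>+r. ennreal (indicator {0..} r *\<^sub>R ?f r) \<partial>lborel)"
  proof (intro nn_integral_cong)
    fix r :: real
    have "?f r = 0" if "r > a" using ge[of r] that by simp
    then show "ennreal (indicator {0..a} r * ?f r) = ennreal (indicator {0..} r *\<^sub>R ?f r)"
      by (cases "r > a") (auto simp: indicator_def)
  qed
  finally have "has_bochner_integral lborel (\<lambda>r. indicator {0..} r *\<^sub>R ?f r) (1 / (m * (s + 2)))"
    using assms by (intro has_bochner_integral_nn_integral) auto
  from has_bochner_integral_even_function[OF this]
  have "has_bochner_integral lborel ?f (2 * (1 / (m * (s + 2))))" by simp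
  then have "integrable lborel ?f" "integral\<^sup>L lborel ?f = 2 / ((s + 2) * m)"
    by (auto simp: has_bochner_integral_iff mult.commute)
  then show ?thesis using nn_integral_eq_integral[of lborel ?f] by simp
qed

text \<open>In slope coordinates the profile along each line through the centre is \<open>(1 - m r^2)\<close> to the power
  \<open>s / 2\<close> with \<open>m = u + v \<tau>^2\<close>, and the remaining integral over \<open>\<tau>\<close> is that of an arctangent.\<close>

lemma nn_integral_ellipse_density:
  assumes "s > 0" "u > 0" "v > 0"
  shows "(\<integral>\<^sup>+y. ennreal (ellipse_density s u v y) \<partial>lborel) = ennreal (2 * pi / ((s + 2) * sqrt (u * v)))"
proof -
  have m: "u + v * \<tau>^2 > 0" for \<tau> using assms by (simp add: add_pos_nonneg)
  have e: "1 - u * r^2 - v * (r * \<tau>)^2 = 1 - (u + v * \<tau>^2) * r^2" for r \<tau>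
    by (simp add: power2_eq_square algebra_simps)
  have "(\<integral>\<^sup>+y. ennreal (ellipse_density s u v y) \<partial>lborel) =
     (\<integral>\<^sup>+\<tau>. (\<integral>\<^sup>+r. ennreal (\<bar>r\<bar> * (max 0 (1 - (u + v * \<tau>^2) * r^2)) powr (s / 2)) \<partial>lborel) \<partial>lborel)"
    by (subst nn_integral_slope) (simp_all add: ellipse_density_def e ennreal_mult)
  also have "\<dots> = (\<integral>\<^sup>+\<tau>. ennreal (2 / (s + 2)) * ennreal (1 / (u + v * \<tau>^2)) \<partial>lborel)"
    using assms m by (intro nn_integral_cong) (simp add: nn_integral_radial_profile ennreal_mult[symmetric] less_imp_le)
  also have "\<dots> = ennreal (2 / (s + 2)) * ennreal (pi / sqrt (u * v))"
    using assms by (subst nn_integral_cmult) (auto simp: nn_integral_inverse_quadratic)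
  finally show ?thesis using assms by (simp add: ennreal_mult[symmetric])
qed

lemma integral_le_nn_integral:
  assumes "integrable M (g :: _ \<Rightarrow> real)"
  shows "ennreal (integral\<^sup>L M g) \<le> (\<integral>\<^sup>+x. ennreal (g x) \<partial>M)"
proof -
  have i: "integrable M (\<lambda>x. max 0 (g x))" using assms by simp
  have "ennreal (integral\<^sup>L M g) \<le> ennreal (integral\<^sup>L M (\<lambda>x. max 0 (g x)))"
    using assms i by (intro ennreal_leI integral_mono) auto
  also have "\<dots> = (\<integral>\<^sup>+x. ennreal (max 0 (g x)) \<partial>M)"
    using i by (intro nn_integral_eq_integral[symmetric]) auto
  also have "\<dots> = (\<integral>\<^sup>+x. ennreal (g x) \<partial>M)" by (intro nn_integral_cong) (simp add: max_def ennreal_neg)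
  finally show ?thesis .
qed

section \<open>The choice of the semi-axes\<close>

text \<open>The weight that slope \<open>\<tau>\<close> receives in the potential: the kernel at \<open>(1, \<tau>)\<close> times the factor
  \<open>m powr (s/2 - 1)\<close> of the chord formula. It is written with the quotient \<open>(u + v \<tau>^2) / (1 + \<tau>^2)\<close>,
  which stays between \<open>u\<close> and \<open>v\<close>, to make integrability over all slopes visible.\<close>

definition slope_weight :: "real \<Rightarrow> (real \<Rightarrow> real) \<Rightarrow> real \<Rightarrow> real \<Rightarrow> real \<Rightarrow> real" where
  "slope_weight s f u v \<tau> = f (arctan \<tau>) / (1 + \<tau>^2) * ((u + v * \<tau>^2) / (1 + \<tau>^2)) powr (s / 2 - 1)"

text \<open>For fixed slope, the coefficients of \<open>- (x $ 1)^2\<close> and \<open>- (x $ 2)^2\<close> in \<open>p + (2 - s) q^2 / m\<close>.\<close>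

definition curv1 :: "real \<Rightarrow> real \<Rightarrow> real \<Rightarrow> real \<Rightarrow> real" where
  "curv1 s u v \<tau> = u * ((s - 1) * u + v * \<tau>^2) / (u + v * \<tau>^2)"

definition curv2 :: "real \<Rightarrow> real \<Rightarrow> real \<Rightarrow> real \<Rightarrow> real" where
  "curv2 s u v \<tau> = v * (u + (s - 1) * (v * \<tau>^2)) / (u + v * \<tau>^2)"

text \<open>Up to the chord constant, the coefficients of the squares in the potential inside the ellipse.\<close>

definition curvature1 :: "real \<Rightarrow> (real \<Rightarrow> real) \<Rightarrow> real \<Rightarrow> real \<Rightarrow> real" where
  "curvature1 s f u v = (LINT \<tau>|lborel. slope_weight s f u v \<tau> * curv1 s u v \<tau>)"

definition curvature2 :: "real \<Rightarrow> (real \<Rightarrow> real) \<Rightarrow> real \<Rightarrow> real \<Rightarrow> real" where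
  "curvature2 s f u v = (LINT \<tau>|lborel. slope_weight s f u v \<tau> * curv2 s u v \<tau>)"

definition ellipse_mass :: "real \<Rightarrow> real \<Rightarrow> real \<Rightarrow> real" where
  "ellipse_mass s u v = 2 * pi / ((s + 2) * sqrt (u * v))"

lemma quot_ge_min:
  fixes u v \<tau> :: real
  assumes "u > 0" "v > 0" shows "min u v \<le> (u + v * \<tau>^2) / (1 + \<tau>^2)"
proof -
  have "min u v * (1 + \<tau>^2) \<le> u + v * \<tau>^2"
    using mult_right_mono[of "min u v" v "\<tau>^2"] by (simp add: distrib_left)
  then show ?thesis by (simp add: pos_le_divide_eq add_pos_nonneg)
qed

lemma curv_measurable [measurable]: "curv1 s u v \<in> borel_measurable borel" "curv2 s u v \<in> borel_measurable borel"
  unfolding curv1_def[abs_def] curv2_def[abs_def] by measurable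

lemma integral_ge_interval:
  fixes g :: "real \<Rightarrow> real"
  assumes g: "integrable lborel g" "\<And>x. g x \<ge> 0" and c: "\<And>x. a \<le> x \<Longrightarrow> x \<le> b \<Longrightarrow> c \<le> g x" and ab: "a \<le> b"
  shows "c * (b - a) \<le> integral\<^sup>L lborel g"
proof -
  have i: "integrable lborel (\<lambda>x. c * indicator {a..b} x)"
    by (intro integrable_mult_right integrable_real_indicator) (auto simp: emeasure_lborel_Icc_eq)
  have "c * (b - a) = (LINT x|lborel. c * indicator {a..b} x)" using ab by simp
  also have "\<dots> \<le> integral\<^sup>L lborel g"
    using g c by (intro integral_mono i) (auto simp: indicator_def)
  finally show ?thesis .
qed

context
  fixes s :: real and f :: "real \<Rightarrow> real"
  assumes s: "1 \<le> s" "s < 2"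
    and per: "\<And>t. f (t + pi) = f t" and cont: "continuous_on UNIV f" and pos: "\<And>t. f t > 0"
begin

lemma slope_weight_measurable: "slope_weight s f u v \<in> borel_measurable borel"
proof -
  note [measurable] = borel_measurable_continuous_onI[OF cont]
  show ?thesis unfolding slope_weight_def[abs_def] by measurable
qed

lemma slope_weight_nonneg: "slope_weight s f u v \<tau> \<ge> 0"
  unfolding slope_weight_def using pos[of "arctan \<tau>"] by (simp add: add_nonneg_nonneg)

lemma slope_weight_le:
  assumes "u > 0" "v > 0" "\<And>t. f t \<le> B"
  shows "slope_weight s f u v \<tau> \<le> B * (min u v) powr (s / 2 - 1) * inverse (1 + \<tau>^2)"
proof -
  have "((u + v * \<tau>^2) / (1 + \<tau>^2)) powr (s / 2 - 1) \<le> (min u v) powr (s / 2 - 1)"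
    using quot_ge_min[OF assms(1,2), of \<tau>] assms s by (intro powr_mono2') auto
  then have "f (arctan \<tau>) / (1 + \<tau>^2) * ((u + v * \<tau>^2) / (1 + \<tau>^2)) powr (s / 2 - 1) \<le> B / (1 + \<tau>^2) * (min u v) powr (s / 2 - 1)"
    using assms(3)[of "arctan \<tau>"] pos[of "arctan \<tau>"]
    by (intro mult_mono divide_right_mono) (auto simp: add_nonneg_nonneg intro: order_trans[of 0 "f (arctan \<tau>)"])
  also have "\<dots> = B * (min u v) powr (s / 2 - 1) * inverse (1 + \<tau>^2)"
  proof -
    have "a / b * c = a * c * inverse b" for a b c :: real by (simp add: divide_inverse)
    then show ?thesis .
  qed
  finally show ?thesis unfolding slope_weight_def .
qed

lemma integrable_slope_weight:
  assumes uv: "u > 0" "v > 0" and [measurable]: "g \<in> borel_measurable borel" and C: "\<And>\<tau>. \<bar>g \<tau>\<bar> \<le> C"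
  shows "integrable lborel (\<lambda>\<tau>. slope_weight s f u v \<tau> * g \<tau>)"
proof -
  note [measurable] = slope_weight_measurable
  obtain \<delta> B where B: "B > 0" "\<And>t. f t \<le> B" using periodic_bounds[OF per cont pos] by metis
  have "integrable lborel (\<lambda>\<tau>. B * (min u v) powr (s / 2 - 1) * C * inverse (1 + \<tau>^2))"
    using integral_inverse_one_plus_square(1) by simp
  then show ?thesis
  proof (rule Bochner_Integration.integrable_bound, goal_cases)
    case 2
    have "norm (slope_weight s f u v \<tau> * g \<tau>) \<le> norm (B * (min u v) powr (s / 2 - 1) * C * inverse (1 + \<tau>^2))" for \<tau>
    proof -
      have "norm (slope_weight s f u v \<tau> * g \<tau>) \<le> (B * (min u v) powr (s / 2 - 1) * inverse (1 + \<tau>^2)) * C"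
        using slope_weight_le[OF uv B(2), of \<tau>] C[of \<tau>] slope_weight_nonneg[of u v \<tau>] B
        by (simp add: abs_mult) (intro mult_mono, auto)
      also have "\<dots> \<le> norm (B * (min u v) powr (s / 2 - 1) * C * inverse (1 + \<tau>^2))"
        using C[of 0] B by (simp add: ac_simps abs_mult)
      finally show ?thesis .
    qed
    then show ?case by simp
  qed measurable
qed

lemma curv_bounds:
  assumes uv: "u > 0" "v > 0"
  shows "0 \<le> curv1 s u v \<tau>" "curv1 s u v \<tau> \<le> u" "0 \<le> curv2 s u v \<tau>" "curv2 s u v \<tau> \<le> v"
proof -
  have m: "u + v * \<tau>^2 > 0" using uv by (simp add: add_pos_nonneg)
  show "0 \<le> curv1 s u v \<tau>" "0 \<le> curv2 s u v \<tau>" using uv s m by (auto simp: curv1_def curv2_def)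
  have 1: "(s - 1) * u \<le> u" "(s - 1) * (v * \<tau>^2) \<le> v * \<tau>^2" using uv s by (auto intro!: mult_left_le_one_le)
  have "u * ((s - 1) * u + v * \<tau>^2) \<le> u * (u + v * \<tau>^2)" "v * (u + (s - 1) * (v * \<tau>^2)) \<le> v * (u + v * \<tau>^2)"
    using 1 uv by auto
  then show "curv1 s u v \<tau> \<le> u" "curv2 s u v \<tau> \<le> v" using m by (auto simp: curv1_def curv2_def pos_divide_le_eq)
qed

lemma integrable_curv:
  assumes uv: "u > 0" "v > 0"
  shows "integrable lborel (\<lambda>\<tau>. slope_weight s f u v \<tau> * curv1 s u v \<tau>)"
    "integrable lborel (\<lambda>\<tau>. slope_weight s f u v \<tau> * curv2 s u v \<tau>)"
  using curv_bounds[OF uv] integrable_slope_weight[OF uv, of "curv1 s u v" u]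
    integrable_slope_weight[OF uv, of "curv2 s u v" v] by auto

lemma half_le_powr: "0 < x \<Longrightarrow> x \<le> 2 \<Longrightarrow> 1 / 2 \<le> x powr (s / 2 - 1)"
proof -
  assume x: "0 < x" "x \<le> 2"
  have "1 / 2 = 2 powr (-1 :: real)" by (simp add: powr_minus_divide)
  also have "\<dots> \<le> 2 powr (s / 2 - 1)" using s by (intro powr_mono) auto
  also have "\<dots> \<le> x powr (s / 2 - 1)" using x s by (intro powr_mono2') auto
  finally show ?thesis .
qed

lemma slope_weight_ge:
  assumes uv: "u > 0" "v > 0" and m: "u + v * \<tau>^2 \<le> 2 * (1 + \<tau>^2)" and d: "\<And>t. \<delta> \<le> f t" "\<delta> > 0"
    and K: "1 + \<tau>^2 \<le> K"
  shows "slope_weight s f u v \<tau> \<ge> \<delta> / (2 * K)"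
proof -
  have p: "1 + \<tau>^2 > 0" "u + v * \<tau>^2 > 0" using uv by (auto simp: add_pos_nonneg)
  have "(u + v * \<tau>^2) / (1 + \<tau>^2) \<le> 2" using m p by (simp add: pos_divide_le_eq)
  then have "1 / 2 \<le> ((u + v * \<tau>^2) / (1 + \<tau>^2)) powr (s / 2 - 1)" using p by (intro half_le_powr) auto
  moreover have "\<delta> / K \<le> f (arctan \<tau>) / (1 + \<tau>^2)"
    using d p K by (intro frac_le) (auto simp: less_imp_le[OF pos])
  ultimately have "\<delta> / K * (1 / 2) \<le> slope_weight s f u v \<tau>"
    unfolding slope_weight_def using d p K pos[of "arctan \<tau>"] by (intro mult_mono) auto
  then show ?thesis by (simp add: mult.commute)
qed

lemma curvature_le:
  assumes uv: "u \<ge> 1" "v \<ge> 1" and B: "B > 0" "\<And>t. f t \<le> B"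
  shows "curvature1 s f u v \<le> B * u * pi" "curvature2 s f u v \<le> B * v * pi"
proof -
  note i = integral_inverse_one_plus_square
  have uv': "u > 0" "v > 0" using uv by auto
  have w: "slope_weight s f u v \<tau> \<le> B * inverse (1 + \<tau>^2)" for \<tau>
  proof -
    have "(min u v) powr (s / 2 - 1) \<le> 1 powr (s / 2 - 1)" using uv s by (intro powr_mono2') auto
    then have "B * (min u v) powr (s / 2 - 1) * inverse (1 + \<tau>^2) \<le> B * 1 * inverse (1 + \<tau>^2)"
      using B by (intro mult_mono) auto
    then show ?thesis using slope_weight_le[OF uv' B(2), of \<tau>] by simp
  qed
  have "curvature1 s f u v \<le> (LINT \<tau>|lborel. (B * u) * inverse (1 + \<tau>^2))" unfolding curvature1_def
  proof (intro integral_mono integrable_curv uv' integrable_mult_right i)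
    fix \<tau> :: real
    have "slope_weight s f u v \<tau> * curv1 s u v \<tau> \<le> B * inverse (1 + \<tau>^2) * u"
      using w[of \<tau>] curv_bounds[OF uv', of \<tau>] slope_weight_nonneg[of u v \<tau>] B uv by (intro mult_mono) auto
    then show "slope_weight s f u v \<tau> * curv1 s u v \<tau> \<le> B * u * inverse (1 + \<tau>^2)" by (simp add: ac_simps)
  qed
  then show "curvature1 s f u v \<le> B * u * pi" using i by simp
  have "curvature2 s f u v \<le> (LINT \<tau>|lborel. (B * v) * inverse (1 + \<tau>^2))" unfolding curvature2_def
  proof (intro integral_mono integrable_curv uv' integrable_mult_right i)
    fix \<tau> :: real
    have "slope_weight s f u v \<tau> * curv2 s u v \<tau> \<le> B * inverse (1 + \<tau>^2) * v"
      using w[of \<tau>] curv_bounds[OF uv', of \<tau>] slope_weight_nonneg[of u v \<tau>] B uv by (intro mult_mono) auto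
    then show "slope_weight s f u v \<tau> * curv2 s u v \<tau> \<le> B * v * inverse (1 + \<tau>^2)" by (simp add: ac_simps)
  qed
  then show "curvature2 s f u v \<le> B * v * pi" using i by simp
qed

text \<open>An ellipse that is thin in the first direction has large curvature in that direction: the slopes
  between \<open>sqrt t\<close> and \<open>2 sqrt t\<close> have total weight of order \<open>1 / sqrt t\<close>, and on them the first
  coefficient is of order \<open>t\<close>.\<close>

lemma curvature1_ge:
  assumes t: "t \<ge> 1" and d: "\<And>x. \<delta> \<le> f x" "\<delta> > 0"
  shows "curvature1 s f t 1 \<ge> \<delta> * sqrt t / 20"
proof -
  let ?g = "\<lambda>\<tau>. slope_weight s f t 1 \<tau> * curv1 s t 1 \<tau>"
  have t0: "t > 0" using t by simp
  have "\<delta> / 20 * (2 * sqrt t - sqrt t) \<le> curvature1 s f t 1" unfolding curvature1_def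
  proof (rule integral_ge_interval)
    show "integrable lborel (\<lambda>\<tau>. ?g \<tau>)" using t by (intro integrable_curv) auto
    show "0 \<le> ?g \<tau>" for \<tau>
      using slope_weight_nonneg curv_bounds(1)[of t 1] t by simp
    fix \<tau> assume \<tau>: "sqrt t \<le> \<tau>" "\<tau> \<le> 2 * sqrt t"
    have "sqrt t \<ge> 0" using t0 by simp
    have lo: "t \<le> \<tau>^2" using power_mono[OF \<tau>(1), of 2] t0 by simp
    have hi: "\<tau>^2 \<le> 4 * t" using power_mono[OF \<tau>(2), of 2] \<tau> \<open>sqrt t \<ge> 0\<close> t0 by (simp add: power_mult_distrib)
    have w: "slope_weight s f t 1 \<tau> \<ge> \<delta> / (2 * (5 * t))"
      using lo hi t d by (intro slope_weight_ge) auto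
    have m: "t + \<tau>^2 > 0" using t0 by (simp add: add_pos_nonneg)
    have "t / 2 * (t + \<tau>^2) \<le> t * (0 + \<tau>^2)" using lo t0 by (simp add: field_simps)
    also have "\<dots> \<le> t * ((s - 1) * t + \<tau>^2)" using s t0 by (intro mult_left_mono add_right_mono) auto
    finally have c: "t / 2 \<le> curv1 s t 1 \<tau>" using m by (simp add: curv1_def pos_le_divide_eq)
    have "\<delta> / (2 * (5 * t)) * (t / 2) \<le> ?g \<tau>"
      using w c d t0 by (intro mult_mono slope_weight_nonneg) auto
    then show "\<delta> / 20 \<le> ?g \<tau>" using t0 by simp
  qed (use t0 in auto)
  then show ?thesis by simp
qed

text \<open>The counterpart for the second direction, where the slopes below \<open>1 / sqrt t\<close> are responsible.\<close>

lemma curvature2_ge: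
  assumes t: "t \<ge> 1" and d: "\<And>x. \<delta> \<le> f x" "\<delta> > 0"
  shows "curvature2 s f 1 t \<ge> \<delta> * sqrt t / 20"
proof -
  let ?g = "\<lambda>\<tau>. slope_weight s f 1 t \<tau> * curv2 s 1 t \<tau>"
  have t0: "t > 0" using t by simp
  have "\<delta> * t / 8 * (1 / sqrt t - 0) \<le> curvature2 s f 1 t" unfolding curvature2_def
  proof (rule integral_ge_interval)
    show "integrable lborel (\<lambda>\<tau>. ?g \<tau>)" using t by (intro integrable_curv) auto
    show "0 \<le> ?g \<tau>" for \<tau>
      using slope_weight_nonneg curv_bounds(3)[of 1 t] t by simp
    fix \<tau> assume \<tau>: "0 \<le> \<tau>" "\<tau> \<le> 1 / sqrt t"
    have "\<tau>^2 \<le> 1 / t" using power_mono[OF \<tau>(2,1), of 2] t0 by (simp add: power_divide)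
    then have hi: "t * \<tau>^2 \<le> 1" using t0 by (simp add: field_simps)
    have hi2: "\<tau>^2 \<le> 1" using hi t mult_right_mono[OF t, of "\<tau>^2"] by simp
    have w: "slope_weight s f 1 t \<tau> \<ge> \<delta> / (2 * 2)"
    proof (rule slope_weight_ge)
      have "1 + x \<le> 2 * (1 + y)" if "x \<le> 1" "0 \<le> y" for x y :: real using that by simp
      from this[OF hi zero_le_power2] show "1 + t * \<tau>^2 \<le> 2 * (1 + \<tau>^2)" .
    qed (use hi2 t d in auto)
    have m: "1 + t * \<tau>^2 > 0" using t0 by (simp add: add_pos_nonneg)
    have "t / 2 * (1 + t * \<tau>^2) \<le> t / 2 * 2" using hi t0 by (intro mult_left_mono) auto
    also have "\<dots> \<le> t * (1 + (s - 1) * (t * \<tau>^2))" using s t0 by simp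
    finally have c: "t / 2 \<le> curv2 s 1 t \<tau>" using m by (simp add: curv2_def pos_le_divide_eq)
    have "\<delta> / (2 * 2) * (t / 2) \<le> ?g \<tau>"
      using w c d t0 by (intro mult_mono slope_weight_nonneg) auto
    then show "\<delta> * t / 8 \<le> ?g \<tau>" by simp
  qed (use t0 in auto)
  moreover have "\<delta> * t / 8 * (1 / sqrt t - 0) = \<delta> * sqrt t / 8" using t0 by (simp add: field_simps)
  moreover have "\<delta> * sqrt t / 20 \<le> \<delta> * sqrt t / 8" using d t0 by simp
  ultimately show ?thesis by linarith
qed

text \<open>Equal coefficients are obtained from the intermediate value theorem. Along the path
  \<open>(1 + max 0 t, 1 + max 0 (- t))\<close> the larger coefficient grows at least like the square root of the parameter at
  either end, while the other one remains bounded. Both parameters stay above \<open>1\<close>, which gives an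
  integrable majorant that is uniform on bounded parameter intervals.\<close>

lemma exists_balanced:
  shows "\<exists>u v. u > 0 \<and> v > 0 \<and> curvature1 s f u v = curvature2 s f u v \<and> curvature1 s f u v > 0"
proof -
  note [measurable] = slope_weight_measurable
  obtain \<delta> B where d: "\<delta> > 0" "\<And>t. \<delta> \<le> f t" and B: "B > 0" "\<And>t. f t \<le> B"
    using periodic_bounds[OF per cont pos] by metis
  define U V where "U t = 1 + max 0 t" and "V t = 1 + max 0 (- t)" for t :: real
  have UV: "U t \<ge> 1" "V t \<ge> 1" "U t > 0" "V t > 0" for t by (auto simp: U_def V_def)
  define D where "D t = curvature1 s f (U t) (V t) - curvature2 s f (U t) (V t)" for t
  \<comment> \<open>large enough for the growing coefficient to exceed the bound \<open>B * pi\<close> of the other one\<close>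
  define T where "T = (20 * (B * pi + 1) / \<delta>)^2"
  have T0: "T > 0" using d B by (simp add: T_def add_pos_pos less_imp_neq[symmetric])
  have sT: "\<delta> * sqrt (1 + T) / 20 > B * pi"
  proof -
    have "sqrt T = 20 * (B * pi + 1) / \<delta>" using d B by (simp add: T_def add_nonneg_nonneg)
    then have "\<delta> * sqrt T / 20 = B * pi + 1" using d by simp
    moreover have "\<delta> * sqrt T / 20 \<le> \<delta> * sqrt (1 + T) / 20" using d by simp
    ultimately show ?thesis by linarith
  qed
  have pos': "D T > 0"
  proof -
    have "U T = 1 + T" "V T = 1" using T0 by (auto simp: U_def V_def)
    then show ?thesis using curvature1_ge[of "1 + T", OF _ d(2,1)] curvature_le(2)[of "1 + T" 1, OF _ _ B] sT T0 by (simp add: D_def)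
  qed
  have neg': "D (- T) < 0"
  proof -
    have "U (- T) = 1" "V (- T) = 1 + T" using T0 by (auto simp: U_def V_def)
    then show ?thesis using curvature2_ge[of "1 + T", OF _ d(2,1)] curvature_le(1)[of 1 "1 + T", OF _ _ B] sT T0 by (simp add: D_def)
  qed
  define F where "F t \<tau> = slope_weight s f (U t) (V t) \<tau> * (curv1 s (U t) (V t) \<tau> - curv2 s (U t) (V t) \<tau>)" for t \<tau>
  have DF: "D t = (LINT \<tau>|lborel. F t \<tau>)" for t
    unfolding D_def curvature1_def curvature2_def F_def using integrable_curv[OF UV(3,4), of t]
    by (simp add: right_diff_distrib)
  have contD: "continuous_on {-T..T} D"
  proof (unfold continuous_on_sequentially, intro allI impI ballI, goal_cases)
    case (1 x a)
    have "(\<lambda>n. LINT \<tau>|lborel. F (x n) \<tau>) \<longlonglongrightarrow> (LINT \<tau>|lborel. F a \<tau>)"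
    proof (rule integral_dominated_convergence[where w="\<lambda>\<tau>. B * (2 * (1 + T)) * inverse (1 + \<tau>^2)"])
      show [measurable]: "F t \<in> borel_measurable lborel" for t unfolding F_def[abs_def] by measurable
      show "F t \<in> borel_measurable lborel" for t unfolding F_def[abs_def] by measurable
      show "integrable lborel (\<lambda>\<tau>. B * (2 * (1 + T)) * inverse (1 + \<tau>^2))"
        using integral_inverse_one_plus_square(1) by simp
      have "(\<lambda>n. F (x n) \<tau>) \<longlonglongrightarrow> F a \<tau>" for \<tau>
      proof -
        have nz: "U t + V t * \<tau>^2 \<noteq> 0" "1 + \<tau>^2 \<noteq> 0" for t
        proof -
          have "U t + V t * \<tau>^2 > 0" "1 + \<tau>^2 > 0" using UV[of t] by (auto simp: add_pos_nonneg)
          then show "U t + V t * \<tau>^2 \<noteq> 0" "1 + \<tau>^2 \<noteq> 0" by auto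
        qed
        have "continuous_on UNIV (\<lambda>t. F t \<tau>)"
          unfolding F_def slope_weight_def curv1_def curv2_def U_def[abs_def] V_def[abs_def]
          by (intro continuous_intros) (use nz in \<open>auto simp: U_def V_def\<close>)
        then have "isCont (\<lambda>t. F t \<tau>) a" by (simp add: continuous_on_eq_continuous_at)
        from isCont_tendsto_compose[OF this] 1 show ?thesis by blast
      qed
      then show "AE \<tau> in lborel. (\<lambda>n. F (x n) \<tau>) \<longlonglongrightarrow> F a \<tau>" by simp
      fix n
      have "norm (F (x n) \<tau>) \<le> B * (2 * (1 + T)) * inverse (1 + \<tau>^2)" for \<tau>
      proof -
        let ?u = "U (x n)" and ?v = "V (x n)"
        have xn: "- T \<le> x n" "x n \<le> T" using 1 by auto
        have le: "?u \<le> 1 + T" "?v \<le> 1 + T" using xn T0 by (auto simp: U_def V_def)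
        have "(min ?u ?v) powr (s / 2 - 1) \<le> 1 powr (s / 2 - 1)" using UV s by (intro powr_mono2') auto
        then have "B * (min ?u ?v) powr (s / 2 - 1) * inverse (1 + \<tau>^2) \<le> B * 1 * inverse (1 + \<tau>^2)"
          using B by (intro mult_mono) auto
        then have w: "slope_weight s f ?u ?v \<tau> \<le> B * inverse (1 + \<tau>^2)"
          using slope_weight_le[OF UV(3,4) B(2), of "x n" "x n" \<tau>] by simp
        have "\<bar>curv1 s ?u ?v \<tau> - curv2 s ?u ?v \<tau>\<bar> \<le> 2 * (1 + T)"
          using curv_bounds[OF UV(3,4), of "x n" "x n" \<tau>] le by (auto simp: abs_le_iff)
        then have "norm (F (x n) \<tau>) \<le> (B * inverse (1 + \<tau>^2)) * (2 * (1 + T))"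
          unfolding F_def using w slope_weight_nonneg[of ?u ?v \<tau>] B
          by (simp add: abs_mult) (intro mult_mono, auto)
        then show ?thesis by (simp add: ac_simps)
      qed
      then show "AE \<tau> in lborel. norm (F (x n) \<tau>) \<le> B * (2 * (1 + T)) * inverse (1 + \<tau>^2)" by simp
    qed
    then show ?case by (simp add: DF o_def)
  qed
  have "\<exists>t. - T \<le> t \<and> t \<le> T \<and> D t = 0"
    using pos' neg' T0 contD by (intro IVT') auto
  then obtain t where t: "D t = 0" by blast
  have "curvature1 s f (U t) (V t) > 0"
  proof -
    let ?u = "U t" and ?v = "V t"
    have "\<exists>c>0. \<forall>\<tau>. 1 \<le> \<tau> \<longrightarrow> \<tau> \<le> 2 \<longrightarrow> c \<le> slope_weight s f ?u ?v \<tau> * curv1 s ?u ?v \<tau>"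
    proof -
      have nz: "?u + ?v * \<tau>^2 > 0" "1 + \<tau>^2 > 0" for \<tau> using UV[of t] by (auto simp add: add_pos_nonneg)
      have nz': "?u + ?v * \<tau>^2 \<noteq> 0" "1 + \<tau>^2 \<noteq> 0" for \<tau> using nz[of \<tau>] by auto
      have "continuous_on {1..2} (\<lambda>\<tau>. slope_weight s f ?u ?v \<tau> * curv1 s ?u ?v \<tau>)"
        unfolding slope_weight_def curv1_def
        by (intro continuous_intros continuous_on_compose2[OF cont]) (use nz' in auto)
      from continuous_attains_inf[OF compact_Icc _ this]
      obtain x where x: "x \<in> {1..2}" "\<forall>y\<in>{1..2}. slope_weight s f ?u ?v x * curv1 s ?u ?v x \<le> slope_weight s f ?u ?v y * curv1 s ?u ?v y"
        by auto
      have "(s - 1) * ?u + ?v * x^2 > 0" using s UV[of t] x by (intro add_nonneg_pos mult_pos_pos mult_nonneg_nonneg) auto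
      then have "slope_weight s f ?u ?v x * curv1 s ?u ?v x > 0"
        unfolding slope_weight_def curv1_def using nz[of x] pos UV by simp
      then show ?thesis using x(2) by force
    qed
    then obtain c where c: "c > 0" "\<And>\<tau>. 1 \<le> \<tau> \<Longrightarrow> \<tau> \<le> 2 \<Longrightarrow> c \<le> slope_weight s f ?u ?v \<tau> * curv1 s ?u ?v \<tau>" by blast
    have "c * (2 - 1) \<le> curvature1 s f ?u ?v" unfolding curvature1_def
      using integrable_curv[OF UV(3,4)] slope_weight_nonneg curv_bounds[OF UV(3,4)] c
      by (intro integral_ge_interval) auto
    then show ?thesis using c by simp
  qed
  then show ?thesis using t UV unfolding D_def by (intro exI[of _ "U t"] exI[of _ "V t"]) auto
qed

text \<open>Homogeneity of degree \<open>s / 2\<close>; the mass is homogeneous of degree \<open>- 1\<close>, so a dilation adjusts their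
  ratio to any prescribed value.\<close>

lemma curvature_scale:
  assumes uv: "u > 0" "v > 0" and l: "l > 0"
  shows "curvature1 s f (l * u) (l * v) = l powr (s / 2) * curvature1 s f u v" "curvature2 s f (l * u) (l * v) = l powr (s / 2) * curvature2 s f u v"
proof -
  have m: "u + v * \<tau>^2 > 0" for \<tau> using uv by (simp add: add_pos_nonneg)
  have w: "slope_weight s f (l * u) (l * v) \<tau> = l powr (s / 2 - 1) * slope_weight s f u v \<tau>" for \<tau>
  proof -
    have "(l * u + l * v * \<tau>^2) / (1 + \<tau>^2) = l * ((u + v * \<tau>^2) / (1 + \<tau>^2))" by (simp add: distrib_left mult.assoc)
    moreover have "(u + v * \<tau>^2) / (1 + \<tau>^2) \<ge> 0" using m[of \<tau>] by (simp add: add_nonneg_nonneg)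
    ultimately have "((l * u + l * v * \<tau>^2) / (1 + \<tau>^2)) powr (s / 2 - 1) =
        l powr (s / 2 - 1) * ((u + v * \<tau>^2) / (1 + \<tau>^2)) powr (s / 2 - 1)"
      using l by (simp only: powr_mult less_imp_le)
    then show ?thesis unfolding slope_weight_def by simp
  qed
  have c: "curv1 s (l * u) (l * v) \<tau> = l * curv1 s u v \<tau>" "curv2 s (l * u) (l * v) \<tau> = l * curv2 s u v \<tau>" for \<tau>
  proof -
    have "l * u + l * v * \<tau>^2 = l * (u + v * \<tau>^2)" "(s - 1) * (l * u) + l * v * \<tau>^2 = l * ((s - 1) * u + v * \<tau>^2)"
      "l * u + (s - 1) * (l * v * \<tau>^2) = l * (u + (s - 1) * (v * \<tau>^2))"
      by (auto simp: algebra_simps)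
    then show "curv1 s (l * u) (l * v) \<tau> = l * curv1 s u v \<tau>" "curv2 s (l * u) (l * v) \<tau> = l * curv2 s u v \<tau>"
      unfolding curv1_def curv2_def using l by auto
  qed
  have e: "l powr (s / 2 - 1) * l = l powr (s / 2)" using l powr_mult_base[of l "s / 2 - 1"] by (simp add: mult.commute)
  have E: "l powr (s / 2 - 1) * x * (l * y) = l powr (s / 2) * (x * y)" for x y
    unfolding e[symmetric] by (simp only: ac_simps)
  show "curvature1 s f (l * u) (l * v) = l powr (s / 2) * curvature1 s f u v" "curvature2 s f (l * u) (l * v) = l powr (s / 2) * curvature2 s f u v"
    unfolding curvature1_def curvature2_def w c E by simp_all
qed

lemma exists_equilibrium_axes:
  "\<exists>u v. u > 0 \<and> v > 0 \<and> chord_const s * curvature1 s f u v = ellipse_mass s u v \<and> chord_const s * curvature2 s f u v = ellipse_mass s u v"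
proof -
  obtain u v where uv: "u > 0" "v > 0" "curvature1 s f u v = curvature2 s f u v" "curvature1 s f u v > 0" using exists_balanced by blast
  have k: "chord_const s > 0" using s chord_const_pos by simp
  define Z where "Z = ellipse_mass s u v / (chord_const s * curvature1 s f u v)"
  have Z: "Z > 0" using uv s k by (simp add: Z_def ellipse_mass_def)
  \<comment> \<open>the dilation multiplies the ratio of curvature and mass by \<open>l powr (s / 2 + 1)\<close>\<close>
  define l where "l = Z powr (1 / (s / 2 + 1))"
  have l: "l > 0" using Z by (simp add: l_def)
  have "l powr (s / 2 + 1) = Z" using Z s by (simp add: l_def powr_powr)
  then have lZ: "l powr (s / 2) * l = Z" using l powr_mult_base[of l "s/2"] by (simp add: mult.commute add.commute)
  have em: "ellipse_mass s (l * u) (l * v) = ellipse_mass s u v / l"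
  proof -
    have "sqrt (l * u * (l * v)) = l * sqrt (u * v)"
    proof -
      have "l * u * (l * v) = l^2 * (u * v)" by (simp add: power2_eq_square)
      then show ?thesis using l by (simp add: real_sqrt_mult)
    qed
    then show ?thesis by (simp add: ellipse_mass_def)
  qed
  have "chord_const s * curvature1 s f (l * u) (l * v) = ellipse_mass s (l * u) (l * v)"
  proof -
    have "chord_const s * curvature1 s f (l * u) (l * v) * l = (l powr (s / 2) * l) * (chord_const s * curvature1 s f u v)"
      using curvature_scale(1)[OF uv(1,2) l] by simp
    also have "\<dots> = ellipse_mass s u v" unfolding lZ Z_def using k uv by simp
    finally show ?thesis unfolding em using l by (simp add: field_simps)
  qed
  then show ?thesis using uv l curvature_scale[OF uv(1,2) l]
    by (intro exI[of _ "l * u"] exI[of _ "l * v"]) auto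
qed

section \<open>The potential of the equilibrium ellipse\<close>

text \<open>The Euler--Lagrange condition. Inside the ellipse the normalised singular potential is \<open>L - |x|^2\<close>:
  every slope contributes a quadratic polynomial, the mixed term is odd in \<open>\<tau>\<close> and integrates to zero, and
  the coefficients of the squares are \<open>- 1\<close> by the choice of \<open>u\<close> and \<open>v\<close>. Outside the ellipse the bound
  for a single chord is integrated over the slopes.\<close>

lemma equilibrium_potential:
  assumes even: "\<And>t. f (- t) = f t" and uv: "u > 0" "v > 0"
    and bal: "chord_const s * curvature1 s f u v = ellipse_mass s u v" "chord_const s * curvature2 s f u v = ellipse_mass s u v"
  defines "L \<equiv> chord_const s * (LINT \<tau>|lborel. slope_weight s f u v \<tau>) / ellipse_mass s u v"
  defines "V \<equiv> \<lambda>x. \<integral>\<^sup>+y. riesz s f (x - y) * ennreal (ellipse_density s u v y / ellipse_mass s u v) \<partial>lborel"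
  shows "ennreal (L - (x $ 1)^2 - (x $ 2)^2) \<le> V x"
    and "0 < 1 - u * (x $ 1)^2 - v * (x $ 2)^2 \<Longrightarrow> V x = ennreal (L - (x $ 1)^2 - (x $ 2)^2)"
    and "0 < 1 - u * (x $ 1)^2 - v * (x $ 2)^2 \<Longrightarrow> 0 \<le> L - (x $ 1)^2 - (x $ 2)^2"
proof -
  let ?k = "chord_const s" and ?M = "ellipse_mass s u v"
  have k: "?k > 0" using s chord_const_pos by simp
  have M: "?M > 0" using uv s by (simp add: ellipse_mass_def)
  note [measurable] = slope_weight_measurable borel_measurable_continuous_onI[OF cont]
    borel_measurable_riesz[of f, OF per]
  define p where "p = 1 - u * (x $ 1)^2 - v * (x $ 2)^2"
  define q where "q \<tau> = u * x $ 1 + v * \<tau> * x $ 2" for \<tau>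
  define m where "m \<tau> = u + v * \<tau>^2" for \<tau>
  define w where "w \<tau> = slope_weight s f u v \<tau>" for \<tau>
  define \<kappa> where "\<kappa> \<tau> = (1 + \<tau>^2) powr (- s / 2) * f (arctan \<tau>)" for \<tau>
  \<comment> \<open>the contribution of one slope if the chord formula for interior points were valid at \<open>x\<close>\<close>
  define G where "G \<tau> = ?k * (w \<tau> * (p + (2 - s) * (q \<tau>)^2 / m \<tau>))" for \<tau>
  have m: "m \<tau> > 0" for \<tau> using uv by (simp add: m_def add_pos_nonneg)
  have \<kappa>0: "\<kappa> \<tau> \<ge> 0" for \<tau> using pos[of "arctan \<tau>"] by (simp add: \<kappa>_def)
  have w0: "w \<tau> \<ge> 0" for \<tau> unfolding w_def by (rule slope_weight_nonneg)
  have \<kappa>w: "\<kappa> \<tau> * m \<tau> powr (s / 2 - 1) = w \<tau>" for \<tau>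
  proof -
    have o: "1 + \<tau>^2 > 0" by (simp add: add_pos_nonneg)
    have "(m \<tau> / (1 + \<tau>^2)) powr (s / 2 - 1) = m \<tau> powr (s / 2 - 1) * (1 + \<tau>^2) powr (1 - s / 2)"
      using o m[of \<tau>] powr_minus_divide[of "1 + \<tau>^2" "s / 2 - 1"] by (simp add: powr_divide)
    moreover have "(1 + \<tau>^2) powr (1 - s / 2) = (1 + \<tau>^2) * (1 + \<tau>^2) powr (- s / 2)"
      using o powr_mult_base[of "1 + \<tau>^2" "- s / 2"] by simp
    ultimately show ?thesis using o unfolding w_def slope_weight_def \<kappa>_def m_def[symmetric] by simp
  qed
  have V: "V x = ennreal (1 / ?M) * (\<integral>\<^sup>+\<tau>. ennreal (\<kappa> \<tau>) * chord s p (q \<tau>) (m \<tau>) \<partial>lborel)"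
  proof -
    have "V x = (\<integral>\<^sup>+y. ennreal (1 / ?M) * (riesz s f (x - y) * ennreal (ellipse_density s u v y)) \<partial>lborel)"
      unfolding V_def using M
      by (intro nn_integral_cong) (simp add: ennreal_mult''[symmetric] ellipse_density_def mult.left_commute)
    also have "\<dots> = ennreal (1 / ?M) * (\<integral>\<^sup>+y. riesz s f (x - y) * ennreal (ellipse_density s u v y) \<partial>lborel)"
      by (rule nn_integral_cmult) measurable
    finally show ?thesis
      using riesz_potential_ellipse[of f s x u v, OF per borel_measurable_continuous_onI[OF cont] less_imp_le[OF pos]]
      by (simp add: \<kappa>_def p_def q_def m_def)
  qed
  have G\<kappa>: "ennreal (\<kappa> \<tau>) * ennreal (?k * m \<tau> powr (s / 2 - 1) * (p + (2 - s) * (q \<tau>)^2 / m \<tau>)) = ennreal (G \<tau>)" for \<tau>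
    using \<kappa>0[of \<tau>] \<kappa>w[of \<tau>] by (simp add: ennreal_mult'[symmetric] G_def) (simp add: \<kappa>w[symmetric] ac_simps)
  define h where "h \<tau> = \<tau> / m \<tau>" for \<tau>
  have h: "\<bar>h \<tau>\<bar> \<le> 1 / min u v" for \<tau>
  proof -
    have "min u v * \<bar>\<tau>\<bar> \<le> min u v * (1 + \<tau>^2)"
    proof (intro mult_left_mono)
      have "0 \<le> (\<bar>\<tau>\<bar> - 1)^2" by simp
      then show "\<bar>\<tau>\<bar> \<le> 1 + \<tau>^2" unfolding power2_diff by (simp add: abs_if split: if_splits)
    qed (use uv in auto)
    also have "\<dots> \<le> m \<tau>" using quot_ge_min[OF uv, of \<tau>] add_pos_nonneg[OF zero_less_one zero_le_power2, of \<tau>]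
      by (simp add: m_def pos_le_divide_eq)
    finally have "\<bar>\<tau>\<bar> / m \<tau> \<le> 1 / min u v" using m[of \<tau>] uv by (simp add: field_simps)
    then show ?thesis using m[of \<tau>] by (simp add: h_def)
  qed
  have [measurable]: "h \<in> borel_measurable borel" unfolding h_def[abs_def] m_def by measurable
  have int: "integrable lborel (\<lambda>\<tau>. w \<tau>)" "integrable lborel (\<lambda>\<tau>. w \<tau> * h \<tau>)"
    "integrable lborel (\<lambda>\<tau>. w \<tau> * curv1 s u v \<tau>)" "integrable lborel (\<lambda>\<tau>. w \<tau> * curv2 s u v \<tau>)"
    using integrable_slope_weight[OF uv, of "\<lambda>_. 1" 1] integrable_slope_weight[OF uv, of h "1 / min u v"] h
      integrable_curv[OF uv] by (auto simp: w_def)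
  have odd: "(LINT \<tau>|lborel. w \<tau> * h \<tau>) = 0"
  proof -
    have "w (- \<tau>) * h (- \<tau>) = - (w \<tau> * h \<tau>)" for \<tau>
      by (simp add: w_def h_def m_def slope_weight_def even arctan_minus)
    then show ?thesis using lborel_integral_real_affine[of "-1" "\<lambda>\<tau>. w \<tau> * h \<tau>" 0] by simp
  qed
  have Gexp: "G \<tau> = ?k * (w \<tau> - (x $ 1)^2 * (w \<tau> * curv1 s u v \<tau>) - (x $ 2)^2 * (w \<tau> * curv2 s u v \<tau>)
      + (2 * (2 - s) * u * v * x $ 1 * x $ 2) * (w \<tau> * h \<tau>))" for \<tau>
  proof -
    let ?m = "m \<tau>"
    have vt: "v * \<tau>^2 = ?m - u" by (simp add: m_def)
    have c1: "curv1 s u v \<tau> = u - (2 - s) * u^2 / ?m"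
      using m[of \<tau>] unfolding curv1_def m_def[symmetric] vt by (simp add: field_simps power2_eq_square)
    have c2: "curv2 s u v \<tau> = v - (2 - s) * (v^2 * \<tau>^2) / ?m"
    proof -
      have "v^2 * \<tau>^2 = v * (?m - u)" by (simp add: power2_eq_square vt[unfolded power2_eq_square, symmetric] m_def)
      then have e: "v^2 * \<tau>^2 = v * (?m - u)" .
      show ?thesis using m[of \<tau>] unfolding e curv2_def m_def[symmetric] vt by (simp add: field_simps)
    qed
    have "p + (2 - s) * (q \<tau>)^2 / ?m = 1 - (x $ 1)^2 * curv1 s u v \<tau> - (x $ 2)^2 * curv2 s u v \<tau>
      + (2 * (2 - s) * u * v * x $ 1 * x $ 2) * h \<tau>"
      unfolding c1 c2 h_def p_def q_def using m[of \<tau>] by (simp add: field_simps power2_eq_square)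
    then have e: "p + (2 - s) * (q \<tau>)^2 / ?m = 1 - (x $ 1)^2 * curv1 s u v \<tau> - (x $ 2)^2 * curv2 s u v \<tau>
      + (2 * (2 - s) * u * v * x $ 1 * x $ 2) * h \<tau>" .
    show ?thesis unfolding G_def e by (simp add: algebra_simps)
  qed
  have intG: "integrable lborel G" unfolding Gexp[abs_def]
    by (intro integrable_mult_right Bochner_Integration.integrable_add Bochner_Integration.integrable_diff int)
  have "integral\<^sup>L lborel G = ?k * ((LINT \<tau>|lborel. w \<tau>) - (x $ 1)^2 * (LINT \<tau>|lborel. w \<tau> * curv1 s u v \<tau>)
       - (x $ 2)^2 * (LINT \<tau>|lborel. w \<tau> * curv2 s u v \<tau>) + (2 * (2 - s) * u * v * x $ 1 * x $ 2) * (LINT \<tau>|lborel. w \<tau> * h \<tau>))"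
    unfolding Gexp[abs_def]
    by (simp add: int)
  also have "\<dots> = ?M * (L - (x $ 1)^2 - (x $ 2)^2)"
  proof -
    have aux: "k * (b - y * c - z * d + e * 0) = M * (l - y - z)"
      if "k * b = M * l" "k * c = M" "k * d = M" for k b y c z d e M l :: real
    proof -
      have "k * (b - y * c - z * d + e * 0) = k * b - y * (k * c) - z * (k * d)" by (simp add: algebra_simps)
      then show ?thesis unfolding that by (simp add: algebra_simps)
    qed
    show ?thesis unfolding odd
    proof (rule aux)
      show "?k * (LINT \<tau>|lborel. w \<tau>) = ?M * L" using M by (simp add: L_def w_def)
      show "?k * (LINT \<tau>|lborel. w \<tau> * curv1 s u v \<tau>) = ?M"
        using bal(1) by (simp add: curvature1_def w_def)
      show "?k * (LINT \<tau>|lborel. w \<tau> * curv2 s u v \<tau>) = ?M"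
        using bal(2) by (simp add: curvature2_def w_def)
    qed
  qed
  finally have IG: "1 / ?M * integral\<^sup>L lborel G = L - (x $ 1)^2 - (x $ 2)^2" using M by simp
  have le: "ennreal (G \<tau>) \<le> ennreal (\<kappa> \<tau>) * chord s p (q \<tau>) (m \<tau>)" for \<tau>
  proof (cases "p > 0")
    case True
    show ?thesis unfolding chord_inside[OF s True m] G\<kappa> by simp
  next
    case False
    then show ?thesis unfolding G\<kappa>[symmetric] using chord_outside[OF s _ m[of \<tau>], of p "q \<tau>"] by (intro mult_left_mono) auto
  qed
  have "ennreal (L - (x $ 1)^2 - (x $ 2)^2) = ennreal (1 / ?M) * ennreal (integral\<^sup>L lborel G)"
    unfolding IG[symmetric] using M by (intro ennreal_mult') simp
  also have "\<dots> \<le> ennreal (1 / ?M) * (\<integral>\<^sup>+\<tau>. ennreal (G \<tau>) \<partial>lborel)"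
    by (intro mult_left_mono integral_le_nn_integral intG) auto
  also have "\<dots> \<le> V x" unfolding V by (intro mult_left_mono nn_integral_mono le) auto
  finally show "ennreal (L - (x $ 1)^2 - (x $ 2)^2) \<le> V x" .
  assume "0 < 1 - u * (x $ 1)^2 - v * (x $ 2)^2"
  then have p: "p > 0" by (simp add: p_def)
  have G0: "G \<tau> \<ge> 0" for \<tau> unfolding G_def using k w0[of \<tau>] p s m[of \<tau>] by simp
  have "V x = ennreal (1 / ?M) * (\<integral>\<^sup>+\<tau>. ennreal (G \<tau>) \<partial>lborel)"
    unfolding V chord_inside[OF s p m] G\<kappa> ..
  also have "(\<integral>\<^sup>+\<tau>. ennreal (G \<tau>) \<partial>lborel) = ennreal (integral\<^sup>L lborel G)"
    using G0 by (intro nn_integral_eq_integral intG) auto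
  also have "ennreal (1 / ?M) * ennreal (integral\<^sup>L lborel G) = ennreal (L - (x $ 1)^2 - (x $ 2)^2)"
    unfolding IG[symmetric] using M by (intro ennreal_mult'[symmetric]) simp
  finally show "V x = ennreal (L - (x $ 1)^2 - (x $ 2)^2)" .
  show "0 \<le> L - (x $ 1)^2 - (x $ 2)^2" unfolding IG[symmetric] using M G0 by (intro mult_nonneg_nonneg integral_nonneg) auto
qed

end

section \<open>Positive definite kernels\<close>

text \<open>The interaction energy of two measures.\<close>

definition mutual :: "(real^2 \<Rightarrow> ennreal) \<Rightarrow> (real^2) measure \<Rightarrow> (real^2) measure \<Rightarrow> ennreal" where
  "mutual K \<mu> \<nu> = (\<integral>\<^sup>+x. (\<integral>\<^sup>+y. K (x - y) \<partial>\<nu>) \<partial>\<mu>)"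

text \<open>Positive definiteness, phrased as a form of the Cauchy--Schwarz inequality so that it makes sense for
  nonnegative extended-valued kernels and for infinite energies; formally it says that the energy of the
  signed measure \<open>\<mu> - \<nu>\<close> is nonnegative.\<close>

definition pos_def :: "(real^2 \<Rightarrow> ennreal) \<Rightarrow> bool" where
  "pos_def K \<longleftrightarrow> (\<forall>\<mu>\<in>prob_measures. \<forall>\<nu>\<in>prob_measures. 2 * mutual K \<mu> \<nu> \<le> mutual K \<mu> \<mu> + mutual K \<nu> \<nu>)"

lemma prob_measuresD:
  assumes "\<mu> \<in> prob_measures"
  shows "prob_space \<mu>" "sets \<mu> = sets borel" "sigma_finite_measure \<mu>" "space \<mu> = UNIV"
  using assms prob_space_imp_sigma_finite[of \<mu>] sets_eq_imp_space_eq[of \<mu> borel] by (auto simp: prob_measures_def)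

lemma pos_defD: "pos_def K \<Longrightarrow> \<mu> \<in> prob_measures \<Longrightarrow> \<nu> \<in> prob_measures \<Longrightarrow> 2 * mutual K \<mu> \<nu> \<le> mutual K \<mu> \<mu> + mutual K \<nu> \<nu>"
  by (simp add: pos_def_def)

lemma measurable_prob_cong:
  assumes "\<mu> \<in> prob_measures" shows "measurable \<mu> M = measurable borel M"
  using prob_measuresD[OF assms] by (intro measurable_cong_sets) auto

lemma measurable_inner_potential [measurable]:
  assumes K[measurable]: "K \<in> borel_measurable borel" and \<nu>: "\<nu> \<in> prob_measures"
  shows "(\<lambda>x. \<integral>\<^sup>+y. K (x - y) \<partial>\<nu>) \<in> borel_measurable borel"
proof -
  interpret sigma_finite_measure \<nu> using prob_measuresD[OF \<nu>] by simp
  have [measurable_cong]: "sets \<nu> = sets borel" using prob_measuresD[OF \<nu>] by simp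
  show ?thesis by measurable
qed

lemma mutual_mono: "(\<And>x. K x \<le> K' x) \<Longrightarrow> mutual K \<mu> \<nu> \<le> mutual K' \<mu> \<nu>"
  unfolding mutual_def by (intro nn_integral_mono)

lemma mutual_add:
  assumes K[measurable]: "K \<in> borel_measurable borel" "K' \<in> borel_measurable borel" and \<mu>: "\<mu> \<in> prob_measures" "\<nu> \<in> prob_measures"
  shows "mutual (\<lambda>x. K x + K' x) \<mu> \<nu> = mutual K \<mu> \<nu> + mutual K' \<mu> \<nu>"
proof -
  have [measurable_cong]: "sets \<nu> = sets borel" "sets \<mu> = sets borel" using prob_measuresD \<mu> by auto
  note [measurable] = measurable_inner_potential[OF K(1) \<mu>(2)] measurable_inner_potential[OF K(2) \<mu>(2)]
  show ?thesis unfolding mutual_def by (simp add: nn_integral_add)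
qed

lemma mutual_cmult:
  assumes K[measurable]: "K \<in> borel_measurable borel" and \<mu>: "\<mu> \<in> prob_measures" "\<nu> \<in> prob_measures"
  shows "mutual (\<lambda>x. c * K x) \<mu> \<nu> = c * mutual K \<mu> \<nu>"
proof -
  have [measurable_cong]: "sets \<nu> = sets borel" "sets \<mu> = sets borel" using prob_measuresD \<mu> by auto
  note [measurable] = measurable_inner_potential[OF K(1) \<mu>(2)]
  show ?thesis unfolding mutual_def by (simp add: nn_integral_cmult)
qed

lemma mutual_mixture:
  assumes k[measurable]: "(\<lambda>(i, x). k i x) \<in> borel_measurable (M \<Otimes>\<^sub>M borel)" and M: "sigma_finite_measure M"
    and \<mu>: "\<mu> \<in> prob_measures" "\<nu> \<in> prob_measures"
  shows "mutual (\<lambda>x. \<integral>\<^sup>+i. k i x \<partial>M) \<mu> \<nu> = (\<integral>\<^sup>+i. mutual (k i) \<mu> \<nu> \<partial>M)"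
    and "(\<lambda>i. mutual (k i) \<mu> \<nu>) \<in> borel_measurable M"
proof -
  have [measurable_cong]: "sets \<nu> = sets borel" "sets \<mu> = sets borel" using prob_measuresD \<mu> by auto
  interpret M: sigma_finite_measure M by fact
  interpret mu: sigma_finite_measure \<mu> using prob_measuresD \<mu> by auto
  interpret nu: sigma_finite_measure \<nu> using prob_measuresD \<mu> by auto
  interpret P: pair_sigma_finite M \<nu> ..
  interpret Q: pair_sigma_finite M \<mu> ..
  have "mutual (\<lambda>x. \<integral>\<^sup>+i. k i x \<partial>M) \<mu> \<nu> = (\<integral>\<^sup>+x. (\<integral>\<^sup>+i. (\<integral>\<^sup>+y. k i (x - y) \<partial>\<nu>) \<partial>M) \<partial>\<mu>)"
    unfolding mutual_def by (intro nn_integral_cong P.Fubini') measurable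
  also have "\<dots> = (\<integral>\<^sup>+i. mutual (k i) \<mu> \<nu> \<partial>M)"
    unfolding mutual_def by (intro Q.Fubini') measurable
  finally show "mutual (\<lambda>x. \<integral>\<^sup>+i. k i x \<partial>M) \<mu> \<nu> = (\<integral>\<^sup>+i. mutual (k i) \<mu> \<nu> \<partial>M)" .
  show "(\<lambda>i. mutual (k i) \<mu> \<nu>) \<in> borel_measurable M" unfolding mutual_def by measurable
qed

lemma pos_def_mixture:
  assumes k: "(\<lambda>(i, x). k i x) \<in> borel_measurable (M \<Otimes>\<^sub>M borel)" and M: "sigma_finite_measure M"
    and pd: "\<And>i. i \<in> space M \<Longrightarrow> pos_def (k i)"
  shows "pos_def (\<lambda>x. \<integral>\<^sup>+i. k i x \<partial>M)"
  unfolding pos_def_def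
proof (intro ballI)
  fix \<mu> \<nu> assume \<mu>: "\<mu> \<in> prob_measures" and \<nu>: "\<nu> \<in> prob_measures"
  note m = mutual_mixture[OF k M]
  have "2 * mutual (\<lambda>x. \<integral>\<^sup>+i. k i x \<partial>M) \<mu> \<nu> = (\<integral>\<^sup>+i. 2 * mutual (k i) \<mu> \<nu> \<partial>M)"
    by (simp add: m \<mu> \<nu> nn_integral_cmult)
  also have "\<dots> \<le> (\<integral>\<^sup>+i. mutual (k i) \<mu> \<mu> + mutual (k i) \<nu> \<nu> \<partial>M)"
    using pd pos_defD[OF _ \<mu> \<nu>] by (intro nn_integral_mono) auto
  also have "\<dots> = mutual (\<lambda>x. \<integral>\<^sup>+i. k i x \<partial>M) \<mu> \<mu> + mutual (\<lambda>x. \<integral>\<^sup>+i. k i x \<partial>M) \<nu> \<nu>"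
    by (simp add: m \<mu> \<nu> nn_integral_add)
  finally show "2 * mutual (\<lambda>x. \<integral>\<^sup>+i. k i x \<partial>M) \<mu> \<nu> \<le> \<dots>" .
qed

lemma pos_def_cmult:
  assumes "K \<in> borel_measurable borel" "pos_def K"
  shows "pos_def (\<lambda>x. c * K x)"
  unfolding pos_def_def
proof (intro ballI)
  fix \<mu> \<nu> assume \<mu>: "\<mu> \<in> prob_measures" and \<nu>: "\<nu> \<in> prob_measures"
  have "c * (2 * mutual K \<mu> \<nu>) \<le> c * (mutual K \<mu> \<mu> + mutual K \<nu> \<nu>)"
    using pos_defD[OF assms(2) \<mu> \<nu>] by (intro mult_left_mono) auto
  then show "2 * mutual (\<lambda>x. c * K x) \<mu> \<nu> \<le> mutual (\<lambda>x. c * K x) \<mu> \<mu> + mutual (\<lambda>x. c * K x) \<nu> \<nu>"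
    by (simp add: mutual_cmult assms \<mu> \<nu> distrib_left mult.left_commute)
qed

section \<open>Gaussian kernels\<close>

definition gauss :: "real \<Rightarrow> real^2 \<Rightarrow> ennreal" where
  "gauss t x = ennreal (exp (- t * (norm x)^2))"

lemma gauss_measurable [measurable]: "gauss t \<in> borel_measurable borel"
  unfolding gauss_def[abs_def] by measurable

definition gauss_mass :: "real \<Rightarrow> ennreal" where
  "gauss_mass t = (\<integral>\<^sup>+z. gauss t z \<partial>lborel)"

lemma norm_vec2: "(norm (x :: real^2))^2 = (x $ 1)^2 + (x $ 2)^2"
  by (simp add: norm_vec_def L2_set_def UNIV_2)

text \<open>The bound \<open>exp (- t a^2) \<le> 1 / (1 + t a^2)\<close> in each coordinate reduces finiteness to the integral of
  an inverse quadratic.\<close>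

lemma gauss_mass_finite: assumes "t > 0" shows "gauss_mass t < \<infinity>"
proof -
  have b: "exp (- t * a^2) \<le> 1 / (1 + t * a^2)" for a :: real
  proof -
    have "1 + t * a^2 \<le> exp (t * a^2)" by (rule exp_ge_add_one_self)
    moreover have "1 + t * a^2 > 0" using assms by (simp add: add_pos_nonneg)
    ultimately have "1 / exp (t * a^2) \<le> 1 / (1 + t * a^2)" by (intro divide_left_mono) auto
    then show ?thesis by (simp add: exp_minus inverse_eq_divide)
  qed
  have "gauss_mass t = (\<integral>\<^sup>+a. \<integral>\<^sup>+b. ennreal (exp (- t * a^2)) * ennreal (exp (- t * b^2)) \<partial>lborel \<partial>lborel)"
    unfolding gauss_mass_def
    by (subst nn_integral_vec2) (auto simp: gauss_def norm_vec2 ennreal_mult[symmetric] exp_add[symmetric] algebra_simps)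
  also have "\<dots> \<le> (\<integral>\<^sup>+a. \<integral>\<^sup>+b. ennreal (1 / (1 + t * a^2)) * ennreal (1 / (1 + t * b^2)) \<partial>lborel \<partial>lborel)"
    by (intro nn_integral_mono mult_mono ennreal_leI b) auto
  also have "\<dots> = ennreal (pi / sqrt (1 * t)) * ennreal (pi / sqrt (1 * t))"
    using assms by (simp add: nn_integral_cmult nn_integral_multc nn_integral_inverse_quadratic[of 1 t, simplified])
  also have "\<dots> < \<infinity>" by (simp add: ennreal_mult[symmetric] assms less_imp_le)
  finally show ?thesis .
qed

lemma gauss_mass_pos: "gauss_mass t > 0"
proof (rule ccontr)
  assume "\<not> gauss_mass t > 0"
  then have "gauss_mass t = 0" by simp
  then have "AE z in lborel. gauss t (z :: real^2) = 0" unfolding gauss_mass_def by (subst (asm) nn_integral_0_iff_AE) auto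
  then have "AE z in (lborel :: (real^2) measure). False" by (simp add: gauss_def ennreal_eq_0_iff not_le)
  then have "emeasure lborel (UNIV :: (real^2) set) = 0" by (simp add: AE_iff_measurable[of UNIV])
  then show False by simp
qed

text \<open>A Gaussian is a convolution square of a Gaussian, by the parallelogram law for \<open>x - z\<close> and \<open>y - z\<close>.\<close>

lemma gauss_convolution:
  "(\<integral>\<^sup>+z. gauss (2 * t) (x - z) * gauss (2 * t) (y - z) \<partial>lborel) = gauss_mass (4 * t) * gauss t (x - y)"
proof -
  define c where "c = (1/2) *\<^sub>R (x + y)"
  have e: "gauss (2 * t) (x - z) * gauss (2 * t) (y - z) = gauss (4 * t) (c - z) * gauss t (x - y)" for z
  proof -
    have p: "2 * (norm (x - z))^2 + 2 * (norm (y - z))^2 = (norm (x - y))^2 + 4 * (norm (c - z))^2"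
      unfolding norm_vec2 c_def by (simp add: power2_eq_square algebra_simps)
    have "- (2 * t) * (norm (x - z))^2 + - (2 * t) * (norm (y - z))^2 = - t * (2 * (norm (x - z))^2 + 2 * (norm (y - z))^2)"
      by (simp add: algebra_simps)
    also have "\<dots> = - (4 * t) * (norm (c - z))^2 + - t * (norm (x - y))^2"
      unfolding p by (simp add: algebra_simps)
    finally show ?thesis unfolding gauss_def by (simp only: ennreal_mult[symmetric] exp_ge_zero exp_add[symmetric])
  qed
  have "(\<integral>\<^sup>+z. gauss (4 * t) (c - z) * gauss t (x - y) \<partial>lborel) = (\<integral>\<^sup>+z. gauss (4 * t) (c - z) \<partial>lborel) * gauss t (x - y)"
    by (rule nn_integral_multc) measurable
  also have "(\<integral>\<^sup>+z. gauss (4 * t) (c - z) \<partial>lborel) = gauss_mass (4 * t)"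
    unfolding gauss_mass_def by (rule nn_integral_lborel_reflect) measurable
  finally show ?thesis unfolding e .
qed

definition mollify :: "real \<Rightarrow> (real^2) measure \<Rightarrow> real^2 \<Rightarrow> ennreal" where
  "mollify t \<mu> z = (\<integral>\<^sup>+x. gauss (2 * t) (x - z) \<partial>\<mu>)"

lemma mollify_measurable [measurable]:
  assumes \<mu>: "\<mu> \<in> prob_measures" shows "mollify t \<mu> \<in> borel_measurable borel"
proof -
  interpret sigma_finite_measure \<mu> using prob_measuresD[OF \<mu>] by simp
  have [measurable_cong]: "sets \<mu> = sets borel" using prob_measuresD[OF \<mu>] by simp
  show ?thesis unfolding mollify_def[abs_def] by measurable
qed

lemma mollify_le_1:
  assumes \<mu>: "\<mu> \<in> prob_measures" and t: "t > 0" shows "mollify t \<mu> z \<le> 1"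
proof -
  interpret prob_space \<mu> using prob_measuresD[OF \<mu>] by simp
  have "mollify t \<mu> z \<le> (\<integral>\<^sup>+x. 1 \<partial>\<mu>)" unfolding mollify_def gauss_def using t
    by (intro nn_integral_mono) (simp add: mult_nonneg_nonneg)
  then show ?thesis by (simp add: emeasure_space_1)
qed

text \<open>Hence the Gaussian interaction of two measures is an inner product of their mollifications, which
  yields both positivity and the discussion of equality.\<close>

lemma mutual_gauss:
  assumes \<mu>: "\<mu> \<in> prob_measures" and \<nu>: "\<nu> \<in> prob_measures"
  shows "gauss_mass (4 * t) * mutual (gauss t) \<mu> \<nu> = (\<integral>\<^sup>+z. mollify t \<mu> z * mollify t \<nu> z \<partial>lborel)"
proof -
  note [measurable] = mollify_measurable[OF \<nu>]
  have [measurable_cong]: "sets \<nu> = sets borel" "sets \<mu> = sets borel" using prob_measuresD \<mu> \<nu> by auto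
  interpret mu: sigma_finite_measure \<mu> using prob_measuresD \<mu> by auto
  interpret nu: sigma_finite_measure \<nu> using prob_measuresD \<nu> by auto
  interpret P: pair_sigma_finite lborel \<nu> ..
  interpret Q: pair_sigma_finite lborel \<mu> ..
  let ?h = "gauss (2 * t)"
  have "gauss_mass (4 * t) * mutual (gauss t) \<mu> \<nu> = mutual (\<lambda>x. gauss_mass (4 * t) * gauss t x) \<mu> \<nu>"
    by (simp add: mutual_cmult \<mu> \<nu>)
  also have "\<dots> = (\<integral>\<^sup>+x. (\<integral>\<^sup>+y. (\<integral>\<^sup>+z. ?h (x - z) * ?h (y - z) \<partial>lborel) \<partial>\<nu>) \<partial>\<mu>)"
    unfolding mutual_def gauss_convolution ..
  also have "\<dots> = (\<integral>\<^sup>+x. (\<integral>\<^sup>+z. (\<integral>\<^sup>+y. ?h (x - z) * ?h (y - z) \<partial>\<nu>) \<partial>lborel) \<partial>\<mu>)"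
    by (intro nn_integral_cong P.Fubini') measurable
  also have "\<dots> = (\<integral>\<^sup>+x. (\<integral>\<^sup>+z. ?h (x - z) * mollify t \<nu> z \<partial>lborel) \<partial>\<mu>)"
    unfolding mollify_def by (intro nn_integral_cong nn_integral_cmult) measurable
  also have "\<dots> = (\<integral>\<^sup>+z. (\<integral>\<^sup>+x. ?h (x - z) * mollify t \<nu> z \<partial>\<mu>) \<partial>lborel)"
    by (intro Q.Fubini') measurable
  also have "\<dots> = (\<integral>\<^sup>+z. mollify t \<mu> z * mollify t \<nu> z \<partial>lborel)"
    unfolding mollify_def[of t \<mu>] by (intro nn_integral_cong nn_integral_multc) measurable
  finally show ?thesis .
qed

lemma ennreal_two_mult_le:
  fixes a b :: ennreal shows "2 * (a * b) \<le> a * a + b * b"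
proof (cases a; cases b)
  fix x y assume xy: "a = ennreal x" "0 \<le> x" "b = ennreal y" "0 \<le> y"
  have "2 * (x * y) \<le> x * x + y * y" using zero_le_power2[of "x - y"] by (simp add: power2_eq_square algebra_simps)
  then show ?thesis using xy
    by (simp add: ennreal_mult[symmetric] ennreal_plus[symmetric] ennreal_numeral[symmetric] del: ennreal_plus ennreal_numeral)
qed (auto simp: ennreal_top_mult ennreal_mult_top top_unique)

lemma ennreal_two_mult_eq:
  fixes a b :: ennreal assumes "2 * (a * b) = a * a + b * b" "a \<le> 1" "b \<le> 1" shows "a = b"
proof (cases a; cases b)
  fix x y assume xy: "a = ennreal x" "0 \<le> x" "b = ennreal y" "0 \<le> y"
  have "ennreal (2 * (x * y)) = ennreal (x * x + y * y)" using assms(1) xy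
    by (simp add: ennreal_mult[symmetric] ennreal_plus[symmetric] ennreal_numeral[symmetric] del: ennreal_plus ennreal_numeral)
  then have "2 * (x * y) = x * x + y * y" using xy by (subst (asm) ennreal_inj) auto
  then have "(x - y)^2 = 0" by (simp add: power2_eq_square algebra_simps)
  then show ?thesis using xy by simp
qed (use assms in \<open>auto simp: top_unique\<close>)

lemma ennreal_cancel_left:
  fixes c a b :: ennreal assumes "0 < c" "c < \<infinity>" shows "c * a \<le> c * b \<longleftrightarrow> a \<le> b"
  using assms ennreal_mult_le_mult_iff[of c a b] by auto

lemma ennreal_cancel_left_eq:
  fixes c a b :: ennreal assumes "0 < c" "c < \<infinity>" "c * a = c * b" shows "a = b"
  using ennreal_cancel_left[OF assms(1,2), of a b] ennreal_cancel_left[OF assms(1,2), of b a] assms(3)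
  by (intro antisym) auto

lemma pos_def_gauss: assumes t: "t > 0" shows "pos_def (gauss t)"
  unfolding pos_def_def
proof (intro ballI)
  fix \<mu> \<nu> assume \<mu>: "\<mu> \<in> prob_measures" and \<nu>: "\<nu> \<in> prob_measures"
  note [measurable] = mollify_measurable[OF \<mu>] mollify_measurable[OF \<nu>]
  let ?c = "gauss_mass (4 * t)"
  have "?c * (2 * mutual (gauss t) \<mu> \<nu>) = (\<integral>\<^sup>+z. 2 * (mollify t \<mu> z * mollify t \<nu> z) \<partial>lborel)"
    by (simp add: nn_integral_cmult mutual_gauss[OF \<mu> \<nu>, symmetric] mult.left_commute)
  also have "\<dots> \<le> (\<integral>\<^sup>+z. mollify t \<mu> z * mollify t \<mu> z + mollify t \<nu> z * mollify t \<nu> z \<partial>lborel)"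
    by (intro nn_integral_mono ennreal_two_mult_le)
  also have "\<dots> = ?c * (mutual (gauss t) \<mu> \<mu> + mutual (gauss t) \<nu> \<nu>)"
    by (simp add: nn_integral_add mutual_gauss \<mu> \<nu> distrib_left)
  finally show "2 * mutual (gauss t) \<mu> \<nu> \<le> mutual (gauss t) \<mu> \<mu> + mutual (gauss t) \<nu> \<nu>"
    using ennreal_cancel_left[OF gauss_mass_pos gauss_mass_finite, of "4 * t"] t by simp
qed

lemma nn_integral_eq_imp_AE_eq:
  assumes [measurable]: "g \<in> borel_measurable M" "h \<in> borel_measurable M" and le: "AE x in M. g x \<le> h x"
    and eq: "(\<integral>\<^sup>+x. h x \<partial>M) = (\<integral>\<^sup>+x. g x \<partial>M)" and fin: "(\<integral>\<^sup>+x. g x \<partial>M) < \<infinity>"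
  shows "AE x in M. h x = (g x :: ennreal)"
proof -
  have "(\<integral>\<^sup>+x. h x - g x \<partial>M) = 0"
    using fin le eq by (subst nn_integral_diff) auto
  then have "AE x in M. h x - g x = 0" by (subst (asm) nn_integral_0_iff_AE) auto
  moreover have "AE x in M. h x \<noteq> \<infinity>" using eq fin by (intro nn_integral_PInf_AE) auto
  ultimately show ?thesis using le
  proof eventually_elim
    case (elim x)
    then have "h x \<le> g x" using diff_eq_0_iff_ennreal[of "h x" "g x"] by (auto simp: less_top)
    then show ?case using elim by simp
  qed
qed

text \<open>Equality in the Gaussian case: the integral of the square of the difference of the mollifications
  vanishes.\<close>

lemma mollify_eqI:
  assumes \<mu>: "\<mu> \<in> prob_measures" and \<nu>: "\<nu> \<in> prob_measures" and t: "t > 0"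
    and eq: "2 * mutual (gauss t) \<mu> \<nu> = mutual (gauss t) \<mu> \<mu> + mutual (gauss t) \<nu> \<nu>"
    and fin: "mutual (gauss t) \<mu> \<nu> < \<infinity>"
  shows "AE z in lborel. mollify t \<mu> z = mollify t \<nu> z"
proof -
  note [measurable] = mollify_measurable[OF \<mu>] mollify_measurable[OF \<nu>]
  let ?c = "gauss_mass (4 * t)"
  have 1: "?c * (2 * mutual (gauss t) \<mu> \<nu>) = (\<integral>\<^sup>+z. 2 * (mollify t \<mu> z * mollify t \<nu> z) \<partial>lborel)"
    by (simp add: nn_integral_cmult mutual_gauss[OF \<mu> \<nu>, symmetric] mult.left_commute)
  have 2: "(\<integral>\<^sup>+z. mollify t \<mu> z * mollify t \<mu> z + mollify t \<nu> z * mollify t \<nu> z \<partial>lborel) = ?c * (mutual (gauss t) \<mu> \<mu> + mutual (gauss t) \<nu> \<nu>)"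
    by (simp add: nn_integral_add mutual_gauss \<mu> \<nu> distrib_left)
  have "AE z in lborel. mollify t \<mu> z * mollify t \<mu> z + mollify t \<nu> z * mollify t \<nu> z = 2 * (mollify t \<mu> z * mollify t \<nu> z)"
  proof (rule nn_integral_eq_imp_AE_eq)
    show "(\<integral>\<^sup>+z. 2 * (mollify t \<mu> z * mollify t \<nu> z) \<partial>lborel) < \<infinity>"
      unfolding 1[symmetric] using fin gauss_mass_finite[of "4 * t"] t by (simp add: ennreal_mult_less_top)
  qed (use 1 2 eq in \<open>auto simp: ennreal_two_mult_le\<close>)
  then show ?thesis
    by eventually_elim (rule ennreal_two_mult_eq[OF sym mollify_le_1[OF \<mu> t] mollify_le_1[OF \<nu> t]])
qed

section \<open>Strict positive definiteness of the isotropic kernel\<close>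

text \<open>The substitution \<open>z = x - w / sqrt t\<close> turns the narrow Gaussian into a fixed one.\<close>

lemma nn_integral_mollify:
  assumes \<mu>: "\<mu> \<in> prob_measures" and [measurable]: "F \<in> borel_measurable borel" and t: "t > 0"
  shows "ennreal t * (\<integral>\<^sup>+z. F z * mollify t \<mu> z \<partial>lborel) =
    (\<integral>\<^sup>+x. (\<integral>\<^sup>+w. F (x - (1 / sqrt t) *\<^sub>R w) * gauss 2 w \<partial>lborel) \<partial>\<mu>)"
proof -
  note [measurable] = mollify_measurable[OF \<mu>]
  have [measurable_cong]: "sets \<mu> = sets borel" using prob_measuresD \<mu> by auto
  interpret mu: sigma_finite_measure \<mu> using prob_measuresD \<mu> by auto
  interpret Q: pair_sigma_finite lborel \<mu> ..
  have "(\<integral>\<^sup>+z. F z * mollify t \<mu> z \<partial>lborel) = (\<integral>\<^sup>+z. (\<integral>\<^sup>+x. F z * gauss (2 * t) (x - z) \<partial>\<mu>) \<partial>lborel)"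
    unfolding mollify_def by (intro nn_integral_cong nn_integral_cmult[symmetric]) measurable
  also have "\<dots> = (\<integral>\<^sup>+x. (\<integral>\<^sup>+z. F z * gauss (2 * t) (x - z) \<partial>lborel) \<partial>\<mu>)"
    by (intro Q.Fubini'[symmetric]) measurable
  also have "\<dots> = (\<integral>\<^sup>+x. ennreal (1 / t) * (\<integral>\<^sup>+w. F (x - (1 / sqrt t) *\<^sub>R w) * gauss 2 w \<partial>lborel) \<partial>\<mu>)"
  proof (rule nn_integral_cong)
    fix x
    have "(\<integral>\<^sup>+z. F z * gauss (2 * t) (x - z) \<partial>lborel) = (\<integral>\<^sup>+z. F (x - z) * gauss (2 * t) z \<partial>lborel)"
      using nn_integral_lborel_reflect[of "\<lambda>z. F z * gauss (2 * t) (x - z)" x] by simp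
    also have "\<dots> = (\<integral>\<^sup>+z. F (x - z) * gauss (2 * t) z
        \<partial>density (distr lborel borel (\<lambda>w. 0 + (1 / sqrt t) *\<^sub>R w)) (\<lambda>_. \<bar>1 / sqrt t\<bar>^DIM(real^2)))"
      using lborel_affine[of "1 / sqrt t" "0 :: real^2"] t by simp
    also have "\<dots> = ennreal (1 / t) * (\<integral>\<^sup>+w. F (x - (1 / sqrt t) *\<^sub>R w) * gauss 2 w \<partial>lborel)"
    proof -
      have "gauss (2 * t) ((1 / sqrt t) *\<^sub>R w) = gauss 2 w" for w
        unfolding gauss_def using t by (simp add: power_mult_distrib power_divide)
      moreover have "\<bar>1 / sqrt t\<bar>^DIM(real^2) = 1 / t" using t by (simp add: power_divide)
      ultimately show ?thesis
        by (simp add: nn_integral_density nn_integral_distr nn_integral_cmult del: DIM_cart)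
    qed
    finally show "(\<integral>\<^sup>+z. F z * gauss (2 * t) (x - z) \<partial>lborel) = \<dots>" .
  qed
  also have "\<dots> = ennreal (1 / t) * (\<integral>\<^sup>+x. (\<integral>\<^sup>+w. F (x - (1 / sqrt t) *\<^sub>R w) * gauss 2 w \<partial>lborel) \<partial>\<mu>)"
    by (rule nn_integral_cmult) measurable
  finally show ?thesis using t by (simp add: mult.assoc[symmetric] ennreal_mult[symmetric])
qed

lemma mollify_tendsto:
  assumes \<mu>: "\<mu> \<in> prob_measures" and F: "continuous_on UNIV F" "\<And>x. 0 \<le> F x" "\<And>x. F x \<le> (1 :: real)"
    and T: "\<And>n. T n > 0" "filterlim T at_top sequentially"
  shows "(\<lambda>n. ennreal (T n) * (\<integral>\<^sup>+z. ennreal (F z) * mollify (T n) \<mu> z \<partial>lborel)) \<longlonglongrightarrow>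
    (\<integral>\<^sup>+x. ennreal (F x) \<partial>\<mu>) * gauss_mass 2"
proof -
  have [measurable_cong]: "sets \<mu> = sets borel" using prob_measuresD \<mu> by auto
  have [measurable]: "F \<in> borel_measurable borel" using F(1) by (rule borel_measurable_continuous_onI)
  interpret prob_space \<mu> using prob_measuresD \<mu> by auto
  define I where "I n x = (\<integral>\<^sup>+w. ennreal (F (x - (1 / sqrt (T n)) *\<^sub>R w)) * gauss 2 w \<partial>lborel)" for n x
  have [measurable]: "I n \<in> borel_measurable borel" for n unfolding I_def[abs_def] by measurable
  have T': "(\<lambda>n. 1 / sqrt (T n)) \<longlonglongrightarrow> 0"
    by (rule tendsto_divide_0[OF tendsto_const])
      (use filterlim_compose[OF sqrt_at_top T(2)] in \<open>simp add: filterlim_at_top_imp_at_infinity\<close>)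
  have I: "(\<lambda>n. I n x) \<longlonglongrightarrow> ennreal (F x) * gauss_mass 2" for x
  proof -
    have "(\<lambda>n. I n x) \<longlonglongrightarrow> (\<integral>\<^sup>+w. ennreal (F x) * gauss 2 w \<partial>lborel)" unfolding I_def
    proof (rule nn_integral_dominated_convergence[where w="gauss 2"])
      show "AE w in lborel. (\<lambda>n. ennreal (F (x - (1 / sqrt (T n)) *\<^sub>R w)) * gauss 2 w) \<longlonglongrightarrow> ennreal (F x) * gauss 2 w"
      proof (rule AE_I2)
        fix w :: "real^2"
        have "(\<lambda>n. x - (1 / sqrt (T n)) *\<^sub>R w) \<longlonglongrightarrow> x - 0 *\<^sub>R w" by (intro tendsto_intros T')
        then have "(\<lambda>n. F (x - (1 / sqrt (T n)) *\<^sub>R w)) \<longlonglongrightarrow> F x"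
          using F(1) continuous_on_tendsto_compose[OF F(1), of _ x] by simp
        then have "(\<lambda>n. ennreal (F (x - (1 / sqrt (T n)) *\<^sub>R w) * exp (- 2 * (norm w)^2))) \<longlonglongrightarrow> ennreal (F x * exp (- 2 * (norm w)^2))"
          by (intro tendsto_ennrealI tendsto_intros)
        then show "(\<lambda>n. ennreal (F (x - (1 / sqrt (T n)) *\<^sub>R w)) * gauss 2 w) \<longlonglongrightarrow> ennreal (F x) * gauss 2 w"
          by (simp add: gauss_def ennreal_mult F(2))
      qed
      show "(\<integral>\<^sup>+w. gauss 2 w \<partial>lborel) < \<infinity>" using gauss_mass_finite[of 2] by (simp add: gauss_mass_def)
      show "AE w in lborel. ennreal (F (x - (1 / sqrt (T n)) *\<^sub>R w)) * gauss 2 w \<le> gauss 2 w" for n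
        using F mult_right_mono[of "ennreal (F (x - (1 / sqrt (T n)) *\<^sub>R w))" 1 "gauss 2 w" for w] by simp
    qed measurable
    then show ?thesis by (simp add: nn_integral_cmult gauss_mass_def)
  qed
  have "(\<lambda>n. \<integral>\<^sup>+x. I n x \<partial>\<mu>) \<longlonglongrightarrow> (\<integral>\<^sup>+x. ennreal (F x) * gauss_mass 2 \<partial>\<mu>)"
  proof (rule nn_integral_dominated_convergence[where w="\<lambda>_. gauss_mass 2"])
    show "AE x in \<mu>. I n x \<le> gauss_mass 2" for n
    proof (rule AE_I2)
      fix x
      show "I n x \<le> gauss_mass 2" unfolding I_def gauss_mass_def
        using F mult_right_mono[of "ennreal (F (x - (1 / sqrt (T n)) *\<^sub>R w))" 1 "gauss 2 w" for w]
        by (intro nn_integral_mono) simp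
    qed
    show "(\<integral>\<^sup>+x. gauss_mass 2 \<partial>\<mu>) < \<infinity>" using gauss_mass_finite[of 2] by (simp add: emeasure_space_1)
  qed (use I in simp_all)
  then show ?thesis using nn_integral_mollify[OF \<mu>, of "\<lambda>x. ennreal (F x)" "T n" for n] T
    by (simp add: I_def nn_integral_multc)
qed

lemma prob_measures_eqI:
  assumes \<mu>: "\<mu> \<in> prob_measures" and \<nu>: "\<nu> \<in> prob_measures"
    and eq: "\<And>F. continuous_on UNIV F \<Longrightarrow> (\<And>x. 0 \<le> F x) \<Longrightarrow> (\<And>x. F x \<le> (1 :: real)) \<Longrightarrow>
      (\<integral>\<^sup>+x. ennreal (F x) \<partial>\<mu>) = (\<integral>\<^sup>+x. ennreal (F x) \<partial>\<nu>)"
  shows "\<mu> = \<nu>"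
proof -
  interpret mu: prob_space \<mu> using prob_measuresD \<mu> by auto
  interpret nu: prob_space \<nu> using prob_measuresD \<nu> by auto
  have sp: "space \<mu> = UNIV" "space \<nu> = UNIV" using prob_measuresD \<mu> \<nu> by auto
  have open_eq: "emeasure \<mu> U = emeasure \<nu> U" if U: "open U" for U
  proof (cases "U = UNIV")
    case True
    then show ?thesis using mu.emeasure_space_1 nu.emeasure_space_1 sp by simp
  next
    case False
    \<comment> \<open>continuous functions increasing to the indicator of the open set\<close>
    define F where "F n x = min 1 (real n * infdist x (- U))" for n :: nat and x
    have F: "continuous_on UNIV (F n)" "0 \<le> F n x" "F n x \<le> 1" for n x
      unfolding F_def by (intro continuous_intros) (auto simp: infdist_nonneg)
    have lim: "(\<lambda>n. ennreal (F n x)) \<longlonglongrightarrow> indicator U x" for x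
    proof (cases "x \<in> U")
      case True
      have "infdist x (- U) > 0"
        using U True False infdist_pos_not_in_closed[of "- U" x] by auto
      then obtain N where N: "real N * infdist x (- U) > 1" using reals_Archimedean3 by blast
      have "eventually (\<lambda>n. ennreal (F n x) = 1) sequentially"
        using eventually_ge_at_top[of N]
      proof eventually_elim
        case (elim n)
        have "real N * infdist x (- U) \<le> real n * infdist x (- U)" using elim by (intro mult_right_mono) (auto simp: infdist_nonneg)
        then show ?case using N by (simp add: F_def)
      qed
      then show ?thesis using True by (simp add: tendsto_eventually)
    qed (simp add: F_def)
    have conv: "(\<lambda>n. \<integral>\<^sup>+x. ennreal (F n x) \<partial>M) \<longlonglongrightarrow> emeasure M U" if M: "M \<in> prob_measures" for M
    proof -
      interpret prob_space M using prob_measuresD M by auto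
      have [measurable_cong]: "sets M = sets borel" using prob_measuresD M by auto
      have [measurable]: "F n \<in> borel_measurable borel" for n using F(1) by (rule borel_measurable_continuous_onI)
      have [measurable]: "U \<in> sets borel" using U by simp
      have "(\<lambda>n. \<integral>\<^sup>+x. ennreal (F n x) \<partial>M) \<longlonglongrightarrow> (\<integral>\<^sup>+x. indicator U x \<partial>M)"
        by (rule nn_integral_dominated_convergence[where w="\<lambda>_. 1"])
          (use F lim in \<open>auto simp: emeasure_space_1\<close>)
      then show ?thesis by simp
    qed
    have "(\<lambda>n. \<integral>\<^sup>+x. ennreal (F n x) \<partial>\<mu>) = (\<lambda>n. \<integral>\<^sup>+x. ennreal (F n x) \<partial>\<nu>)"
      using eq[OF F(1) F(2) F(3)] by auto
    then show ?thesis using conv[OF \<mu>] conv[OF \<nu>] LIMSEQ_unique by metis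
  qed
  have sb: "sets borel = sigma_sets (UNIV :: (real^2) set) {S. open S}"
    unfolding borel_def by (simp add: sets_measure_of)
  show ?thesis
  proof (rule measure_eqI_generator_eq[where E="{S. open S}" and \<Omega>=UNIV and A="\<lambda>_. UNIV"])
    show "Int_stable {S :: (real^2) set. open S}" by (auto simp: Int_stable_def)
    show "sets \<mu> = sigma_sets UNIV {S. open S}" "sets \<nu> = sigma_sets UNIV {S. open S}"
      using prob_measuresD \<mu> \<nu> sb by auto
    show "emeasure \<mu> UNIV \<noteq> \<infinity>" using mu.emeasure_space_1 sp by simp
  qed (use open_eq in auto)
qed

text \<open>Mollification at scales tending to zero recovers the integrals of all continuous functions.\<close>

lemma mollify_injective:
  assumes \<mu>: "\<mu> \<in> prob_measures" and \<nu>: "\<nu> \<in> prob_measures"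
    and ae: "\<And>n::nat. \<exists>t>real n. AE z in lborel. mollify t \<mu> z = mollify t \<nu> z"
  shows "\<mu> = \<nu>"
proof (rule prob_measures_eqI[OF \<mu> \<nu>])
  fix F :: "real^2 \<Rightarrow> real" assume F: "continuous_on UNIV F" "\<And>x. 0 \<le> F x" "\<And>x. F x \<le> 1"
  obtain T where T: "\<And>n. T n > real n" "\<And>n. AE z in lborel. mollify (T n) \<mu> z = mollify (T n) \<nu> z"
    using ae by metis
  have pos: "T n > 0" for n using T(1)[of n] by (meson of_nat_0_le_iff order_le_less_trans)
  have top: "filterlim T at_top sequentially"
    by (rule filterlim_at_top_mono[OF filterlim_real_sequentially]) (use T(1) in \<open>auto simp: less_imp_le\<close>)
  have "(\<integral>\<^sup>+z. ennreal (F z) * mollify (T n) \<mu> z \<partial>lborel) = (\<integral>\<^sup>+z. ennreal (F z) * mollify (T n) \<nu> z \<partial>lborel)" for n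
    using T(2)[of n] by (intro nn_integral_cong_AE) (auto elim: eventually_mono)
  then have "(\<integral>\<^sup>+x. ennreal (F x) \<partial>\<mu>) * gauss_mass 2 = (\<integral>\<^sup>+x. ennreal (F x) \<partial>\<nu>) * gauss_mass 2"
    using mollify_tendsto[OF \<mu> F pos top] mollify_tendsto[OF \<nu> F pos top] LIMSEQ_unique by auto
  then show "(\<integral>\<^sup>+x. ennreal (F x) \<partial>\<mu>) = (\<integral>\<^sup>+x. ennreal (F x) \<partial>\<nu>)"
    using ennreal_cancel_left_eq[OF gauss_mass_pos[of 2] gauss_mass_finite[of 2]] by (simp add: mult.commute)
qed

text \<open>The isotropic kernel as a mixture of Gaussians, from the integral for the Gamma function.\<close>

definition riesz_mix :: "real \<Rightarrow> real^2 \<Rightarrow> ennreal" where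
  "riesz_mix s x = (\<integral>\<^sup>+t. ennreal (indicator {0<..} t * t powr (s / 2 - 1)) * gauss t x \<partial>lborel)"

lemma gauss_measurable_pair [measurable]: "(\<lambda>(t, x). gauss t x) \<in> borel_measurable (borel \<Otimes>\<^sub>M borel)"
  unfolding gauss_def by measurable

lemma riesz_mix_measurable [measurable]: "riesz_mix s \<in> borel_measurable borel"
  unfolding riesz_mix_def[abs_def] by measurable

text \<open>At the origin the mixture diverges: it is at least its value at every other point, and these values
  are unbounded.\<close>

lemma riesz_mix_eq:
  assumes s: "s > 0" shows "riesz_mix s x = ennreal (Gamma (s / 2)) * riesz s (\<lambda>_. 1) x"
proof -
  have G: "Gamma (s / 2) > 0" using s by (simp add: Gamma_real_pos)
  have nz: "riesz_mix s x = ennreal (Gamma (s / 2) * norm x powr (- s))" if x: "x \<noteq> 0" for x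
  proof -
    define c where "c = (norm x)^2"
    have c: "c > 0" using x by (simp add: c_def)
    let ?g = "\<lambda>t. ennreal (indicator {0..} t * t powr (s / 2 - 1) / exp t)"
    have "ennreal (Gamma (s / 2)) = (\<integral>\<^sup>+t. ?g t \<partial>lborel)" using Gamma_conv_nn_integral_real[of "s / 2"] s by simp
    also have "\<dots> = ennreal c * (\<integral>\<^sup>+t. ?g (0 + c * t) \<partial>lborel)"
      using c by (subst nn_integral_real_affine[where c=c and t=0]) auto
    also have "(\<integral>\<^sup>+t. ?g (0 + c * t) \<partial>lborel) = (\<integral>\<^sup>+t. ennreal (c powr (s / 2 - 1)) * (ennreal (indicator {0<..} t * t powr (s / 2 - 1)) * gauss t x) \<partial>lborel)"
    proof (rule nn_integral_cong)
      fix t :: real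
      show "?g (0 + c * t) = ennreal (c powr (s / 2 - 1)) * (ennreal (indicator {0<..} t * t powr (s / 2 - 1)) * gauss t x)"
      proof (cases "t > 0")
        case True
        then have "c * t > 0" using c by simp
        have "(c * t) powr (s / 2 - 1) / exp (c * t) = c powr (s / 2 - 1) * (t powr (s / 2 - 1) * exp (- t * c))"
        proof -
          have e1: "(c * t) powr a = c powr a * t powr a" for a using c True by (simp add: powr_mult)
          have e2: "exp (- t * c) = inverse (exp (c * t))" by (simp only: exp_minus[symmetric] mult_minus_left mult.commute[of t c])
          show ?thesis unfolding e1 e2 by (simp add: divide_inverse[of _ "exp (c * t)"])
        qed
        then show ?thesis using \<open>c * t > 0\<close> True unfolding gauss_def c_def[symmetric]
          by (simp add: ennreal_mult[symmetric])
      next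
        case False
        then have "t = 0 \<or> c * t < 0" using c by (auto simp: mult_less_0_iff)
        then show ?thesis using False by auto
      qed
    qed
    also have "\<dots> = ennreal (c powr (s / 2 - 1)) * riesz_mix s x" unfolding riesz_mix_def by (rule nn_integral_cmult) measurable
    also have "ennreal c * (ennreal (c powr (s / 2 - 1)) * riesz_mix s x) = ennreal (c powr (s / 2)) * riesz_mix s x"
      using c by (simp add: mult.assoc[symmetric] ennreal_mult[symmetric] powr_mult_base)
    finally have "ennreal (c powr (- (s / 2))) * ennreal (Gamma (s / 2)) = ennreal (c powr (- (s / 2))) * (ennreal (c powr (s / 2)) * riesz_mix s x)" by simp
    also have "\<dots> = riesz_mix s x"
      using c by (simp add: mult.assoc[symmetric] ennreal_mult[symmetric] powr_add[symmetric])
    finally have "riesz_mix s x = ennreal (c powr (- (s / 2)) * Gamma (s / 2))" using G by (simp add: ennreal_mult')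
    moreover have "c powr (- (s / 2)) = norm x powr (- s)"
      using square_powr_half[of "norm x" "- s"] x by (simp add: c_def)
    ultimately show ?thesis by (simp add: mult.commute)
  qed
  have z: "riesz_mix s 0 = \<infinity>"
  proof (rule ccontr)
    let ?e = "axis 1 1 :: real^2"
    assume fin: "riesz_mix s 0 \<noteq> \<infinity>"
    have le: "ennreal (Gamma (s / 2) * r powr (- s)) \<le> riesz_mix s 0" if r: "r > 0" for r :: real
    proof -
      have ne: "r *\<^sub>R ?e \<noteq> 0" using r by (simp add: axis_eq_0_iff)
      have "ennreal (Gamma (s / 2) * r powr (- s)) = riesz_mix s (r *\<^sub>R ?e)" unfolding nz[OF ne] using r by (simp add: norm_axis_1)
      also have "\<dots> \<le> riesz_mix s 0" unfolding riesz_mix_def gauss_def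
        by (intro nn_integral_mono) (auto simp: indicator_def ennreal_mult[symmetric] intro!: ennreal_leI mult_left_le)
      finally show ?thesis .
    qed
    obtain b where b: "riesz_mix s 0 = ennreal b" "b \<ge> 0" using fin by (cases "riesz_mix s 0") auto
    \<comment> \<open>chosen so that the mixture has the value \<open>b + 1\<close> at distance \<open>r\<close> from the origin\<close>
    define r where "r = ((b + 1) / Gamma (s / 2)) powr (- (1 / s))"
    have "r powr (- s) = (b + 1) / Gamma (s / 2)" using b G s by (simp add: r_def powr_powr)
    moreover have "r > 0" using b G by (simp add: r_def)
    ultimately have "ennreal (b + 1) \<le> ennreal b" using le[of r] b G by simp
    then show False using b by (simp add: ennreal_le_iff)
  qed
  show ?thesis using nz[of x] z G by (cases "x = 0") (auto simp: riesz_def ennreal_mult ennreal_mult_top ennreal_eq_0_iff)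
qed

lemma mutual_gauss_le_1:
  assumes "\<mu> \<in> prob_measures" "\<nu> \<in> prob_measures" "t > 0" shows "mutual (gauss t) \<mu> \<nu> \<le> 1"
proof -
  interpret mu: prob_space \<mu> using prob_measuresD assms by auto
  interpret nu: prob_space \<nu> using prob_measuresD assms by auto
  have "mutual (gauss t) \<mu> \<nu> \<le> (\<integral>\<^sup>+x. (\<integral>\<^sup>+y. 1 \<partial>\<nu>) \<partial>\<mu>)" unfolding mutual_def gauss_def using assms
    by (intro nn_integral_mono) simp
  then show ?thesis by (simp add: mu.emeasure_space_1 nu.emeasure_space_1)
qed

lemma mutual_riesz_mix:
  assumes "\<mu> \<in> prob_measures" "\<nu> \<in> prob_measures"
  shows "mutual (riesz_mix s) \<mu> \<nu> = (\<integral>\<^sup>+t. ennreal (indicator {0<..} t * t powr (s / 2 - 1)) * mutual (gauss t) \<mu> \<nu> \<partial>lborel)"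
  unfolding riesz_mix_def[abs_def]
  by (subst mutual_mixture(1)) (auto simp: assms mutual_cmult lborel.sigma_finite_measure_axioms)

lemma mutual_gauss_measurable [measurable]:
  assumes "\<mu> \<in> prob_measures" "\<nu> \<in> prob_measures"
  shows "(\<lambda>t. mutual (gauss t) \<mu> \<nu>) \<in> borel_measurable borel"
  using mutual_mixture(2)[OF _ lborel.sigma_finite_measure_axioms assms, of gauss] by simp

lemma pos_def_riesz_mix: "pos_def (riesz_mix s)"
  unfolding riesz_mix_def[abs_def]
proof (rule pos_def_mixture)
  fix t :: real
  show "pos_def (\<lambda>x. ennreal (indicator {0<..} t * t powr (s / 2 - 1)) * gauss t x)"
  proof (cases "t > 0")
    case True
    then show ?thesis by (intro pos_def_cmult pos_def_gauss) auto
  next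
    case False
    then show ?thesis by (simp add: pos_def_def mutual_def)
  qed
qed (auto simp: lborel.sigma_finite_measure_axioms)

text \<open>Equality for the mixture forces equality for almost every Gaussian parameter, in particular for
  arbitrarily large ones.\<close>

lemma riesz_mix_strict:
  assumes \<mu>: "\<mu> \<in> prob_measures" and \<nu>: "\<nu> \<in> prob_measures"
    and eq: "2 * mutual (riesz_mix s) \<mu> \<nu> = mutual (riesz_mix s) \<mu> \<mu> + mutual (riesz_mix s) \<nu> \<nu>"
    and fin: "mutual (riesz_mix s) \<mu> \<nu> < \<infinity>"
  shows "\<mu> = \<nu>"
proof (rule mollify_injective[OF \<mu> \<nu>])
  fix n :: nat
  let ?w = "\<lambda>t::real. ennreal (indicator {0<..} t * t powr (s / 2 - 1))"
  note [measurable] = mutual_gauss_measurable[OF \<mu> \<mu>] mutual_gauss_measurable[OF \<nu> \<nu>] mutual_gauss_measurable[OF \<mu> \<nu>]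
  have "AE t in lborel. ?w t * (mutual (gauss t) \<mu> \<mu> + mutual (gauss t) \<nu> \<nu>) = ?w t * (2 * mutual (gauss t) \<mu> \<nu>)"
  proof (rule nn_integral_eq_imp_AE_eq)
    show "AE t in lborel. ?w t * (2 * mutual (gauss t) \<mu> \<nu>) \<le> ?w t * (mutual (gauss t) \<mu> \<mu> + mutual (gauss t) \<nu> \<nu>)"
    proof (rule AE_I2)
      fix t :: real
      show "?w t * (2 * mutual (gauss t) \<mu> \<nu>) \<le> ?w t * (mutual (gauss t) \<mu> \<mu> + mutual (gauss t) \<nu> \<nu>)"
        using pos_defD[OF pos_def_gauss \<mu> \<nu>, of t] by (cases "t > 0") (auto intro: mult_left_mono)
    qed
    have 2: "(\<integral>\<^sup>+t. ?w t * (2 * mutual (gauss t) \<mu> \<nu>) \<partial>lborel) = 2 * mutual (riesz_mix s) \<mu> \<nu>"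
      by (simp add: mutual_riesz_mix \<mu> \<nu> mult.left_commute[of _ 2] nn_integral_cmult)
    show "(\<integral>\<^sup>+t. ?w t * (mutual (gauss t) \<mu> \<mu> + mutual (gauss t) \<nu> \<nu>) \<partial>lborel) = (\<integral>\<^sup>+t. ?w t * (2 * mutual (gauss t) \<mu> \<nu>) \<partial>lborel)"
      unfolding 2 eq by (simp add: mutual_riesz_mix \<mu> \<nu> distrib_left nn_integral_add)
    show "(\<integral>\<^sup>+t. ?w t * (2 * mutual (gauss t) \<mu> \<nu>) \<partial>lborel) < \<infinity>" unfolding 2 using fin by (simp add: ennreal_mult_less_top)
  qed measurable
  then have ae: "AE t in lborel. t > 0 \<longrightarrow> 2 * mutual (gauss t) \<mu> \<nu> = mutual (gauss t) \<mu> \<mu> + mutual (gauss t) \<nu> \<nu>"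
  proof eventually_elim
    case (elim t)
    show ?case
    proof
      assume t: "t > 0"
      then have "0 < ?w t" "?w t < \<infinity>" by (auto simp: indicator_def)
      from ennreal_cancel_left_eq[OF this elim, symmetric]
      show "2 * mutual (gauss t) \<mu> \<nu> = mutual (gauss t) \<mu> \<mu> + mutual (gauss t) \<nu> \<nu>" .
    qed
  qed
  have "\<exists>t>real n. 2 * mutual (gauss t) \<mu> \<nu> = mutual (gauss t) \<mu> \<mu> + mutual (gauss t) \<nu> \<nu>"
  proof (rule ccontr)
    assume "\<not> ?thesis"
    then have "AE t in lborel. t \<notin> {real n<..<real n + 1}" using ae
      by (auto elim!: eventually_mono)
    then have "emeasure lborel {real n<..<real n + 1} = 0" by (subst (asm) AE_iff_measurable[of "{real n<..<real n + 1}"]) auto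
    then show False by simp
  qed
  then obtain t where t: "t > real n" "2 * mutual (gauss t) \<mu> \<nu> = mutual (gauss t) \<mu> \<mu> + mutual (gauss t) \<nu> \<nu>" by blast
  have "t > 0" using t(1) by (meson of_nat_0_le_iff order_le_less_trans)
  moreover have "mutual (gauss t) \<mu> \<nu> < \<infinity>" using mutual_gauss_le_1[OF \<mu> \<nu> \<open>t > 0\<close>] by (rule order_le_less_trans) simp
  ultimately show "\<exists>t>real n. AE z in lborel. mollify t \<mu> z = mollify t \<nu> z"
    using mollify_eqI[OF \<mu> \<nu> _ t(2)] t(1) by blast
qed

section \<open>Anisotropic kernels as limits of stretched isotropic ones\<close>

text \<open>A rotation by \<open>- \<theta>\<close> followed by a dilation by \<open>l\<close> of the second coordinate. For large \<open>l\<close> the kernel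
  \<open>|stretch \<theta> l x| powr (- s)\<close> is concentrated near the line of angle \<open>\<theta>\<close>.\<close>

definition stretch :: "real \<Rightarrow> real \<Rightarrow> real^2 \<Rightarrow> real^2" where
  "stretch \<theta> l x = vector [x $ 1 * cos \<theta> + x $ 2 * sin \<theta>, l * (x $ 2 * cos \<theta> - x $ 1 * sin \<theta>)]"

lemma stretch_diff: "stretch \<theta> l (x - y) = stretch \<theta> l x - stretch \<theta> l y"
  by (simp add: stretch_def vec_eq_iff forall_2 algebra_simps)

lemma stretch_measurable [measurable]:
  assumes [measurable]: "g \<in> borel_measurable M" "h \<in> borel_measurable M"
  shows "(\<lambda>z. stretch (g z) l (h z)) \<in> borel_measurable M"
proof -
  have "(\<lambda>z. h z $ 1) \<in> borel_measurable M" "(\<lambda>z. h z $ 2) \<in> borel_measurable M"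
    using measurable_compose[OF assms(2) borel_measurable_vec_nth] by auto
  note [measurable] = this
  show ?thesis unfolding stretch_def by measurable
qed

text \<open>The angular profile of the stretched kernel, as a function of the angle measured from the line.\<close>

definition profile :: "real \<Rightarrow> real \<Rightarrow> real \<Rightarrow> real" where
  "profile s l \<theta> = ((cos \<theta>)^2 + l^2 * (sin \<theta>)^2) powr (- s / 2)"

lemma profile_base_pos:
  fixes l \<theta> :: real
  assumes l: "l > 0" shows "(cos \<theta>)^2 + l^2 * (sin \<theta>)^2 > 0"
proof -
  show ?thesis
  proof (cases "sin \<theta> = 0")
    case True
    then have "(cos \<theta>)^2 = 1" using sin_cos_squared_add[of \<theta>] by simp
    then show ?thesis using True by simp
  next
    case False
    then show ?thesis using l by (intro add_nonneg_pos) auto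
  qed
qed

lemma profile_periodic: "profile s l (t + pi) = profile s l t"
  by (simp add: profile_def)

lemma profile_nonneg: "profile s l t \<ge> 0"
  by (simp add: profile_def)

lemma profile_continuous:
  fixes h :: "real \<Rightarrow> real"
  assumes h: "continuous_on A h" and l: "l > 0"
  shows "continuous_on A (\<lambda>x. profile s l (h x))"
proof -
  have c: "continuous_on A (\<lambda>x. cos (h x))" "continuous_on A (\<lambda>x. sin (h x))"
    using h by (auto intro!: continuous_on_cos continuous_on_sin)
  show ?thesis unfolding profile_def
    by (intro continuous_intros c) (use profile_base_pos[OF l] in \<open>auto simp: less_imp_neq[symmetric]\<close>)
qed

lemma riesz_stretch:
  assumes x: "x \<noteq> 0" and l: "l > 0"
  shows "riesz s (\<lambda>_. 1) (stretch \<theta> l x) = ennreal (norm x powr (- s) * profile s l (\<theta> - polar_angle x))"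
proof -
  let ?\<phi> = "polar_angle x" and ?D = "(cos (\<theta> - polar_angle x))^2 + l^2 * (sin (\<theta> - polar_angle x))^2"
  have D: "?D > 0" using profile_base_pos[OF l] .
  have 1: "x $ 1 * cos \<theta> + x $ 2 * sin \<theta> = norm x * cos (\<theta> - ?\<phi>)"
    by (subst polar_angle_coords(1)[OF x], subst polar_angle_coords(2)[OF x]) (simp add: cos_diff algebra_simps)
  have 2: "x $ 2 * cos \<theta> - x $ 1 * sin \<theta> = - (norm x * sin (\<theta> - ?\<phi>))"
    by (subst polar_angle_coords(1)[OF x], subst polar_angle_coords(2)[OF x]) (simp add: sin_diff algebra_simps)
  have n2: "(norm (stretch \<theta> l x))^2 = (norm x)^2 * ?D"
  proof -
    have "stretch \<theta> l x $ 1 = norm x * cos (\<theta> - ?\<phi>)" "stretch \<theta> l x $ 2 = l * (- (norm x * sin (\<theta> - ?\<phi>)))"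
      unfolding stretch_def vector_2 1 2 by simp_all
    then show ?thesis unfolding norm_vec2[of "stretch \<theta> l x"] by (simp add: power_mult_distrib distrib_left)
  qed
  then have ne: "stretch \<theta> l x \<noteq> 0" using D x by auto
  note pw = square_powr_half[symmetric, of _ "- s"]
  have "norm (stretch \<theta> l x) powr (- s) = ((norm x)^2 * ?D) powr (- s / 2)"
    using pw[of "norm (stretch \<theta> l x)"] ne n2 by simp
  also have "\<dots> = norm x powr (- s) * profile s l (\<theta> - ?\<phi>)"
    using D x pw[of "norm x"] by (simp add: powr_mult profile_def)
  finally show ?thesis using ne by (simp add: riesz_def)
qed

text \<open>Pulling a kernel back along a linear map is the same as pushing the measures forward.\<close>

lemma pos_def_pullback:
  assumes K[measurable]: "K \<in> borel_measurable borel" and T[measurable]: "T \<in> borel_measurable borel"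
    and diff: "\<And>x y. T (x - y) = T x - T y" and pd: "pos_def K"
  shows "pos_def (\<lambda>x. K (T x))"
proof -
  have d: "distr \<mu> borel T \<in> prob_measures" if \<mu>: "\<mu> \<in> prob_measures" for \<mu>
  proof -
    interpret prob_space \<mu> using prob_measuresD \<mu> by auto
    have "T \<in> measurable \<mu> borel" unfolding measurable_prob_cong[OF \<mu>] by (rule T)
    then show ?thesis using prob_space_distr[of T borel] by (simp add: prob_measures_def)
  qed
  have e: "mutual (\<lambda>x. K (T x)) \<mu> \<nu> = mutual K (distr \<mu> borel T) (distr \<nu> borel T)"
    if \<mu>: "\<mu> \<in> prob_measures" and \<nu>: "\<nu> \<in> prob_measures" for \<mu> \<nu>
  proof -
    have [measurable_cong]: "sets \<nu> = sets borel" "sets \<mu> = sets borel" using prob_measuresD \<mu> \<nu> by auto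
    note [measurable] = measurable_inner_potential[OF K d[OF \<nu>]]
    have "mutual K (distr \<mu> borel T) (distr \<nu> borel T) = (\<integral>\<^sup>+x. (\<integral>\<^sup>+y. K (T x - y) \<partial>distr \<nu> borel T) \<partial>\<mu>)"
      unfolding mutual_def by (subst nn_integral_distr) measurable
    also have "\<dots> = mutual (\<lambda>x. K (T x)) \<mu> \<nu>"
      unfolding mutual_def diff by (intro nn_integral_cong, subst nn_integral_distr) measurable
    finally show ?thesis by simp
  qed
  show ?thesis unfolding pos_def_def using pos_defD[OF pd d d] e by simp
qed

lemma riesz_one_measurable [measurable]: "riesz s (\<lambda>_. 1) \<in> borel_measurable borel"
  by (rule borel_measurable_riesz) auto

lemma riesz_one_eq: "s > 0 \<Longrightarrow> riesz s (\<lambda>_. 1) = (\<lambda>x. ennreal (1 / Gamma (s / 2)) * riesz_mix s x)"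
proof
  fix x assume "s > 0"
  then have "Gamma (s / 2) > 0" by (simp add: Gamma_real_pos)
  then show "riesz s (\<lambda>_. 1) x = ennreal (1 / Gamma (s / 2)) * riesz_mix s x"
    using riesz_mix_eq[OF \<open>s > 0\<close>, of x] by (simp add: mult.assoc[symmetric] ennreal_mult[symmetric])
qed

lemma pos_def_riesz_one: "s > 0 \<Longrightarrow> pos_def (riesz s (\<lambda>_. 1))"
  unfolding riesz_one_eq by (intro pos_def_cmult pos_def_riesz_mix riesz_mix_measurable)

text \<open>Translating \<open>{0..a}\<close> by one period gives \<open>{pi..a + pi}\<close>; both intervals complete \<open>{0..pi}\<close> and
  \<open>{a..a + pi}\<close> to the same interval.\<close>

lemma integral_periodic:
  fixes h :: "real \<Rightarrow> real"
  assumes cont: "continuous_on UNIV h" and per: "\<And>t. h (t + pi) = h t"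
  shows "integral {a..a + pi} h = integral {0..pi} h"
proof -
  have i: "h integrable_on {c..d}" for c d using cont continuous_on_subset by (intro integrable_continuous_real) blast
  define H where "H x = integral {min 0 a..x} h" for x
  have shift: "integral {c + pi..d + pi} h = integral {c..d} h" for c d
    using integral_shift_Icc_real[of c d h pi] per by (simp add: o_def add.commute)
  show ?thesis
  proof (cases "a \<ge> 0")
    case True
    have "integral {0..a} h + integral {a..a + pi} h = integral {0..a + pi} h"
      using True i by (intro Henstock_Kurzweil_Integration.integral_combine) auto
    moreover have "integral {0..pi} h + integral {pi..a + pi} h = integral {0..a + pi} h"
      using True i by (intro Henstock_Kurzweil_Integration.integral_combine) auto
    ultimately show ?thesis using shift[of 0 a] by simp
  next
    case False
    have "integral {a..0} h + integral {0..pi} h = integral {a..pi} h"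
      using False i by (intro Henstock_Kurzweil_Integration.integral_combine) auto
    moreover have "integral {a..a + pi} h + integral {a + pi..pi} h = integral {a..pi} h"
      using False i by (intro Henstock_Kurzweil_Integration.integral_combine) auto
    ultimately show ?thesis using shift[of a 0] by simp
  qed
qed

lemma periodic_uniformly_continuous:
  fixes g :: "real \<Rightarrow> real"
  assumes cont: "continuous_on UNIV g" and per: "\<And>t. g (t + pi) = g t" and e: "e > 0"
  obtains d where "d > 0" "d < pi / 2" "\<And>x t. \<bar>t\<bar> < d \<Longrightarrow> \<bar>g (x + t) - g x\<bar> < e"
proof -
  have "uniformly_continuous_on {-pi..2 * pi} g"
    using cont continuous_on_subset by (intro compact_uniformly_continuous) auto
  then obtain d where d: "d > 0" "\<And>x y. x \<in> {-pi..2 * pi} \<Longrightarrow> y \<in> {-pi..2 * pi} \<Longrightarrow> dist y x < d \<Longrightarrow> dist (g y) (g x) < e"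
    using e unfolding uniformly_continuous_on_def by metis
  have "\<bar>g (x + t) - g x\<bar> < e" if t: "\<bar>t\<bar> < min d (pi / 3)" for x t
  proof -
    let ?n = "- \<lfloor>x / pi\<rfloor>"
    let ?x = "x + of_int ?n * pi"
    have x: "0 \<le> ?x" "?x \<le> pi" using floor_divide_lower[of pi x] floor_divide_upper[of pi x] by (auto simp: algebra_simps)
    have "dist (g (?x + t)) (g ?x) < e"
      using x t pi_gt_zero by (intro d(2)) (auto simp: dist_real_def)
    moreover have "g ?x = g x" "g (?x + t) = g (x + t)"
      using periodic_int[of g, OF per, of x ?n] periodic_int[of g, OF per, of "x + t" ?n] by (auto simp: algebra_simps)
    ultimately show ?thesis by (simp add: dist_real_def)
  qed
  moreover have "min d (pi / 3) < pi / 2" by (rule le_less_trans[OF min.cobounded2]) simp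
  ultimately show ?thesis using d(1) by (intro that[of "min d (pi / 3)"]) auto
qed

text \<open>The total mass of the profile exceeds its values away from zero, which are of order \<open>l powr (- s)\<close>, by a
  factor of order \<open>ln l\<close> at least. This is where \<open>1 \<le> s\<close> enters: the integral of \<open>t powr (- s)\<close> over \<open>{1 / l..1}\<close> has to
  diverge as \<open>l\<close> grows.\<close>

lemma profile_mass_lower:
  assumes s: "1 \<le> s" "s < 2" and l: "l > 1"
  shows "l powr (- s) * ln l / 2 \<le> integral {-(pi/2)..pi/2} (profile s l)"
proof -
  have i: "profile s l integrable_on {c..d}" for c d
    using l by (intro integrable_continuous_real profile_continuous continuous_intros) auto
  have l0: "l > 0" "1 / l \<le> 1" using l by auto
  have "((\<lambda>t. l powr (- s) / 2 * (1 / t)) has_integral (l powr (- s) / 2 * (ln 1 - ln (1 / l)))) {1 / l..1}"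
  proof (intro has_integral_mult_right fundamental_theorem_of_calculus)
    fix x assume "x \<in> {1 / l..1}"
    then have "x > 0" using l0 by (auto intro: less_le_trans[of 0 "1 / l"])
    then show "(ln has_vector_derivative 1 / x) (at x within {1 / l..1})"
      by (auto intro!: derivative_eq_intros simp: has_real_derivative_iff_has_vector_derivative[symmetric] divide_inverse)
  qed (use l0 in auto)
  then have "l powr (- s) * ln l / 2 = integral {1 / l..1} (\<lambda>t. l powr (- s) / 2 * (1 / t))"
    using l0 by (simp add: ln_div integral_unique)
  also have "\<dots> \<le> integral {1 / l..1} (profile s l)"
  proof (intro integral_le i)
    show "(\<lambda>t. l powr (- s) / 2 * (1 / t)) integrable_on {1 / l..1}"
      using l0 by (intro integrable_continuous_real continuous_intros) auto
    fix t assume t: "t \<in> {1 / l..1}"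
    have t0: "t > 0" "t \<le> 1" using t l0 by (auto intro: less_le_trans[of 0 "1 / l"])
    have lt: "1 \<le> l * t" using t l0 by (simp add: field_simps)
    have "1 \<le> (l * t)^2" using lt by (simp add: one_le_power)
    moreover have "(cos t)^2 \<le> 1" by (simp add: cos_squared_eq)
    moreover have "(sin t)^2 \<le> t^2" using abs_sin_x_le_abs_x[of t] by (simp add: abs_le_square_iff)
    then have "l^2 * (sin t)^2 \<le> l^2 * t^2" by (intro mult_left_mono) auto
    ultimately have le: "(cos t)^2 + l^2 * (sin t)^2 \<le> 2 * (l * t)^2" by (simp add: power_mult_distrib)
    have "l powr (- s) / 2 * (1 / t) = (1 / 2) * (l powr (- s) * t powr (- 1))" using t0 by (simp add: powr_minus_divide)
    also have "\<dots> \<le> 2 powr (- s / 2) * (l powr (- s) * t powr (- s))"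
    proof (intro mult_mono)
      have "2 powr (- 1 :: real) \<le> 2 powr (- s / 2)" using s by (intro powr_mono) auto
      then show "1 / 2 \<le> (2 :: real) powr (- s / 2)" by (simp add: powr_minus_divide)
      show "t powr (- 1) \<le> t powr (- s)" using t0 s by (intro powr_mono') auto
    qed auto
    also have "\<dots> = (2 * (l * t)^2) powr (- s / 2)"
      using square_powr_half[of "l * t" "- s"] l0 t0 by (simp add: powr_mult)
    also have "\<dots> \<le> profile s l t" unfolding profile_def
      using le profile_base_pos[OF l0(1), of t] s by (intro powr_mono2') auto
    finally show "l powr (- s) / 2 * (1 / t) \<le> profile s l t" .
  qed
  also have "\<dots> \<le> integral {-(pi/2)..pi/2} (profile s l)"
    using l0 pi_gt3 less_imp_le[OF l0(1)] by (intro integral_subset_le i) (auto simp: profile_nonneg intro: order_trans[of _ 0])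
  finally show ?thesis .
qed

text \<open>The normalised profiles form an approximate identity on the circle of lines. Near the origin uniform
  continuity of \<open>g\<close> is used; on the rest the profile is at most \<open>(l sin d) powr (- s)\<close>, negligible
  against the total mass by the preceding lower bound.\<close>

lemma profile_approximation:
  assumes s: "1 \<le> s" "s < 2" and cont: "continuous_on UNIV g" and per: "\<And>t. g (t + pi) = g t"
    and g: "\<And>t. 0 \<le> g t" "\<And>t. g t \<le> (B :: real)" and e: "e > 0"
  shows "\<exists>l>0. \<exists>Z>0. \<forall>\<phi>. \<bar>integral {0..pi} (\<lambda>\<theta>. g \<theta> * profile s l (\<theta> - \<phi>)) / Z - g \<phi>\<bar> \<le> e"
proof -
  have B: "B \<ge> 0" using g[of 0] by linarith
  obtain d where d: "d > 0" "d < pi / 2" "\<And>x t. \<bar>t\<bar> < d \<Longrightarrow> \<bar>g (x + t) - g x\<bar> < e / 2"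
    using periodic_uniformly_continuous[OF cont per, of "e / 2"] e by auto
  have sd: "sin d > 0" using d by (intro sin_gt_zero) auto
  define C where "C = B * pi * (sin d) powr (- s)"
  have C: "C \<ge> 0" using B by (simp add: C_def)
  \<comment> \<open>the tail contributes \<open>C * l powr (- s)\<close>, the mass at least \<open>l powr (- s) * ln l / 2\<close>\<close>
  define l where "l = exp (4 * C / e + 1)"
  have l: "l > 1" unfolding l_def using C e by (simp add: add_nonneg_pos)
  have l0: "l > 0" using l by simp
  define Z where "Z = integral {-(pi/2)..pi/2} (profile s l)"
  have ln: "ln l = 4 * C / e + 1" by (simp add: l_def)
  have Zlow: "l powr (- s) * ln l / 2 \<le> Z" unfolding Z_def by (rule profile_mass_lower[OF s l])
  have Z0: "Z > 0"
  proof -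
    have "l powr (- s) * ln l / 2 > 0" using l by simp
    then show ?thesis using Zlow by simp
  qed
  have tail: "C * l powr (- s) \<le> e / 2 * Z"
  proof -
    have "C \<le> e / 4 * ln l" unfolding ln using e C by (simp add: field_simps)
    then have "C * l powr (- s) \<le> e / 4 * ln l * l powr (- s)" by (intro mult_right_mono) auto
    also have "\<dots> = e / 2 * (l powr (- s) * ln l / 2)" by simp
    also have "\<dots> \<le> e / 2 * Z" using Zlow e by (intro mult_left_mono) auto
    finally show ?thesis .
  qed
  have i: "(\<lambda>t. h t * profile s l t) integrable_on {c..b}" if "continuous_on UNIV h" for h c b
    using l0 that by (intro integrable_continuous_real continuous_intros profile_continuous) (auto intro: continuous_on_subset)
  have main: "\<bar>integral {0..pi} (\<lambda>\<theta>. g \<theta> * profile s l (\<theta> - \<phi>)) / Z - g \<phi>\<bar> \<le> e" for \<phi>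
  proof -
    let ?I = "integral {0..pi} (\<lambda>\<theta>. g \<theta> * profile s l (\<theta> - \<phi>))" and ?J = "integral {-(pi/2)..pi/2} (\<lambda>t. g (\<phi> + t) * profile s l t)"
    have cg: "continuous_on UNIV (\<lambda>t. g (\<phi> + t))" using cont by (intro continuous_on_compose2[OF cont] continuous_intros) auto
    have "?I = integral {\<phi> - pi/2..\<phi> - pi/2 + pi} (\<lambda>\<theta>. g \<theta> * profile s l (\<theta> - \<phi>))"
    proof (rule integral_periodic[symmetric])
      show "continuous_on UNIV (\<lambda>\<theta>. g \<theta> * profile s l (\<theta> - \<phi>))"
        using l0 cont by (intro continuous_intros profile_continuous) auto
      show "g (t + pi) * profile s l (t + pi - \<phi>) = g t * profile s l (t - \<phi>)" for t
      proof -
        have "t + pi - \<phi> = (t - \<phi>) + pi" by simp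
        then show ?thesis by (simp only: per profile_periodic)
      qed
    qed
    also have "\<dots> = ?J"
      using integral_shift_Icc_real[of "-(pi/2)" "pi/2" "\<lambda>\<theta>. g \<theta> * profile s l (\<theta> - \<phi>)" \<phi>]
      by (simp add: o_def add.commute algebra_simps)
    finally have 1: "?I = ?J" .
    have "?J - g \<phi> * Z = integral {-(pi/2)..pi/2} (\<lambda>t. (g (\<phi> + t) - g \<phi>) * profile s l t)"
      unfolding Z_def using i[OF cg] i[of "\<lambda>_. g \<phi>"]
      by (simp add: left_diff_distrib Henstock_Kurzweil_Integration.integral_diff)
    also have "\<bar>\<dots>\<bar> \<le> integral {-(pi/2)..pi/2} (\<lambda>t. e / 2 * profile s l t + B * (l * sin d) powr (- s))"
    proof (rule Henstock_Kurzweil_Integration.integral_norm_bound_integral[where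
          f="\<lambda>t. (g (\<phi> + t) - g \<phi>) * profile s l t", unfolded real_norm_def])
      show "(\<lambda>t. (g (\<phi> + t) - g \<phi>) * profile s l t) integrable_on {-(pi/2)..pi/2}"
        by (intro i continuous_intros cg)
      show "(\<lambda>t. e / 2 * profile s l t + B * (l * sin d) powr (- s)) integrable_on {-(pi/2)..pi/2}"
        by (intro integrable_add i continuous_intros integrable_const_ivl)
      fix t assume t: "t \<in> {-(pi/2)..pi/2}"
      show "\<bar>(g (\<phi> + t) - g \<phi>) * profile s l t\<bar> \<le> e / 2 * profile s l t + B * (l * sin d) powr (- s)"
      proof (cases "\<bar>t\<bar> < d")
        case True
        then have "\<bar>g (\<phi> + t) - g \<phi>\<bar> * profile s l t \<le> e / 2 * profile s l t"
          using d(3)[of t \<phi>] by (intro mult_right_mono profile_nonneg) auto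
        moreover have "B * (l * sin d) powr (- s) \<ge> 0" using B by simp
        ultimately show ?thesis using profile_nonneg[of s l t] by (simp add: abs_mult)
      next
        case False
        have "sin d \<le> sin \<bar>t\<bar>" using False t d by (intro sin_monotone_2pi_le) auto
        also have "\<dots> = \<bar>sin t\<bar>"
        proof -
          have "\<bar>t\<bar> \<le> pi" using t pi_gt_zero by auto
          then have "0 \<le> sin \<bar>t\<bar>" by (intro sin_ge_zero) auto
          then show ?thesis by (cases "t \<ge> 0") auto
        qed
        finally have "(sin d)^2 \<le> (sin t)^2" using sd by (simp add: abs_le_square_iff[symmetric])
        then have "l^2 * (sin d)^2 \<le> l^2 * (sin t)^2" by (intro mult_left_mono) auto
        then have le: "(l * sin d)^2 \<le> (cos t)^2 + l^2 * (sin t)^2"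
          by (simp add: power_mult_distrib add_increasing)
        have ls: "l * sin d > 0" using l0 sd by simp
        have "profile s l t \<le> ((l * sin d)^2) powr (- s / 2)" unfolding profile_def
          using le ls s by (intro powr_mono2') auto
        also have "\<dots> = (l * sin d) powr (- s)" by (rule square_powr_half[OF ls])
        finally have p: "profile s l t \<le> (l * sin d) powr (- s)" .
        have "\<bar>g (\<phi> + t) - g \<phi>\<bar> \<le> B" using g(1)[of "\<phi> + t"] g(1)[of \<phi>] g(2)[of "\<phi> + t"] g(2)[of \<phi>] by auto
        then have "\<bar>g (\<phi> + t) - g \<phi>\<bar> * profile s l t \<le> B * (l * sin d) powr (- s)"
          using p profile_nonneg[of s l t] B by (intro mult_mono) auto
        moreover have "0 \<le> e / 2 * profile s l t" using e profile_nonneg[of s l t] by simp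
        ultimately show ?thesis using profile_nonneg[of s l t] by (simp add: abs_mult)
      qed
    qed
    also have "\<dots> = e / 2 * Z + C * l powr (- s)"
    proof -
      have "integral {-(pi/2)..pi/2} (\<lambda>t. e / 2 * profile s l t + B * (l * sin d) powr (- s))
        = integral {-(pi/2)..pi/2} (\<lambda>t. e / 2 * profile s l t) + integral {-(pi/2)..pi/2} (\<lambda>t. B * (l * sin d) powr (- s))"
        by (intro Henstock_Kurzweil_Integration.integral_add i continuous_intros integrable_const_ivl)
      also have "\<dots> = e / 2 * Z + pi * (B * (l * sin d) powr (- s))" by (simp add: Z_def)
      also have "\<dots> = e / 2 * Z + C * l powr (- s)" using l0 sd by (simp add: powr_mult C_def)
      finally show ?thesis .
    qed
    also have "\<dots> \<le> e * Z" using tail by simp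
    finally have "\<bar>?J - g \<phi> * Z\<bar> \<le> e * Z" .
    moreover have "?I / Z - g \<phi> = (?J - g \<phi> * Z) / Z"
      unfolding 1 using Z0 by (simp add: diff_divide_distrib)
    ultimately show ?thesis using Z0 by (simp add: abs_divide pos_divide_le_eq)
  qed
  show ?thesis using l0 Z0 main by blast
qed

text \<open>Accordingly the anisotropic kernel is approximated by mixtures of stretched isotropic kernels. The
  error is uniform relative to the isotropic kernel, so it is controlled by the isotropic energy.\<close>

lemma riesz_approximation:
  assumes s: "1 \<le> s" "s < 2" and cont: "continuous_on UNIV g" and per: "\<And>t. g (t + pi) = g t"
    and g: "\<And>t. 0 \<le> g t" "\<And>t. g t \<le> (B :: real)" and e: "e > 0"
  shows "\<exists>K. K \<in> borel_measurable borel \<and> pos_def K \<and>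
    (\<forall>x. riesz s g x \<le> K x + ennreal e * riesz s (\<lambda>_. 1) x) \<and> (\<forall>x. K x \<le> riesz s g x + ennreal e * riesz s (\<lambda>_. 1) x)"
proof -
  obtain l Z where l: "l > 0" and Z: "Z > 0" and app: "\<And>\<phi>. \<bar>integral {0..pi} (\<lambda>\<theta>. g \<theta> * profile s l (\<theta> - \<phi>)) / Z - g \<phi>\<bar> \<le> e"
    using profile_approximation[of s g B e, OF s cont per g e] by blast
  have [measurable]: "g \<in> borel_measurable borel" using cont by (rule borel_measurable_continuous_onI)
  define k where "k \<theta> x = ennreal (indicator {0..pi} \<theta> * g \<theta> / Z) * riesz s (\<lambda>_. 1) (stretch \<theta> l x)" for \<theta> x
  define K where "K x = (\<integral>\<^sup>+\<theta>. k \<theta> x \<partial>lborel)" for x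
  have km[measurable]: "(\<lambda>(\<theta>, x). k \<theta> x) \<in> borel_measurable (lborel \<Otimes>\<^sub>M borel)" unfolding k_def by measurable
  have Km: "K \<in> borel_measurable borel" unfolding K_def[abs_def] by measurable
  have pd: "pos_def K" unfolding K_def[abs_def]
  proof (rule pos_def_mixture[OF km lborel.sigma_finite_measure_axioms])
    fix \<theta> :: real
    have "s > 0" using s by simp
    have pb: "pos_def (\<lambda>x. riesz s (\<lambda>_. 1) (stretch \<theta> l x))"
      by (rule pos_def_pullback[OF riesz_one_measurable _ stretch_diff pos_def_riesz_one[OF \<open>s > 0\<close>]]) measurable
    show "pos_def (k \<theta>)" unfolding k_def[abs_def] by (rule pos_def_cmult[OF _ pb]) measurable
  qed
  have Kx: "K x = ennreal (norm x powr (- s) * (integral {0..pi} (\<lambda>\<theta>. g \<theta> * profile s l (\<theta> - polar_angle x)) / Z))" if x: "x \<noteq> 0" for x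
  proof -
    let ?I = "integral {0..pi} (\<lambda>\<theta>. g \<theta> * profile s l (\<theta> - polar_angle x))"
    have "(\<lambda>\<theta>. g \<theta> * profile s l (\<theta> - polar_angle x)) integrable_on {0..pi}"
      using l cont by (intro integrable_continuous_real continuous_intros profile_continuous) (auto intro: continuous_on_subset)
    then have "((\<lambda>\<theta>. norm x powr (- s) / Z * (g \<theta> * profile s l (\<theta> - polar_angle x))) has_integral (norm x powr (- s) / Z * ?I)) {0..pi}"
      by (intro has_integral_mult_right integrable_integral)
    then have "(\<integral>\<^sup>+\<theta>. ennreal (indicator {0..pi} \<theta> * (norm x powr (- s) / Z * (g \<theta> * profile s l (\<theta> - polar_angle x)))) \<partial>lborel) = ennreal (norm x powr (- s) / Z * ?I)"
      by (rule nn_integral_has_integral_lebesgue[rotated])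
        (intro mult_nonneg_nonneg divide_nonneg_nonneg profile_nonneg g(1) less_imp_le[OF Z] powr_ge_zero)
    moreover have "K x = (\<integral>\<^sup>+\<theta>. ennreal (indicator {0..pi} \<theta> * (norm x powr (- s) / Z * (g \<theta> * profile s l (\<theta> - polar_angle x)))) \<partial>lborel)"
      unfolding K_def k_def riesz_stretch[OF x l]
    proof (intro nn_integral_cong)
      fix \<theta> :: real
      have "0 \<le> norm x powr (- s) * profile s l (\<theta> - polar_angle x)" by (intro mult_nonneg_nonneg profile_nonneg powr_ge_zero)
      then show "ennreal (indicator {0..pi} \<theta> * g \<theta> / Z) * ennreal (norm x powr (- s) * profile s l (\<theta> - polar_angle x)) =
          ennreal (indicator {0..pi} \<theta> * (norm x powr (- s) / Z * (g \<theta> * profile s l (\<theta> - polar_angle x))))"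
        by (simp add: ennreal_mult''[symmetric] mult.commute mult.left_commute)
    qed
    ultimately show ?thesis by simp
  qed
  have "riesz s g x \<le> K x + ennreal e * riesz s (\<lambda>_. 1) x \<and> K x \<le> riesz s g x + ennreal e * riesz s (\<lambda>_. 1) x" for x
  proof (cases "x = 0")
    case True
    then show ?thesis using e by (simp add: riesz_def ennreal_mult_top)
  next
    case False
    let ?J = "integral {0..pi} (\<lambda>\<theta>. g \<theta> * profile s l (\<theta> - polar_angle x)) / Z"
    have J: "0 \<le> ?J"
      using g Z by (intro divide_nonneg_pos Henstock_Kurzweil_Integration.integral_nonneg)
        (auto intro!: mult_nonneg_nonneg profile_nonneg integrable_continuous_real continuous_intros profile_continuous l continuous_on_subset[OF cont])
    have b: "g (polar_angle x) \<le> ?J + e" "?J \<le> g (polar_angle x) + e" using app[of "polar_angle x"] by (auto simp: abs_le_iff)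
    have n: "norm x powr (- s) \<ge> 0" by simp
    have comb: "ennreal (n * a) \<le> ennreal (n * b) + ennreal e * ennreal (n * 1)"
      if "a \<le> b + e" "0 \<le> b" "0 \<le> n" for n a b :: real
    proof -
      have "n * a \<le> n * b + e * n" using mult_left_mono[OF that(1,3)] by (simp add: distrib_left mult.commute)
      then have "ennreal (n * a) \<le> ennreal (n * b + e * n)" by (rule ennreal_leI)
      also have "\<dots> = ennreal (n * b) + ennreal (e * n)" using that e by (intro ennreal_plus) auto
      also have "ennreal (e * n) = ennreal e * ennreal (n * 1)" using that e by (simp add: ennreal_mult)
      finally show ?thesis .
    qed
    have r: "riesz s h x = ennreal (norm x powr (- s) * h (polar_angle x))" for h using False by (simp add: riesz_def)
    show ?thesis unfolding Kx[OF False] r using comb[OF b(1) J n] comb[OF b(2) g(1) n] by blast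
  qed
  then show ?thesis using Km pd by blast
qed

text \<open>Positive definiteness passes to the limit as soon as the isotropic energies are finite.\<close>

lemma pos_def_riesz_finite:
  assumes s: "1 \<le> s" "s < 2" and cont: "continuous_on UNIV g" and per: "\<And>t. g (t + pi) = g t"
    and g: "\<And>t. 0 \<le> g t" "\<And>t. g t \<le> (B :: real)"
    and \<mu>: "\<mu> \<in> prob_measures" and \<nu>: "\<nu> \<in> prob_measures"
    and fin: "mutual (riesz s (\<lambda>_. 1)) \<mu> \<mu> < \<infinity>" "mutual (riesz s (\<lambda>_. 1)) \<nu> \<nu> < \<infinity>"
  shows "2 * mutual (riesz s g) \<mu> \<nu> \<le> mutual (riesz s g) \<mu> \<mu> + mutual (riesz s g) \<nu> \<nu>"
proof -
  let ?R = "riesz s (\<lambda>_. 1)"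
  let ?G = "mutual (riesz s g)" and ?H = "mutual ?R"
  have s0: "s > 0" using s by simp
  have [measurable]: "g \<in> borel_measurable borel" using cont by (rule borel_measurable_continuous_onI)
  have gm[measurable]: "riesz s g \<in> borel_measurable borel" by (rule borel_measurable_riesz[of g, OF per]) measurable
  obtain c where c: "?H \<mu> \<mu> + ?H \<nu> \<nu> = ennreal c" "c \<ge> 0"
    using fin by (cases "?H \<mu> \<mu> + ?H \<nu> \<nu>") auto
  have cross: "2 * ?H \<mu> \<nu> \<le> ennreal c" using pos_defD[OF pos_def_riesz_one[OF s0] \<mu> \<nu>] c by simp
  show ?thesis
  proof (rule ennreal_le_epsilon)
    fix \<epsilon> :: real assume \<epsilon>: "0 < \<epsilon>"
    \<comment> \<open>the approximation error enters with the factor \<open>2 * c\<close>\<close>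
    define e where "e = \<epsilon> / (2 * c + 1)"
    have e: "e > 0" using \<epsilon> c by (simp add: e_def)
    obtain K where Km[measurable]: "K \<in> borel_measurable borel" and pd: "pos_def K"
      and up: "\<And>x. riesz s g x \<le> K x + ennreal e * ?R x" and lo: "\<And>x. K x \<le> riesz s g x + ennreal e * ?R x"
      using riesz_approximation[of s g B e, OF s cont per g e] by blast
    have u: "?G \<mu>' \<nu>' \<le> mutual K \<mu>' \<nu>' + ennreal e * ?H \<mu>' \<nu>'"
      and w: "mutual K \<mu>' \<nu>' \<le> ?G \<mu>' \<nu>' + ennreal e * ?H \<mu>' \<nu>'"
      if "\<mu>' \<in> prob_measures" "\<nu>' \<in> prob_measures" for \<mu>' \<nu>'
    proof -
      have m: "(\<lambda>x. ennreal e * ?R x) \<in> borel_measurable borel" by measurable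
      show "?G \<mu>' \<nu>' \<le> mutual K \<mu>' \<nu>' + ennreal e * ?H \<mu>' \<nu>'"
        using mutual_mono[of "riesz s g" "\<lambda>x. K x + ennreal e * ?R x" \<mu>' \<nu>', OF up] mutual_add[OF Km m that] mutual_cmult[OF riesz_one_measurable that]
        by simp
      show "mutual K \<mu>' \<nu>' \<le> ?G \<mu>' \<nu>' + ennreal e * ?H \<mu>' \<nu>'"
        using mutual_mono[of K "\<lambda>x. riesz s g x + ennreal e * ?R x" \<mu>' \<nu>', OF lo] mutual_add[OF gm m that] mutual_cmult[OF riesz_one_measurable that]
        by simp
    qed
    have "2 * ?G \<mu> \<nu> \<le> 2 * (mutual K \<mu> \<nu> + ennreal e * ?H \<mu> \<nu>)"
      by (intro mult_left_mono u \<mu> \<nu>) auto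
    also have "\<dots> = 2 * mutual K \<mu> \<nu> + ennreal e * (2 * ?H \<mu> \<nu>)"
      by (simp add: distrib_left mult.left_commute)
    also have "\<dots> \<le> (mutual K \<mu> \<mu> + mutual K \<nu> \<nu>) + ennreal e * ennreal c"
      by (intro add_mono mult_left_mono cross pos_defD[OF pd \<mu> \<nu>]) auto
    also have "\<dots> \<le> ((?G \<mu> \<mu> + ennreal e * ?H \<mu> \<mu>) + (?G \<nu> \<nu> + ennreal e * ?H \<nu> \<nu>)) + ennreal e * ennreal c"
      by (intro add_mono w \<mu> \<nu>) auto
    also have "\<dots> = (?G \<mu> \<mu> + ?G \<nu> \<nu>) + (ennreal e * ennreal c + ennreal e * ennreal c)"
      unfolding c(1)[symmetric] by (simp add: distrib_left algebra_simps)
    also have "ennreal e * ennreal c + ennreal e * ennreal c = ennreal (2 * (e * c))"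
      using e c by (simp add: ennreal_mult[symmetric] ennreal_plus[symmetric] del: ennreal_plus)
    also have "\<dots> \<le> ennreal \<epsilon>"
    proof (rule ennreal_leI)
      have "2 * (e * c) \<le> e * (2 * c + 1)" using e by (simp add: algebra_simps)
      also have "\<dots> = \<epsilon>" using c by (simp add: e_def)
      finally show "2 * (e * c) \<le> \<epsilon>" .
    qed
    finally show "2 * ?G \<mu> \<nu> \<le> ?G \<mu> \<mu> + ?G \<nu> \<nu> + ennreal \<epsilon>"
      by (auto simp: add_left_mono)
  qed
qed

text \<open>Splitting off a small positive constant from \<open>f\<close> leaves a nonnegative profile, to which the
  preceding lemma applies, while the constant contributes a strictly positive definite isotropic kernel.\<close>

lemma riesz_strictly_pos_def:
  assumes s: "1 \<le> s" "s < 2" and cont: "continuous_on UNIV f" and per: "\<And>t. f (t + pi) = f t" and pos: "\<And>t. (f t :: real) > 0"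
    and \<mu>: "\<mu> \<in> prob_measures" and \<nu>: "\<nu> \<in> prob_measures"
    and fin: "mutual (riesz s f) \<mu> \<mu> < \<infinity>" "mutual (riesz s f) \<nu> \<nu> < \<infinity>"
  shows "2 * mutual (riesz s f) \<mu> \<nu> \<le> mutual (riesz s f) \<mu> \<mu> + mutual (riesz s f) \<nu> \<nu>"
    and "2 * mutual (riesz s f) \<mu> \<nu> = mutual (riesz s f) \<mu> \<mu> + mutual (riesz s f) \<nu> \<nu> \<Longrightarrow> \<mu> = \<nu>"
proof -
  let ?R = "riesz s (\<lambda>_. 1)"
  let ?F = "mutual (riesz s f)" and ?H = "mutual ?R" and ?M = "mutual (riesz_mix s)"
  have s0: "s > 0" using s by simp
  obtain \<delta> B where \<delta>: "\<delta> > 0" "\<And>t. \<delta> \<le> f t" and B: "\<And>t. f t \<le> B" using periodic_bounds[OF per cont pos] by metis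
  define g where "g t = f t - \<delta>" for t
  let ?G = "mutual (riesz s g)"
  have gc: "continuous_on UNIV g" unfolding g_def using cont by (intro continuous_intros)
  have gp: "g (t + pi) = g t" for t using per by (simp add: g_def)
  have g0: "0 \<le> g t" "g t \<le> B" for t using \<delta> B[of t] less_imp_le[OF \<delta>(1)] by (auto simp: g_def intro: order_trans[of _ "f t"])
  have [measurable]: "g \<in> borel_measurable borel" using gc by (rule borel_measurable_continuous_onI)
  have gm: "riesz s g \<in> borel_measurable borel" by (rule borel_measurable_riesz[of g, OF gp]) measurable
  have split: "riesz s f = (\<lambda>x. riesz s g x + ennreal \<delta> * ?R x)"
  proof
    fix x show "riesz s f x = riesz s g x + ennreal \<delta> * ?R x"
      using g0(1) \<delta>(1) by (auto simp: riesz_def g_def ennreal_mult[symmetric] ennreal_plus[symmetric] algebra_simps simp del: ennreal_plus)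
  qed
  have m: "(\<lambda>x. ennreal \<delta> * ?R x) \<in> borel_measurable borel" by measurable
  have e: "?F \<mu>' \<nu>' = ?G \<mu>' \<nu>' + ennreal \<delta> * ?H \<mu>' \<nu>'"
    if "\<mu>' \<in> prob_measures" "\<nu>' \<in> prob_measures" for \<mu>' \<nu>'
    unfolding split by (simp add: mutual_add[OF gm m that] mutual_cmult[OF riesz_one_measurable that])
  have finR: "?H \<mu> \<mu> < \<infinity>" "?H \<nu> \<nu> < \<infinity>"
    using fin \<delta>(1) unfolding e[OF \<mu> \<mu>] e[OF \<nu> \<nu>] by (auto simp: ennreal_mult_less_top ennreal_eq_0_iff not_le)
  have A: "2 * ?G \<mu> \<nu> \<le> ?G \<mu> \<mu> + ?G \<nu> \<nu>"
    by (rule pos_def_riesz_finite[OF s gc gp g0 \<mu> \<nu> finR])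
  have C: "2 * ?H \<mu> \<nu> \<le> ?H \<mu> \<mu> + ?H \<nu> \<nu>"
    by (rule pos_defD[OF pos_def_riesz_one[OF s0] \<mu> \<nu>])
  have l: "2 * ?F \<mu> \<nu> = 2 * ?G \<mu> \<nu> + ennreal \<delta> * (2 * ?H \<mu> \<nu>)"
    unfolding e[OF \<mu> \<nu>] by (simp add: distrib_left mult.left_commute)
  have r: "?F \<mu> \<mu> + ?F \<nu> \<nu> = (?G \<mu> \<mu> + ?G \<nu> \<nu>) + ennreal \<delta> * (?H \<mu> \<mu> + ?H \<nu> \<nu>)"
    unfolding e[OF \<mu> \<mu>] e[OF \<nu> \<nu>] by (simp add: distrib_left ac_simps)
  show "2 * ?F \<mu> \<nu> \<le> ?F \<mu> \<mu> + ?F \<nu> \<nu>"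
    unfolding l r by (intro add_mono mult_left_mono A C) auto
  assume eq: "2 * ?F \<mu> \<nu> = ?F \<mu> \<mu> + ?F \<nu> \<nu>"
  have gfin: "?G \<mu> \<mu> + ?G \<nu> \<nu> < \<infinity>"
    using fin unfolding e[OF \<mu> \<mu>] e[OF \<nu> \<nu>] by auto
  have "2 * ?H \<mu> \<nu> = ?H \<mu> \<mu> + ?H \<nu> \<nu>"
  proof -
    have "(?G \<mu> \<mu> + ?G \<nu> \<nu>) + ennreal \<delta> * (?H \<mu> \<mu> + ?H \<nu> \<nu>)
      \<le> (?G \<mu> \<mu> + ?G \<nu> \<nu>) + ennreal \<delta> * (2 * ?H \<mu> \<nu>)"
      unfolding r[symmetric] eq[symmetric] l by (intro add_right_mono A)
    then have "ennreal \<delta> * (?H \<mu> \<mu> + ?H \<nu> \<nu>) \<le> ennreal \<delta> * (2 * ?H \<mu> \<nu>)"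
      using gfin by (subst (asm) ennreal_add_left_cancel_le) auto
    then have "?H \<mu> \<mu> + ?H \<nu> \<nu> \<le> 2 * ?H \<mu> \<nu>"
      using \<delta>(1) by (subst (asm) ennreal_cancel_left) auto
    then show ?thesis using C by (intro antisym)
  qed
  moreover have G: "0 < ennreal (Gamma (s / 2))" using s0 by (simp add: Gamma_real_pos)
  moreover have mix: "?M \<mu>' \<nu>' = ennreal (Gamma (s / 2)) * ?H \<mu>' \<nu>'"
    if "\<mu>' \<in> prob_measures" "\<nu>' \<in> prob_measures" for \<mu>' \<nu>'
  proof -
    have "riesz_mix s = (\<lambda>x. ennreal (Gamma (s / 2)) * ?R x)" by (rule ext) (rule riesz_mix_eq[OF s0])
    then show ?thesis using mutual_cmult[OF riesz_one_measurable that] by simp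
  qed
  ultimately have q: "2 * ?M \<mu> \<nu> = ?M \<mu> \<mu> + ?M \<nu> \<nu>"
    unfolding mix[OF \<mu> \<nu>] mix[OF \<mu> \<mu>] mix[OF \<nu> \<nu>] by (simp add: mult.left_commute[of 2] distrib_left[symmetric])
  have "2 * ?M \<mu> \<nu> < \<infinity>"
    unfolding q mix[OF \<mu> \<mu>] mix[OF \<nu> \<nu>] using finR by (simp add: ennreal_mult_less_top)
  then have "?M \<mu> \<nu> < \<infinity>"
    by (cases "?M \<mu> \<nu> = 0") (auto simp: ennreal_mult_less_top)
  then show "\<mu> = \<nu>" by (rule riesz_mix_strict[OF \<mu> \<nu> q])
qed

section \<open>Energy comparison with an equilibrium measure\<close>

definition sq :: "real^2 \<Rightarrow> ennreal" where
  "sq x = ennreal ((norm x)^2)"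

lemma sq_measurable [measurable]: "sq \<in> borel_measurable borel"
  unfolding sq_def[abs_def] by measurable

definition moment2 :: "(real^2) measure \<Rightarrow> ennreal" where
  "moment2 \<mu> = (\<integral>\<^sup>+x. sq x \<partial>\<mu>)"

lemma potential_eq: "(\<And>t. \<Omega> t > 0) \<Longrightarrow> potential s \<Omega> = (\<lambda>x. riesz s \<Omega> x + sq x)"
  by (rule ext) (simp add: potential_def riesz_def sq_def less_imp_le)

lemma norm_le_one_plus_square: "norm y \<le> 1 + (norm y)^2"
proof -
  have "r \<le> 1 + r^2" if "0 \<le> r" for r :: real
  proof -
    have "0 \<le> r^2 - 2 * r + 1" using zero_le_power2[of "r - 1"] by (simp add: power2_diff)
    then show ?thesis using that by linarith
  qed
  then show ?thesis by simp
qed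

text \<open>For a centred measure the mixed term in \<open>|x - y|^2\<close> integrates to zero.\<close>

lemma sq_potential_centered:
  assumes \<mu>: "\<mu> \<in> prob_measures" and fin: "moment2 \<mu> < \<infinity>" and mean: "(LINT y|\<mu>. y) = 0"
  shows "(\<integral>\<^sup>+y. sq (x - y) \<partial>\<mu>) = sq x + moment2 \<mu>"
proof -
  interpret prob_space \<mu> using prob_measuresD \<mu> by auto
  have [measurable_cong]: "sets \<mu> = sets borel" using prob_measuresD \<mu> by auto
  have i2: "integrable \<mu> (\<lambda>y. (norm y)^2)"
    using fin by (intro integrableI_nonneg) (auto simp: moment2_def sq_def)
  have i1: "integrable \<mu> (\<lambda>y. y)"
  proof (rule Bochner_Integration.integrable_bound)
    show "integrable \<mu> (\<lambda>y. 1 + (norm y)^2)" using i2 by simp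
    show "AE y in \<mu>. norm y \<le> norm (1 + (norm y)^2)" by (simp add: norm_le_one_plus_square add_nonneg_nonneg)
  qed measurable
  have e: "(norm (x - y))^2 = (norm x)^2 - 2 * (x \<bullet> y) + (norm y)^2" for y
    by (simp add: power2_norm_eq_inner inner_diff_left inner_diff_right inner_commute)
  have ix: "integrable \<mu> (\<lambda>y. (norm (x - y))^2)" unfolding e using i1 i2 by simp
  have "(\<integral>\<^sup>+y. sq (x - y) \<partial>\<mu>) = ennreal (LINT y|\<mu>. (norm (x - y))^2)"
    unfolding sq_def using ix by (intro nn_integral_eq_integral) auto
  also have "(LINT y|\<mu>. (norm (x - y))^2) = (norm x)^2 + (LINT y|\<mu>. (norm y)^2)"
    unfolding e using i1 i2 mean by (simp add: prob_space)
  also have "ennreal \<dots> = sq x + ennreal (LINT y|\<mu>. (norm y)^2)"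
    unfolding sq_def by (intro ennreal_plus) auto
  also have "ennreal (LINT y|\<mu>. (norm y)^2) = moment2 \<mu>"
    unfolding moment2_def sq_def using i2 by (intro nn_integral_eq_integral[symmetric]) auto
  finally show ?thesis .
qed

lemma mutual_sq:
  assumes \<nu>: "\<nu> \<in> prob_measures" and pot: "\<And>x. (\<integral>\<^sup>+y. sq (x - y) \<partial>\<mu>) = sq x + moment2 \<mu>"
  shows "mutual sq \<nu> \<mu> = moment2 \<nu> + moment2 \<mu>"
proof -
  interpret prob_space \<nu> using prob_measuresD \<nu> by auto
  have [measurable_cong]: "sets \<nu> = sets borel" using prob_measuresD \<nu> by auto
  show ?thesis unfolding mutual_def pot by (simp add: nn_integral_add moment2_def emeasure_space_1)
qed

lemma translate_prob:
  assumes \<nu>: "\<nu> \<in> prob_measures" shows "translate c \<nu> \<in> prob_measures"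
proof -
  interpret prob_space \<nu> using prob_measuresD \<nu> by auto
  have "(\<lambda>x. x + c) \<in> measurable \<nu> borel" unfolding measurable_prob_cong[OF \<nu>] by measurable
  then show ?thesis using prob_space_distr by (simp add: prob_measures_def translate_def)
qed

lemma mutual_translate:
  assumes K: "K \<in> borel_measurable borel" and \<nu>: "\<nu> \<in> prob_measures"
  shows "mutual K (translate c \<nu>) (translate c \<nu>) = mutual K \<nu> \<nu>"
proof -
  have [measurable_cong]: "sets \<nu> = sets borel" using prob_measuresD \<nu> by auto
  note [measurable] = K measurable_inner_potential[OF K translate_prob[OF \<nu>]]
  have "mutual K (translate c \<nu>) (translate c \<nu>) = (\<integral>\<^sup>+x. (\<integral>\<^sup>+y. K (x + c - y) \<partial>translate c \<nu>) \<partial>\<nu>)"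
    unfolding mutual_def translate_def[of c \<nu>]
    by (subst nn_integral_distr) (use measurable_inner_potential[OF K translate_prob[OF \<nu>, of c]] in \<open>simp_all add: translate_def\<close>)
  also have "\<dots> = mutual K \<nu> \<nu>"
    unfolding mutual_def translate_def by (intro nn_integral_cong, subst nn_integral_distr) simp_all
  finally show ?thesis .
qed

lemma translate_translate:
  assumes \<nu>: "\<nu> \<in> prob_measures" shows "translate c (translate (- c) \<nu>) = \<nu>"
proof -
  have s: "sets \<nu> = sets borel" using prob_measuresD \<nu> by auto
  then have [measurable_cong]: "sets \<nu> = sets borel" .
  have "translate c (translate (- c) \<nu>) = distr \<nu> borel (\<lambda>x. x)"
    unfolding translate_def by (subst distr_distr) (auto simp: o_def)
  also have "\<dots> = \<nu>" by (rule distr_id2) (simp add: s)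
  finally show ?thesis .
qed

lemma sq_triangle: "sq (x + y) \<le> 2 * sq x + 2 * sq y"
proof -
  have "(norm (x + y))^2 \<le> 2 * (norm x)^2 + 2 * (norm y)^2"
    using zero_le_power2[of "norm (x - y)"]
    by (simp add: power2_norm_eq_inner inner_add_left inner_add_right inner_diff_left inner_diff_right inner_commute)
  then have "ennreal ((norm (x + y))^2) \<le> ennreal (2 * (norm x)^2 + 2 * (norm y)^2)" by (rule ennreal_leI)
  also have "\<dots> = 2 * sq x + 2 * sq y" by (simp add: sq_def ennreal_mult)
  finally show ?thesis unfolding sq_def .
qed

text \<open>Finite interaction for \<open>|x - y|^2\<close> gives one point with finite potential, hence a finite second
  moment, hence a mean that can be translated to the origin.\<close>

lemma exists_centering:
  assumes \<nu>: "\<nu> \<in> prob_measures" and fin: "mutual sq \<nu> \<nu> < \<infinity>"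
  obtains c where "moment2 (translate c \<nu>) < \<infinity>" "(LINT y|translate c \<nu>. y) = 0"
proof -
  interpret prob_space \<nu> using prob_measuresD \<nu> by auto
  have [measurable_cong]: "sets \<nu> = sets borel" using prob_measuresD \<nu> by auto
  note [measurable] = measurable_inner_potential[OF sq_measurable \<nu>]
  have "AE x in \<nu>. (\<integral>\<^sup>+y. sq (x - y) \<partial>\<nu>) \<noteq> \<infinity>"
    using fin unfolding mutual_def by (intro nn_integral_PInf_AE) auto
  then have "\<exists>x. (\<integral>\<^sup>+y. sq (x - y) \<partial>\<nu>) \<noteq> \<infinity>"
    by (rule contrapos_pp) (simp add: AE_const)
  then obtain a where a: "(\<integral>\<^sup>+y. sq (a - y) \<partial>\<nu>) < \<infinity>" by (auto simp: top.not_eq_extremum)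
  have bound: "(\<integral>\<^sup>+y. sq (y + b) \<partial>\<nu>) < \<infinity>" for b
  proof -
    have "sq (y + b) \<le> 2 * sq (a + b) + 2 * sq (a - y)" for y
      using sq_triangle[of "a + b" "- (a - y)"] by (simp add: sq_def norm_minus_commute algebra_simps)
    then have "(\<integral>\<^sup>+y. sq (y + b) \<partial>\<nu>) \<le> (\<integral>\<^sup>+y. 2 * sq (a + b) + 2 * sq (a - y) \<partial>\<nu>)" by (intro nn_integral_mono)
    also have "\<dots> = 2 * sq (a + b) + 2 * (\<integral>\<^sup>+y. sq (a - y) \<partial>\<nu>)"
      by (simp add: nn_integral_add nn_integral_cmult emeasure_space_1)
    also have "\<dots> < \<infinity>" using a by (simp add: ennreal_mult_less_top sq_def)
    finally show ?thesis .
  qed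
  have i1: "integrable \<nu> (\<lambda>y. y)"
  proof (rule Bochner_Integration.integrable_bound)
    have "integrable \<nu> (\<lambda>y. (norm y)^2)" using bound[of 0] by (intro integrableI_nonneg) (auto simp: sq_def)
    then show "integrable \<nu> (\<lambda>y. 1 + (norm y)^2)" by simp
    show "AE y in \<nu>. norm y \<le> norm (1 + (norm y)^2)" by (simp add: norm_le_one_plus_square add_nonneg_nonneg)
  qed measurable
  define c where "c = - (LINT y|\<nu>. y)"
  show ?thesis
  proof (rule that[of c])
    show "moment2 (translate c \<nu>) < \<infinity>" unfolding moment2_def translate_def
      by (subst nn_integral_distr) (use bound[of c] in simp_all)
    have "(LINT y|translate c \<nu>. y) = (LINT y|\<nu>. y + c)" unfolding translate_def
      by (subst integral_distr) simp_all
    also have "\<dots> = 0" using i1 by (simp add: prob_space c_def)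
    finally show "(LINT y|translate c \<nu>. y) = 0" .
  qed
qed

lemma ennreal_add_right_cancel_leD:
  fixes a b c :: ennreal assumes "a + c \<le> b + c" "c < \<infinity>" shows "a \<le> b"
  using assms ennreal_add_left_cancel_le[of c a b] by (auto simp: add.commute)

text \<open>The Euler--Lagrange inequality and strict positive definiteness determine the minimizer. After
  centring the competitor as \<open>\<mu>\<close>, the quadratic part of the interaction satisfies
  \<open>2 mutual \<mu> \<rho> = mutual \<mu> \<mu> + mutual \<rho> \<rho>\<close>, so that the whole interaction satisfies the inequality
  \<open>2 mutual \<mu> \<rho> \<le> mutual \<mu> \<mu> + mutual \<rho> \<rho>\<close>. The left side is at least \<open>2 L\<close> and \<open>mutual \<rho> \<rho> = L\<close>.\<close>

lemma energy_comparison: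
  assumes s: "1 \<le> s" "s < 2" and cont: "continuous_on UNIV \<Omega>" and per: "\<And>t. \<Omega> (t + pi) = \<Omega> t" and pos: "\<And>t. \<Omega> t > 0"
    and \<rho>: "\<rho> \<in> prob_measures" and \<sigma>: "moment2 \<rho> < \<infinity>"
    and sqpot: "\<And>x. (\<integral>\<^sup>+y. sq (x - y) \<partial>\<rho>) = sq x + moment2 \<rho>"
    and EL: "\<And>x. L \<le> (\<integral>\<^sup>+y. potential s \<Omega> (x - y) \<partial>\<rho>)" "mutual (potential s \<Omega>) \<rho> \<rho> = L" and L: "L < \<infinity>"
    and \<nu>: "\<nu> \<in> prob_measures"
  shows "mutual (potential s \<Omega>) \<rho> \<rho> \<le> mutual (potential s \<Omega>) \<nu> \<nu>"
    and "mutual (potential s \<Omega>) \<nu> \<nu> \<le> mutual (potential s \<Omega>) \<rho> \<rho> \<Longrightarrow> \<exists>c. \<nu> = translate c \<rho>"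
proof -
  let ?W = "potential s \<Omega>" and ?K = "riesz s \<Omega>"
  have [measurable]: "\<Omega> \<in> borel_measurable borel" using cont by (rule borel_measurable_continuous_onI)
  have Km[measurable]: "?K \<in> borel_measurable borel" by (rule borel_measurable_riesz[of \<Omega>, OF per]) measurable
  have Wm: "?W \<in> borel_measurable borel" unfolding potential_eq[of \<Omega>, OF pos] by measurable
  have W: "mutual ?W \<mu>' \<nu>' = mutual ?K \<mu>' \<nu>' + mutual sq \<mu>' \<nu>'" if "\<mu>' \<in> prob_measures" "\<nu>' \<in> prob_measures" for \<mu>' \<nu>'
    unfolding potential_eq[of \<Omega>, OF pos] by (rule mutual_add[OF Km sq_measurable that])
  have key: "mutual ?W \<rho> \<rho> \<le> mutual ?W \<nu> \<nu> \<and> (mutual ?W \<nu> \<nu> \<le> mutual ?W \<rho> \<rho> \<longrightarrow> (\<exists>c. \<nu> = translate c \<rho>))"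
    if fin: "mutual ?W \<nu> \<nu> < \<infinity>"
  proof -
    have "mutual sq \<nu> \<nu> < \<infinity>" using fin W[OF \<nu> \<nu>] by simp
    then obtain c where c: "moment2 (translate c \<nu>) < \<infinity>" "(LINT y|translate c \<nu>. y) = 0"
      using exists_centering[OF \<nu>] by blast
    define \<mu> where "\<mu> = translate c \<nu>"
    have \<mu>: "\<mu> \<in> prob_measures" unfolding \<mu>_def by (rule translate_prob[OF \<nu>])
    have \<mu>\<nu>: "mutual ?W \<mu> \<mu> = mutual ?W \<nu> \<nu>" unfolding \<mu>_def by (rule mutual_translate[OF Wm \<nu>])
    have m: "moment2 \<mu> < \<infinity>" using c by (simp add: \<mu>_def)
    have q\<mu>: "mutual sq \<mu> \<mu> = moment2 \<mu> + moment2 \<mu>"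
      using c by (intro mutual_sq \<mu> sq_potential_centered) (auto simp: \<mu>_def)
    have q\<rho>: "mutual sq \<rho> \<rho> = moment2 \<rho> + moment2 \<rho>" by (intro mutual_sq \<rho> sqpot)
    have qx: "mutual sq \<mu> \<rho> = moment2 \<mu> + moment2 \<rho>" by (intro mutual_sq \<mu> sqpot)
    have K_le: "mutual ?K \<mu>' \<mu>' \<le> mutual ?W \<mu>' \<mu>'" if "\<mu>' \<in> prob_measures" for \<mu>'
      unfolding W[OF that that] by simp
    have K\<mu>: "mutual ?K \<mu> \<mu> < \<infinity>" using K_le[OF \<mu>] fin unfolding \<mu>\<nu> by (rule le_less_trans)
    have K\<rho>: "mutual ?K \<rho> \<rho> < \<infinity>" using K_le[OF \<rho>] L unfolding EL(2) by (rule le_less_trans)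
    note pd = riesz_strictly_pos_def[of s \<Omega>, OF s cont per pos \<mu> \<rho> K\<mu> K\<rho>]
    have Q: "2 * mutual sq \<mu> \<rho> = mutual sq \<mu> \<mu> + mutual sq \<rho> \<rho>"
      unfolding q\<mu> q\<rho> qx mult_2 by (simp only: ac_simps)
    have Qfin: "2 * mutual sq \<mu> \<rho> < \<infinity>" unfolding Q q\<mu> q\<rho> using m \<sigma> by simp
    have sum: "mutual ?W \<mu> \<mu> + mutual ?W \<rho> \<rho> = (mutual ?K \<mu> \<mu> + mutual ?K \<rho> \<rho>) + 2 * mutual sq \<mu> \<rho>"
      unfolding Q W[OF \<mu> \<mu>] W[OF \<rho> \<rho>] by (simp add: ac_simps)
    have dbl: "2 * mutual ?W \<mu> \<rho> = 2 * mutual ?K \<mu> \<rho> + 2 * mutual sq \<mu> \<rho>" unfolding W[OF \<mu> \<rho>] by (simp add: distrib_left)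
    have le: "2 * mutual ?W \<mu> \<rho> \<le> mutual ?W \<mu> \<mu> + mutual ?W \<rho> \<rho>"
      unfolding sum dbl by (intro add_right_mono pd(1))
    have lo: "L \<le> mutual ?W \<mu> \<rho>"
    proof -
      interpret prob_space \<mu> using prob_measuresD \<mu> by auto
      have "L = (\<integral>\<^sup>+x. L \<partial>\<mu>)" by (simp add: emeasure_space_1)
      also have "\<dots> \<le> mutual ?W \<mu> \<rho>" unfolding mutual_def by (intro nn_integral_mono EL(1))
      finally show ?thesis .
    qed
    have "L + L \<le> mutual ?W \<mu> \<mu> + L"
    proof -
      have "L + L \<le> 2 * mutual ?W \<mu> \<rho>" using lo by (simp add: mult_2 add_mono)
      also have "\<dots> \<le> mutual ?W \<mu> \<mu> + L" using le EL(2) by simp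
      finally show ?thesis .
    qed
    then have "L \<le> mutual ?W \<mu> \<mu>" using L by (rule ennreal_add_right_cancel_leD)
    then have first: "mutual ?W \<rho> \<rho> \<le> mutual ?W \<nu> \<nu>" using \<mu>\<nu> EL(2) by simp
    moreover have "\<exists>c. \<nu> = translate c \<rho>" if up: "mutual ?W \<nu> \<nu> \<le> mutual ?W \<rho> \<rho>"
    proof -
      have "mutual ?W \<mu> \<mu> + mutual ?W \<rho> \<rho> \<le> L + L" using up \<mu>\<nu> EL(2) by (simp add: add_mono)
      also have "\<dots> \<le> 2 * mutual ?W \<mu> \<rho>" using lo by (simp add: mult_2 add_mono)
      finally have "(mutual ?K \<mu> \<mu> + mutual ?K \<rho> \<rho>) + 2 * mutual sq \<mu> \<rho> \<le> 2 * mutual ?K \<mu> \<rho> + 2 * mutual sq \<mu> \<rho>"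
        unfolding sum dbl .
      then have "mutual ?K \<mu> \<mu> + mutual ?K \<rho> \<rho> \<le> 2 * mutual ?K \<mu> \<rho>"
        using Qfin by (rule ennreal_add_right_cancel_leD)
      then have "\<mu> = \<rho>" using pd by (intro pd(2) antisym)
      then have "\<nu> = translate (- c) \<rho>" using translate_translate[OF \<nu>, of "- c"] by (simp add: \<mu>_def)
      then show ?thesis by blast
    qed
    ultimately show ?thesis by blast
  qed
  show "mutual ?W \<rho> \<rho> \<le> mutual ?W \<nu> \<nu>"
  proof (cases "mutual ?W \<nu> \<nu> < \<infinity>")
    case False
    then show ?thesis by (simp add: not_less top_unique)
  qed (use key in blast)
  show "\<exists>c. \<nu> = translate c \<rho>" if "mutual ?W \<nu> \<nu> \<le> mutual ?W \<rho> \<rho>"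
  proof -
    have "mutual ?W \<nu> \<nu> < \<infinity>" using that L unfolding EL(2) by (rule le_less_trans)
    then show ?thesis using key that by blast
  qed
qed

section \<open>The ellipse as equilibrium measure\<close>

lemma R2_pos: assumes "1 \<le> s" "s < 2" shows "R2 s > 0" "C2 s * R2 s powr (s + 2) = (s + 2) / (2 * pi)"
proof -
  have sp: "sin (s * pi / 2) > 0" using assms by (intro sin_gt_zero) auto
  define X where "X = 8 * sin (s * pi / 2) / (s^2 * (2 + s) * pi)"
  have X: "X > 0" unfolding X_def using sp assms by simp
  then show "R2 s > 0" by (simp add: R2_def X_def[symmetric])
  have "R2 s powr (s + 2) = X powr (- 1)" unfolding R2_def X_def[symmetric] powr_powr using assms by simp
  also have "\<dots> = 1 / X" using X by (simp add: powr_minus_divide)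
  also have "C2 s * (1 / X) = (s + 2) / (2 * pi)"
  proof -
    have "4 * S / (a * pi^2) = 8 * S / (a * b * pi) * (b / (2 * pi))" if "a \<noteq> 0" "b \<noteq> 0" for S a b :: real
      using that by (simp add: power2_eq_square field_simps)
    from this[of "s^2" "2 + s"] have "C2 s = X * ((s + 2) / (2 * pi))"
      unfolding C2_def X_def using assms by (simp add: add.commute)
    then show ?thesis using X by simp
  qed
  finally show "C2 s * R2 s powr (s + 2) = (s + 2) / (2 * pi)" by simp
qed

text \<open>The densities of the statement are the normalised elliptic profiles: the semi-axes of the support of
  \<open>rho_ab s a b\<close> are \<open>a R2 s\<close> and \<open>b R2 s\<close>, and the constants agree because both densities have mass one.\<close>

lemma rho_ab_eq_ellipse_density:
  assumes s: "1 \<le> s" "s < 2" and uv: "u > 0" "v > 0"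
  shows "rho_ab s (1 / (R2 s * sqrt u)) (1 / (R2 s * sqrt v)) y = ellipse_density s u v y / ellipse_mass s u v"
proof -
  let ?R = "R2 s" and ?t = "1 - u * (y $ 1)^2 - v * (y $ 2)^2"
  note R = R2_pos[OF s]
  have n: "(norm (vector [y $ 1 / (1 / (?R * sqrt u)), y $ 2 / (1 / (?R * sqrt v))] :: real^2))^2
      = ?R^2 * (u * (y $ 1)^2 + v * (y $ 2)^2)"
    unfolding norm_vec2 vector_2 using uv by (simp add: power_mult_distrib distrib_left ac_simps)
  have "max 0 (?R^2 - ?R^2 * (u * (y $ 1)^2 + v * (y $ 2)^2)) = ?R^2 * max 0 ?t"
  proof -
    have "?R^2 - ?R^2 * (u * (y $ 1)^2 + v * (y $ 2)^2) = ?R^2 * ?t" by (simp add: algebra_simps)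
    moreover have "max 0 (c * z) = c * max 0 z" if "c > 0" for c z :: real
      using that by (simp add: max_def zero_le_mult_iff)
    ultimately show ?thesis using R(1) by simp
  qed
  moreover have "(?R^2 * max 0 ?t) powr (s / 2) = ?R powr s * (max 0 ?t) powr (s / 2)"
    using square_powr_half[OF R(1), of s] R(1) by (simp add: powr_mult)
  moreover have "1 / (1 / (?R * sqrt u) * (1 / (?R * sqrt v))) = ?R powr 2 * sqrt (u * v)"
    using R(1) uv by (simp add: real_sqrt_mult power2_eq_square)
  ultimately have "rho_ab s (1 / (?R * sqrt u)) (1 / (?R * sqrt v)) y
      = ?R powr 2 * sqrt (u * v) * (C2 s * (?R powr s * ellipse_density s u v y))"
    unfolding rho_ab_def rho2_def n ellipse_density_def by simp
  also have "\<dots> = sqrt (u * v) * (C2 s * (?R powr s * ?R powr 2)) * ellipse_density s u v y"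
    by (simp only: ac_simps)
  also have "?R powr s * ?R powr 2 = ?R powr (s + 2)" by (simp only: powr_add)
  also have "C2 s * ?R powr (s + 2) = (s + 2) / (2 * pi)" by (rule R(2))
  finally show ?thesis by (simp add: ellipse_mass_def mult.commute mult.left_commute)
qed

definition ellipse_measure :: "real \<Rightarrow> real \<Rightarrow> real \<Rightarrow> (real^2) measure" where
  "ellipse_measure s u v = density lborel (\<lambda>y. ennreal (ellipse_density s u v y / ellipse_mass s u v))"

context
  fixes s u v :: real
  assumes s: "1 \<le> s" "s < 2" and uv: "u > 0" "v > 0"
begin

lemma ellipse_mass_pos: "ellipse_mass s u v > 0"
  using s uv by (simp add: ellipse_mass_def)

lemma nn_integral_ellipse_measure:
  "g \<in> borel_measurable borel \<Longrightarrow> (\<integral>\<^sup>+y. g y \<partial>ellipse_measure s u v) =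
    (\<integral>\<^sup>+y. g y * ennreal (ellipse_density s u v y / ellipse_mass s u v) \<partial>lborel)"
  unfolding ellipse_measure_def by (subst nn_integral_density) (auto simp: mult.commute)

lemma ellipse_measure_prob: "ellipse_measure s u v \<in> prob_measures"
proof -
  have "emeasure (ellipse_measure s u v) UNIV = (\<integral>\<^sup>+y. ennreal (1 / ellipse_mass s u v) * ennreal (ellipse_density s u v y) \<partial>lborel)"
    unfolding ellipse_measure_def using ellipse_mass_pos
    by (subst emeasure_density) (auto intro!: nn_integral_cong simp: ennreal_mult[symmetric] ellipse_density_def)
  also have "\<dots> = ennreal (1 / ellipse_mass s u v) * ennreal (ellipse_mass s u v)"
    using nn_integral_ellipse_density[of s u v] s uv
    by (subst nn_integral_cmult) (auto simp: ellipse_mass_def)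
  also have "\<dots> = 1" using ellipse_mass_pos by (simp add: ennreal_mult[symmetric])
  finally show ?thesis by (auto simp: prob_measures_def ellipse_measure_def intro!: prob_spaceI)
qed

lemma ellipse_density_outside: "1 - u * (y $ 1)^2 - v * (y $ 2)^2 \<le> 0 \<Longrightarrow> ellipse_density s u v y = 0"
  by (simp add: ellipse_density_def max_def)

lemma ellipse_measure_moment: "moment2 (ellipse_measure s u v) < \<infinity>"
proof -
  let ?p = "\<lambda>y. ennreal (ellipse_density s u v y / ellipse_mass s u v)"
  interpret prob_space "ellipse_measure s u v" using prob_measuresD ellipse_measure_prob by auto
  have b: "(norm y)^2 \<le> 1 / u + 1 / v" if "ellipse_density s u v y \<noteq> 0" for y
  proof -
    have in_e: "u * (y $ 1)^2 + v * (y $ 2)^2 < 1" using ellipse_density_outside[of y] that by fastforce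
    have "u * (y $ 1)^2 \<ge> 0" "v * (y $ 2)^2 \<ge> 0" using uv by simp_all
    then have "u * (y $ 1)^2 \<le> 1" "v * (y $ 2)^2 \<le> 1" using in_e by linarith+
    then show ?thesis unfolding norm_vec2 using uv by (intro add_mono) (simp_all add: field_simps)
  qed
  have "moment2 (ellipse_measure s u v) \<le> (\<integral>\<^sup>+y. ennreal (1 / u + 1 / v) \<partial>ellipse_measure s u v)"
    unfolding moment2_def
  proof (subst (1 2) nn_integral_ellipse_measure)
    show "(\<integral>\<^sup>+y. sq y * ?p y \<partial>lborel)
        \<le> (\<integral>\<^sup>+y. ennreal (1 / u + 1 / v) * ?p y \<partial>lborel)"
    proof (rule nn_integral_mono)
      fix y
      show "sq y * ?p y \<le> ennreal (1 / u + 1 / v) * ?p y"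
        using b[of y] unfolding sq_def
        by (cases "ellipse_density s u v y = 0") (auto intro!: mult_right_mono ennreal_leI simp del: ennreal_plus)
    qed
  qed auto
  also have "\<dots> < \<infinity>" by (simp add: emeasure_space_1 del: ennreal_plus)
  finally show ?thesis .
qed

text \<open>Adding the integrals for \<open>x - y\<close> and \<open>x + y\<close>, which are equal by symmetry, cancels the mixed term.\<close>

lemma ellipse_measure_sq: "(\<integral>\<^sup>+y. sq (x - y) \<partial>ellipse_measure s u v) = sq x + moment2 (ellipse_measure s u v)"
proof -
  let ?\<rho> = "ellipse_measure s u v"
  interpret prob_space ?\<rho> using prob_measuresD ellipse_measure_prob by auto
  have [measurable_cong]: "sets ?\<rho> = sets borel" using prob_measuresD ellipse_measure_prob by auto
  have e: "ellipse_density s u v (- y) = ellipse_density s u v y" for y by (simp add: ellipse_density_def)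
  have refl: "(\<integral>\<^sup>+y. sq (x - y) \<partial>?\<rho>) = (\<integral>\<^sup>+y. sq (x + y) \<partial>?\<rho>)"
    using nn_integral_lborel_reflect[of "\<lambda>y. sq (x - y) * ennreal (ellipse_density s u v y / ellipse_mass s u v)" 0]
    by (simp add: nn_integral_ellipse_measure e)
  have par: "sq (x - y) + sq (x + y) = 2 * sq x + 2 * sq y" for y
  proof -
    have "(norm (x - y))^2 + (norm (x + y))^2 = 2 * (norm x)^2 + 2 * (norm y)^2"
      by (simp add: power2_norm_eq_inner inner_add_left inner_add_right inner_diff_left inner_diff_right inner_commute)
    then have "ennreal ((norm (x - y))^2 + (norm (x + y))^2) = ennreal (2 * (norm x)^2 + 2 * (norm y)^2)" by (rule arg_cong)
    then show ?thesis by (simp add: sq_def ennreal_mult)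
  qed
  have "2 * (\<integral>\<^sup>+y. sq (x - y) \<partial>?\<rho>) = (\<integral>\<^sup>+y. sq (x - y) + sq (x + y) \<partial>?\<rho>)"
    by (subst nn_integral_add) (simp_all add: refl mult_2)
  also have "\<dots> = 2 * (sq x + moment2 ?\<rho>)"
    unfolding par by (simp add: nn_integral_add nn_integral_cmult emeasure_space_1 moment2_def distrib_left)
  finally show ?thesis by (rule ennreal_cancel_left_eq[rotated 2]) simp_all
qed

text \<open>The total potential is constant on the open ellipse, which carries the measure, and at least as
  large elsewhere. Where \<open>c - |x|^2\<close> is negative and \<open>ennreal\<close> truncates it to zero, \<open>|x|^2\<close> alone exceeds \<open>c\<close>.\<close>

lemma ellipse_measure_equilibrium:
  assumes cont: "continuous_on UNIV \<Omega>" and per: "\<And>t. \<Omega> (t + pi) = \<Omega> t" and pos: "\<And>t. \<Omega> t > 0" and even: "\<And>t. \<Omega> (- t) = \<Omega> t"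
    and bal: "chord_const s * curvature1 s \<Omega> u v = ellipse_mass s u v" "chord_const s * curvature2 s \<Omega> u v = ellipse_mass s u v"
  shows "\<exists>L<\<infinity>. mutual (potential s \<Omega>) (ellipse_measure s u v) (ellipse_measure s u v) = L \<and>
    (\<forall>x. L \<le> (\<integral>\<^sup>+y. potential s \<Omega> (x - y) \<partial>ellipse_measure s u v))"
proof -
  let ?p = "\<lambda>y. ennreal (ellipse_density s u v y / ellipse_mass s u v)"
  let ?\<rho> = "ellipse_measure s u v" and ?W = "potential s \<Omega>"
  interpret prob_space ?\<rho> using prob_measuresD ellipse_measure_prob by auto
  have [measurable_cong]: "sets ?\<rho> = sets borel" using prob_measuresD ellipse_measure_prob by auto
  have [measurable]: "\<Omega> \<in> borel_measurable borel" using cont by (rule borel_measurable_continuous_onI)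
  have Km[measurable]: "riesz s \<Omega> \<in> borel_measurable borel" by (rule borel_measurable_riesz[of \<Omega>, OF per]) measurable
  have Wm: "?W \<in> borel_measurable borel" unfolding potential_eq[of \<Omega>, OF pos] by measurable
  define c where "c = chord_const s * (LINT \<tau>|lborel. slope_weight s \<Omega> u v \<tau>) / ellipse_mass s u v"
  define V where "V x = (\<integral>\<^sup>+y. ?W (x - y) \<partial>?\<rho>)" for x
  define L where "L = ennreal c + moment2 ?\<rho>"
  note eq = equilibrium_potential[of s \<Omega>, OF s per cont pos even uv bal, folded c_def]
  have V: "V x = (\<integral>\<^sup>+y. riesz s \<Omega> (x - y) * ?p y \<partial>lborel) + (sq x + moment2 ?\<rho>)" for x
  proof -
    have "V x = (\<integral>\<^sup>+y. riesz s \<Omega> (x - y) \<partial>?\<rho>) + (\<integral>\<^sup>+y. sq (x - y) \<partial>?\<rho>)"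
      unfolding V_def potential_eq[of \<Omega>, OF pos] by (rule nn_integral_add) measurable
    then show ?thesis unfolding ellipse_measure_sq by (simp add: nn_integral_ellipse_measure)
  qed
  have n: "c - (x $ 1)^2 - (x $ 2)^2 = c - (norm x)^2" for x :: "real^2" by (simp add: norm_vec2)
  have lo: "L \<le> V x" for x
  proof -
    have "ennreal c \<le> ennreal (c - (norm x)^2) + sq x"
      unfolding sq_def by (cases "c - (norm x)^2 \<ge> 0") (auto simp: ennreal_plus[symmetric] ennreal_neg intro!: ennreal_leI simp del: ennreal_plus)
    also have "\<dots> \<le> (\<integral>\<^sup>+y. riesz s \<Omega> (x - y) * ?p y \<partial>lborel) + sq x"
      using eq(1)[of x] unfolding n by (intro add_right_mono)
    finally show ?thesis unfolding L_def V add.assoc[symmetric] by (rule add_right_mono)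
  qed
  have inside: "V x = L" if x: "0 < 1 - u * (x $ 1)^2 - v * (x $ 2)^2" for x
  proof -
    have "0 \<le> c - (norm x)^2" using eq(3)[OF x] unfolding n .
    then have "ennreal (c - (norm x)^2) + sq x = ennreal c" unfolding sq_def by (simp flip: ennreal_plus)
    then show ?thesis unfolding L_def V eq(2)[OF x] n add.assoc[symmetric] by simp
  qed
  have "mutual ?W ?\<rho> ?\<rho> = (\<integral>\<^sup>+x. V x \<partial>?\<rho>)" unfolding mutual_def V_def ..
  also have "\<dots> = (\<integral>\<^sup>+x. L \<partial>?\<rho>)"
  proof -
    have "V \<in> borel_measurable borel" unfolding V_def[abs_def] by (rule measurable_inner_potential[OF Wm ellipse_measure_prob])
    then have "(\<integral>\<^sup>+x. V x \<partial>?\<rho>) = (\<integral>\<^sup>+y. V y * ?p y \<partial>lborel)"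
      by (rule nn_integral_ellipse_measure)
    also have "\<dots> = (\<integral>\<^sup>+y. L * ?p y \<partial>lborel)"
    proof (rule nn_integral_cong)
      fix y
      show "V y * ?p y = L * ?p y"
        using inside[of y] ellipse_density_outside[of y] by (cases "0 < 1 - u * (y $ 1)^2 - v * (y $ 2)^2") auto
    qed
    also have "\<dots> = (\<integral>\<^sup>+x. L \<partial>?\<rho>)" by (rule nn_integral_ellipse_measure[symmetric]) simp
    finally show ?thesis .
  qed
  also have "\<dots> = L" by (simp add: emeasure_space_1)
  finally have "mutual ?W ?\<rho> ?\<rho> = L" .
  moreover have "L < \<infinity>" using ellipse_measure_moment by (simp add: L_def)
  ultimately show ?thesis using lo unfolding V_def by blast
qed

end

theorem theorem8p3:
  fixes s :: real and \<Omega> :: "real \<Rightarrow> real"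
  assumes "1 \<le> s" and "s < 2"
    and "smooth \<Omega>"
    and "\<And>\<theta>. \<Omega> \<theta> > 0"
    and "\<And>\<theta>. \<Omega> (\<theta> + pi) = \<Omega> \<theta>"
    and "\<And>\<theta>. \<Omega> \<theta> = \<Omega> (- \<theta>)"
  shows "\<exists>a b. a > 0 \<and> b > 0 \<and>
    unique_minimizer_up_to_translation (potential s \<Omega>)
      (density lborel (\<lambda>x. ennreal (rho_ab s a b x)))"
proof -
  let ?W = "potential s \<Omega>"
  note s = assms(1,2) and pos = assms(4) and per = assms(5)
  have even: "\<Omega> (- t) = \<Omega> t" for t using assms(6)[of t] by simp
  have "\<Omega> differentiable (at x)" for x using assms(3)[unfolded smooth_def, rule_format, of 0 x] by simp
  then have cont: "continuous_on UNIV \<Omega>"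
    by (simp add: continuous_at_imp_continuous_on differentiable_imp_continuous_within)
  obtain u v where uv: "u > 0" "v > 0" and bal: "chord_const s * curvature1 s \<Omega> u v = ellipse_mass s u v" "chord_const s * curvature2 s \<Omega> u v = ellipse_mass s u v"
    using exists_equilibrium_axes[of s \<Omega>, OF s per cont pos] by blast
  define \<rho> where "\<rho> = ellipse_measure s u v"
  have \<rho>: "\<rho> \<in> prob_measures" unfolding \<rho>_def by (rule ellipse_measure_prob[OF s uv])
  obtain L where L: "L < \<infinity>" "mutual ?W \<rho> \<rho> = L" "\<And>x. L \<le> (\<integral>\<^sup>+y. ?W (x - y) \<partial>\<rho>)"
    using ellipse_measure_equilibrium[OF s uv cont per pos even bal] unfolding \<rho>_def by blast
  have energy_iff: "energy ?W \<mu> \<le> energy ?W \<nu> \<longleftrightarrow> mutual ?W \<mu> \<mu> \<le> mutual ?W \<nu> \<nu>" for \<mu> \<nu>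
  proof -
    have e: "energy ?W \<mu> = inverse 2 * mutual ?W \<mu> \<mu>" for \<mu>
      by (simp add: energy_def mutual_def divide_ennreal_def mult.commute)
    have "inverse (2::ennreal) > 0" "inverse (2::ennreal) < \<infinity>"
      using ennreal_less_zero_iff[of "1 / 2"] ennreal_less_top[of "1 / 2"] by simp_all
    from ennreal_cancel_left[OF this] show ?thesis unfolding e .
  qed
  note cmp = energy_comparison[of s \<Omega> \<rho> L, OF s cont per pos \<rho> _ _ L(3,2,1)]
  have cmp': "mutual ?W \<rho> \<rho> \<le> mutual ?W \<nu> \<nu>" "mutual ?W \<nu> \<nu> \<le> mutual ?W \<rho> \<rho> \<Longrightarrow> \<exists>c. \<nu> = translate c \<rho>"
    if "\<nu> \<in> prob_measures" for \<nu>
    using cmp[OF _ _ that] ellipse_measure_moment[OF s uv] ellipse_measure_sq[OF s uv] unfolding \<rho>_def by blast+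
  have "unique_minimizer_up_to_translation ?W \<rho>"
    unfolding unique_minimizer_up_to_translation_def is_minimizer_def energy_iff
    using \<rho> cmp' by blast
  moreover have "\<rho> = density lborel (\<lambda>x. ennreal (rho_ab s (1 / (R2 s * sqrt u)) (1 / (R2 s * sqrt v)) x))"
    unfolding \<rho>_def ellipse_measure_def rho_ab_eq_ellipse_density[OF s uv] ..
  moreover have "1 / (R2 s * sqrt u) > 0" "1 / (R2 s * sqrt v) > 0" using R2_pos[OF s] uv by simp_all
  ultimately show ?thesis by metis
qed

end
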